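(* Let $G=P_1\times P_2\times\cdots\times P_k$ be a finite nilpotent group, where $k\ge 2$ and $P_1,\dots,P_k$ are the (nontrivial) Sylow subgroups of $G$ for the distinct primes $p_1,\dots,p_k$ dividing $|G|$. Let $x_1,\ldots,x_s$ be a system of representatives of the twin equivalence classes of $V(\mathcal{D}(G))$. (1) If $G\cong\mathbb{Z}_{2^n}\times G'$ with $n>1$, or $G\cong Q_{4m}\times G'$ with $m=2^r$, $r\ge 1$, where in either case $G'$ is the Sylow $p$-subgroup of $G$ for some odd prime $p$ and $G'$ has a maximal cyclic subgroup of prime order, then $$S=(V(\mathcal{D}(G))\setminus\{x_1,\ldots,x_s\})\cup\{z\},$$ where $z$ is the representative among $x_1,\dots,x_s$ with $o(z)=2$, is a resolving set of $\mathcal{D}(G)$. (2) Otherwise, $$S=V(\mathcal{D}(G))\setminus\{x_1,\ldots,x_s\}$$ is a resolving set of $\mathcal{D}(G)$. Moreover, $\dim(\mathcal{D}(G))\in\{\alpha,\alpha-1\}$, where $$\alpha=|G|-\big(|M(P_1)|\,|M(P_2)|\cdots|M(P_k)|+|\overline{G}|\big).$$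
   Context: For a finite group $G$, the power graph $\mathcal{P}(G)$ is the simple graph with vertex set $G$ in which distinct $x,y$ are adjacent iff $x\in\langle y\rangle$ or $y\in\langle x\rangle$. The enhanced power graph $\mathcal{P}_E(G)$ is the simple graph with vertex set $G$ in which distinct $x,y$ are adjacent iff both belong to some common cyclic subgroup of $G$. The difference graph $\mathcal{D}(G)$ is obtained from $\mathcal{P}_E(G)$ by removing all edges of $\mathcal{P}(G)$ and then deleting all isolated vertices; $V(\mathcal{D}(G))$ is its vertex set. Two vertices $u,v$ of a graph are twins if $N(u)=N(v)$ or $N[u]=N[v]$, where $N(u)$ is the open neighbourhood and $N[u]=N(u)\cup\{u\}$. Being twins in $\mathcal{D}(G)$ is an equivalence relation on $V(\mathcal{D}(G))$; $\overline{G}$ denotes the set of its equivalence classes (so $|\overline{G}|=s$). A vertex $z$ resolves vertices $x,y$ of a graph if $d(x,z)\ne d(y,z)$, where $d$ is graph distance. A set $W$ of vertices is a resolving set if every pair of distinct vertices is resolved by some vertex in $W$. The metric dimension $\dim(\Gamma)$ is the minimum size of a resolving set of $\Gamma$. A cyclic subgroup of a group $H$ is maximal cyclic if it is not properly contained in any cyclic subgroup of $H$; $M(H)$ denotes the set of all elements of $H$ that generate a maximal cyclic subgroup of $H$. The order of $x$ is denoted $o(x)$. For $m\ge 2$, $Q_{4m}=\langle a,b\mid a^{2m}=e,\ a^m=b^2,\ ab=ba^{-1}\rangle$ is the generalized quaternion group of order $4m$. *)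

theory Defs
  imports
    "HOL-Algebra.Algebra"
    "HOL-Computational_Algebra.Primes"
    "Graph_Theory.Graph_Theory"
begin

hide_const (open) Divisibility.prime

primrec lower_central :: "('a, 'b) monoid_scheme \<Rightarrow> nat \<Rightarrow> 'a set" where
  "lower_central G 0 = carrier G"
| "lower_central G (Suc n) =
     generate G (\<Union>x \<in> lower_central G n. \<Union>y \<in> carrier G.
       {x \<otimes>\<^bsub>G\<^esub> y \<otimes>\<^bsub>G\<^esub> inv\<^bsub>G\<^esub> x \<otimes>\<^bsub>G\<^esub> inv\<^bsub>G\<^esub> y})"

definition nilpotent_group :: "('a, 'b) monoid_scheme \<Rightarrow> bool" where
  "nilpotent_group G \<longleftrightarrow> group G \<and> (\<exists>n. lower_central G n = {\<one>\<^bsub>G\<^esub>})"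

definition sylow_subgroup :: "nat \<Rightarrow> 'a set \<Rightarrow> ('a, 'b) monoid_scheme \<Rightarrow> bool" where
  "sylow_subgroup p H G \<longleftrightarrow>
     prime p \<and> subgroup H G \<and> card H = p ^ multiplicity p (order G)"

definition cyclic_subgroup :: "'a set \<Rightarrow> ('a, 'b) monoid_scheme \<Rightarrow> bool" where
  "cyclic_subgroup C H \<longleftrightarrow> subgroup C H \<and> cyclic_group (H\<lparr>carrier := C\<rparr>)"

definition maximal_cyclic_subgroup :: "'a set \<Rightarrow> ('a, 'b) monoid_scheme \<Rightarrow> bool" where
  "maximal_cyclic_subgroup C H \<longleftrightarrow>
     cyclic_subgroup C H \<and> \<not> (\<exists>C'. cyclic_subgroup C' H \<and> C \<subset> C')"

definition maximal_cyclic_generators :: "('a, 'b) monoid_scheme \<Rightarrow> 'a set" where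
  "maximal_cyclic_generators H =
     {x \<in> carrier H. maximal_cyclic_subgroup (generate H {x}) H}"

text \<open>
  The generalized quaternion group of order \<open>4 * m\<close>, with presentation
  \<open>a^(2 * m) = e, a^m = b^2, a * b = b * a^(-1)\<close>. The pair \<open>(i, t)\<close> is the normal form
  \<open>a^i * b\<close> (if \<open>t\<close>) or \<open>a^i\<close> (if not \<open>t\<close>); the product formula uses
  \<open>b * a^j = a^(-j) * b\<close> and \<open>b^2 = a^m\<close>. The lemmas below show that this is the group
  given by the presentation: it is generated by two elements that satisfy the relations, and
  any two elements of a group that satisfy them are the images of \<open>a\<close> and \<open>b\<close> under a
  homomorphism.
\<close>

definition generalized_quaternion :: "nat \<Rightarrow> (int \<times> bool) monoid" where
  "generalized_quaternion m =
     \<lparr>carrier = {0..<2 * int m} \<times> UNIV,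
      monoid.mult = (\<lambda>(i, s) (j, t).
        ((i + (if s then - j else j) + (if s \<and> t then int m else 0)) mod (2 * int m), s \<noteq> t)),
      one = (0, False)\<rparr>"

lemma generalized_quaternion_group:
  assumes "m > 0"
  shows "group (generalized_quaternion m)"
proof (rule groupI, goal_cases)
  case (3 x y z)
  obtain i s j t k u where [simp]: "x = (i, s)" "y = (j, t)" "z = (k, u)"
    by (metis surj_pair)
  let ?n = "2 * int m"
  have e1: "(a mod ?n + b + c) mod ?n = (a + b + c) mod ?n" for a b c
    by (metis mod_add_left_eq add.assoc)
  have e2: "(a + b mod ?n + c) mod ?n = (a + b + c) mod ?n" for a b c
    by (metis mod_add_right_eq mod_add_left_eq)
  have e3: "(a + - (b mod ?n) + c) mod ?n = (a - b + c) mod ?n" for a b c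
    using mod_add_left_eq[of "a - b mod ?n" ?n c] mod_add_left_eq[of "a - b" ?n c]
    by (simp add: mod_diff_right_eq)
  have e4: "(i - (j - k + int m) + int m) mod ?n = (i - j + k) mod ?n"
    by (simp add: algebra_simps)
  have e5: "(i - (j - k) + int m) mod ?n = (i - j + int m + k) mod ?n"
    by (simp add: algebra_simps)
  have e6: "(i - (j + k) + int m) mod ?n = (i - j + - k + int m) mod ?n"
    by (simp add: algebra_simps)
  have e7: "(i - (j - k + int m)) mod ?n = (i - j + int m + k) mod ?n"
  proof -
    have "i - j + int m + k = (i - (j - k + int m)) + ?n" by simp
    then show ?thesis by (metis mod_add_self2)
  qed
  have e8: "(i - j + int m + - k + int m) mod ?n = (i - (j + k)) mod ?n"
  proof -
    have "i - j + int m + - k + int m = (i - (j + k)) + ?n" by simp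
    then show ?thesis by (metis mod_add_self2)
  qed
  note f = e1[of _ _ 0, simplified] e2[of _ _ 0, simplified] e3[of _ _ 0, simplified]
  show ?case
    using e1 e2 e3 e4 e5 e6 e7 e8
    by (cases s; cases t; cases u)
       (simp_all add: generalized_quaternion_def f algebra_simps mod_simps)
next
  case (5 x)
  obtain i s where x: "x = (i, s)" by fastforce
  show ?case
  proof (cases s)
    case True
    have "((i + int m) mod (2 * int m) - i + int m) mod (2 * int m) =
        ((i + int m) + (int m - i)) mod (2 * int m)"
      using mod_add_left_eq[of "i + int m" "2 * int m" "int m - i"] by (simp add: algebra_simps)
    then show ?thesis using True assms
      by (intro bexI[of _ "((i + int m) mod (2 * int m), True)"])
         (auto simp: x generalized_quaternion_def mod_simps)
  next
    case False
    then show ?thesis using assms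
      by (intro bexI[of _ "((- i) mod (2 * int m), False)"])
         (auto simp: x generalized_quaternion_def mod_simps)
  qed
qed (use assms in \<open>auto simp: generalized_quaternion_def\<close>)

lemma order_generalized_quaternion: "order (generalized_quaternion m) = 4 * m"
  by (simp add: order_def generalized_quaternion_def card_cartesian_product UNIV_bool)

lemma generalized_quaternion_pow:
  assumes "m > 0"
  shows "(1, False) [^]\<^bsub>generalized_quaternion m\<^esub> (n::nat) = (int n mod (2 * int m), False)"
  by (induction n) (auto simp: generalized_quaternion_def mod_simps add.commute)

lemma generalized_quaternion_relations:
  fixes m :: nat
  assumes "m \<ge> 2"
  defines "Q \<equiv> generalized_quaternion m" and "a \<equiv> (1, False)" and "b \<equiv> (0, True)"
  shows "a \<in> carrier Q" "b \<in> carrier Q"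
    and "a [^]\<^bsub>Q\<^esub> (2 * m) = \<one>\<^bsub>Q\<^esub>"
    and "a [^]\<^bsub>Q\<^esub> m = b [^]\<^bsub>Q\<^esub> (2::nat)"
    and "a \<otimes>\<^bsub>Q\<^esub> b = b \<otimes>\<^bsub>Q\<^esub> inv\<^bsub>Q\<^esub> a"
    and "generate Q {a, b} = carrier Q"
proof -
  interpret Q: group Q
    unfolding Q_def using assms by (intro generalized_quaternion_group) auto
  have pow: "a [^]\<^bsub>Q\<^esub> (n::nat) = (int n mod (2 * int m), False)" for n
    unfolding Q_def a_def using assms by (intro generalized_quaternion_pow) auto
  show a: "a \<in> carrier Q" and b: "b \<in> carrier Q"
    using assms by (auto simp: Q_def a_def b_def generalized_quaternion_def)
  show "a [^]\<^bsub>Q\<^esub> (2 * m) = \<one>\<^bsub>Q\<^esub>"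
    unfolding pow by (simp add: Q_def generalized_quaternion_def)
  show "a [^]\<^bsub>Q\<^esub> m = b [^]\<^bsub>Q\<^esub> (2::nat)"
    unfolding pow using assms
    by (simp add: Q_def b_def generalized_quaternion_def numeral_2_eq_2)
  have "inv\<^bsub>Q\<^esub> a = (2 * int m - 1, False)"
    using assms by (intro Q.inv_equality a)
      (auto simp: Q_def a_def generalized_quaternion_def)
  moreover have "(1 - 2 * int m) mod (2 * int m) = 1"
    using assms by (simp add: minus_mod_self2)
  ultimately show "a \<otimes>\<^bsub>Q\<^esub> b = b \<otimes>\<^bsub>Q\<^esub> inv\<^bsub>Q\<^esub> a"
    using assms by (simp add: Q_def a_def b_def generalized_quaternion_def)
  show "generate Q {a, b} = carrier Q"
  proof
    show "generate Q {a, b} \<subseteq> carrier Q"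
      using a b by (intro Q.generate_incl) auto
    have sub: "subgroup (generate Q {a, b}) Q"
      using a b by (intro Q.generate_is_subgroup) auto
    have ga: "a [^]\<^bsub>Q\<^esub> (n::nat) \<in> generate Q {a, b}" for n
      by (induction n)
        (auto intro: generate.one generate.eng generate.incl)
    show "carrier Q \<subseteq> generate Q {a, b}"
    proof
      fix x assume x: "x \<in> carrier Q"
      obtain i t where it: "x = (i, t)" by fastforce
      then have i: "0 \<le> i" "i < 2 * int m"
        using x by (auto simp: Q_def generalized_quaternion_def)
      have 1: "(i, False) \<in> generate Q {a, b}"
        using ga[of "nat i"] i by (simp add: pow)
      have "(i, False) \<otimes>\<^bsub>Q\<^esub> b = (i, True)"
        using i by (simp add: Q_def b_def generalized_quaternion_def)
      moreover have "(i, False) \<otimes>\<^bsub>Q\<^esub> b \<in> generate Q {a, b}"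
        using 1 by (auto intro: generate.eng generate.incl)
      ultimately show "x \<in> generate Q {a, b}"
        using 1 it by (cases t) auto
    qed
  qed
qed

lemma generalized_quaternion_universal:
  fixes H (structure) and m :: nat
  assumes "group H" and xy: "x \<in> carrier H" "y \<in> carrier H"
    and x2m: "x [^] (2 * m) = \<one>" and xm: "x [^] m = y [^] (2::nat)"
    and rel: "x \<otimes> y = y \<otimes> inv x" and "m \<ge> 2"
  shows "\<exists>f \<in> hom (generalized_quaternion m) H. f (1, False) = x \<and> f (0, True) = y"
proof -
  interpret H: group H by fact
  define f where "f = (\<lambda>(i::int, t). x [^] i \<otimes> (if t then y else \<one>))"
  have xmod: "x [^] (i mod (2 * int m)) = x [^] i" for i :: int
  proof -
    have "x [^] i = x [^] (2 * int m * (i div (2 * int m)) + i mod (2 * int m))" by simp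
    also have "\<dots> = (x [^] (2 * int m)) [^] (i div (2 * int m)) \<otimes> x [^] (i mod (2 * int m))"
      using xy by (simp only: H.int_pow_mult H.int_pow_pow)
    also have "x [^] (2 * int m) = \<one>"
      using x2m by (metis int_pow_int of_nat_mult of_nat_numeral)
    finally show ?thesis using xy by (simp add: H.int_pow_one)
  qed
  have y2: "y \<otimes> y = x [^] (int m)"
    using xm xy by (simp add: numeral_2_eq_2 int_pow_int)
  have conj: "y \<otimes> x \<otimes> inv y = inv x"
  proof -
    have "x \<otimes> (y \<otimes> x) = y"
      using rel xy by (metis H.inv_closed H.m_assoc H.l_inv H.r_one)
    then have "y \<otimes> x = inv x \<otimes> y"
      using xy by (metis H.inv_solve_left H.m_closed)
    then show ?thesis using xy by (simp add: H.m_assoc)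
  qed
  have comm: "y \<otimes> x [^] j = x [^] (- j) \<otimes> y" for j :: int
  proof -
    interpret h: group_hom H H "\<lambda>g. y \<otimes> g \<otimes> inv y"
    proof unfold_locales
      have "y \<otimes> (g \<otimes> h) \<otimes> inv y = y \<otimes> g \<otimes> inv y \<otimes> (y \<otimes> h \<otimes> inv y)"
        if "g \<in> carrier H" "h \<in> carrier H" for g h
      proof -
        have "inv y \<otimes> (y \<otimes> (h \<otimes> inv y)) = h \<otimes> inv y"
          using that xy by (metis H.inv_closed H.l_inv H.l_one H.m_assoc H.m_closed)
        then show ?thesis using that xy by (simp add: H.m_assoc)
      qed
      then show "(\<lambda>g. y \<otimes> g \<otimes> inv y) \<in> hom H H"
        using xy by (auto simp: hom_def)
    qed
    have "y \<otimes> x [^] j \<otimes> inv y = (y \<otimes> x \<otimes> inv y) [^] j"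
      using xy h.hom_int_pow[of x j] by simp
    also have "\<dots> = x [^] (- j)"
      using xy by (simp add: conj H.int_pow_inv H.int_pow_neg)
    finally show ?thesis using xy
      by (metis H.inv_closed H.inv_solve_right H.int_pow_closed H.m_closed H.inv_inv)
  qed
  have "f \<in> hom (generalized_quaternion m) H"
  proof (rule homI)
    show "f g \<in> carrier H" if "g \<in> carrier (generalized_quaternion m)" for g
      using xy by (auto simp: f_def split: prod.split)
    fix g h assume "g \<in> carrier (generalized_quaternion m)" "h \<in> carrier (generalized_quaternion m)"
    obtain i s j t where gh: "g = (i, s)" "h = (j, t)" by fastforce
    have a: "x [^] i \<otimes> y \<otimes> x [^] j = x [^] (i - j) \<otimes> y"
    proof -
      have "x [^] i \<otimes> y \<otimes> x [^] j = x [^] i \<otimes> (x [^] (- j) \<otimes> y)"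
        using xy by (simp add: comm H.m_assoc)
      also have "\<dots> = x [^] (i + - j) \<otimes> y"
        using xy by (simp only: H.int_pow_mult H.m_assoc H.int_pow_closed)
      finally show ?thesis by simp
    qed
    have b: "x [^] i \<otimes> y \<otimes> (x [^] j \<otimes> y) = x [^] (i - j + int m)"
    proof -
      have "x [^] i \<otimes> y \<otimes> (x [^] j \<otimes> y) = (x [^] i \<otimes> y \<otimes> x [^] j) \<otimes> y"
        using xy by (simp add: H.m_assoc)
      also have "\<dots> = x [^] (i - j) \<otimes> (y \<otimes> y)"
        using xy by (simp add: a H.m_assoc)
      also have "\<dots> = x [^] (i - j + int m)"
        using xy by (simp only: y2 H.int_pow_mult)
      finally show ?thesis .
    qed
    show "f (g \<otimes>\<^bsub>generalized_quaternion m\<^esub> h) = f g \<otimes> f h"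
      using xy a b
      by (cases s; cases t)
         (simp_all add: gh f_def generalized_quaternion_def xmod H.int_pow_mult H.m_assoc)
  qed
  moreover have "f (1, False) = x" "f (0, True) = y"
    using xy by (simp_all add: f_def H.int_pow_1)
  ultimately show ?thesis by blast
qed

text \<open>The hypothesis of the first case. It forces \<open>H\<close> to be nontrivial and \<open>order G\<close> to
  have exactly two prime divisors.\<close>

definition exceptional_group :: "('a, 'b) monoid_scheme \<Rightarrow> bool" where
  "exceptional_group G \<longleftrightarrow>
     (\<exists>p H. prime p \<and> odd p \<and> sylow_subgroup p H G \<and>
        (\<exists>C. maximal_cyclic_subgroup C (G\<lparr>carrier := H\<rparr>) \<and> prime (card C)) \<and>
        ((\<exists>n>1. G \<cong> integer_mod_group (2 ^ n) \<times>\<times> G\<lparr>carrier := H\<rparr>) \<or>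
         (\<exists>r\<ge>1. G \<cong> generalized_quaternion (2 ^ r) \<times>\<times> G\<lparr>carrier := H\<rparr>)))"

text \<open>Simple graphs are symmetric loop-free pair digraphs, as in \<^locale>\<open>pair_graph\<close>.\<close>

definition power_graph :: "('a, 'b) monoid_scheme \<Rightarrow> 'a pair_pre_digraph" where
  "power_graph G =
     \<lparr>pverts = carrier G,
      parcs = {(x, y). x \<in> carrier G \<and> y \<in> carrier G \<and> x \<noteq> y \<and>
                 (x \<in> generate G {y} \<or> y \<in> generate G {x})}\<rparr>"

definition enhanced_power_graph :: "('a, 'b) monoid_scheme \<Rightarrow> 'a pair_pre_digraph" where
  "enhanced_power_graph G =
     \<lparr>pverts = carrier G,
      parcs = {(x, y). x \<in> carrier G \<and> y \<in> carrier G \<and> x \<noteq> y \<and>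
                 (\<exists>C. cyclic_subgroup C G \<and> x \<in> C \<and> y \<in> C)}\<rparr>"

definition delete_isolated :: "'a pair_pre_digraph \<Rightarrow> 'a pair_pre_digraph" where
  "delete_isolated \<Gamma> =
     \<lparr>pverts = {x \<in> pverts \<Gamma>. \<exists>y. (x, y) \<in> parcs \<Gamma> \<or> (y, x) \<in> parcs \<Gamma>}, parcs = parcs \<Gamma>\<rparr>"

definition difference_graph :: "('a, 'b) monoid_scheme \<Rightarrow> 'a pair_pre_digraph" where
  "difference_graph G =
     delete_isolated
       \<lparr>pverts = carrier G, parcs = parcs (enhanced_power_graph G) - parcs (power_graph G)\<rparr>"

lemma pair_graph_difference_graph:
  assumes "finite (carrier G)"
  shows "pair_graph (difference_graph G)"
proof
  have "parcs (difference_graph G) \<subseteq> carrier G \<times> carrier G"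
    by (auto simp: difference_graph_def delete_isolated_def enhanced_power_graph_def)
  then show "finite (parcs (difference_graph G))"
    using assms by (meson finite_SigmaI finite_subset)
  show "symmetric (difference_graph G)"
    unfolding symmetric_def with_proj_simps
    by (auto simp: sym_def difference_graph_def delete_isolated_def enhanced_power_graph_def
        power_graph_def)
qed (use assms in \<open>auto simp: difference_graph_def delete_isolated_def enhanced_power_graph_def
       power_graph_def\<close>)

definition open_nbhd :: "'a pair_pre_digraph \<Rightarrow> 'a \<Rightarrow> 'a set" where
  "open_nbhd \<Gamma> u = {v. (u, v) \<in> parcs \<Gamma>}"

definition closed_nbhd :: "'a pair_pre_digraph \<Rightarrow> 'a \<Rightarrow> 'a set" where
  "closed_nbhd \<Gamma> u = insert u (open_nbhd \<Gamma> u)"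

definition twin_rel :: "'a pair_pre_digraph \<Rightarrow> 'a rel" where
  "twin_rel \<Gamma> = {(u, v). u \<in> pverts \<Gamma> \<and> v \<in> pverts \<Gamma> \<and>
     (open_nbhd \<Gamma> u = open_nbhd \<Gamma> v \<or> closed_nbhd \<Gamma> u = closed_nbhd \<Gamma> v)}"

lemma equiv_twin_rel:
  assumes "pair_graph \<Gamma>"
  shows "equiv (pverts \<Gamma>) (twin_rel \<Gamma>)"
proof -
  interpret pair_graph \<Gamma> by fact
  have sy: "(u, v) \<in> parcs \<Gamma> \<longleftrightarrow> (v, u) \<in> parcs \<Gamma>" for u v
    using pair_sym_arcs unfolding symmetric_def with_proj_simps by (meson symE)
  have lf: "(u, u) \<notin> parcs \<Gamma>" for u
    using pair_no_loops by fastforce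
  have mixed: "u = v \<or> v = w"
    if "open_nbhd \<Gamma> u = open_nbhd \<Gamma> v" "closed_nbhd \<Gamma> v = closed_nbhd \<Gamma> w" for u v w
  proof (rule ccontr)
    assume "\<not> (u = v \<or> v = w)"
    then have "w \<in> open_nbhd \<Gamma> u" using that by (auto simp: closed_nbhd_def)
    then have "u \<in> closed_nbhd \<Gamma> v"
      using that sy by (auto simp: closed_nbhd_def open_nbhd_def)
    then have "u \<in> open_nbhd \<Gamma> u"
      using \<open>\<not> (u = v \<or> v = w)\<close> that by (auto simp: closed_nbhd_def)
    then show False using lf by (auto simp: open_nbhd_def)
  qed
  have "trans (twin_rel \<Gamma>)"
  proof (rule transI)
    fix u v w assume "(u, v) \<in> twin_rel \<Gamma>" "(v, w) \<in> twin_rel \<Gamma>"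
    then show "(u, w) \<in> twin_rel \<Gamma>"
      using mixed[of u v w] mixed[of w v u] unfolding twin_rel_def by auto
  qed
  then show ?thesis
    by (intro equivI) (auto simp: twin_rel_def refl_on_def sym_def)
qed

definition twin_classes :: "'a pair_pre_digraph \<Rightarrow> 'a set set" where
  "twin_classes \<Gamma> = pverts \<Gamma> // twin_rel \<Gamma>"

definition system_of_representatives :: "'a set \<Rightarrow> 'a set set \<Rightarrow> bool" where
  "system_of_representatives T R \<longleftrightarrow> T \<subseteq> \<Union>R \<and> (\<forall>C \<in> R. \<exists>!x. x \<in> T \<inter> C)"

text \<open>The number of edges of a shortest walk; \<open>\<infinity>\<close> if there is no walk.\<close>

definition graph_dist :: "'a pair_pre_digraph \<Rightarrow> 'a \<Rightarrow> 'a \<Rightarrow> ereal" where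
  "graph_dist \<Gamma> u v = wf_digraph.\<mu> (with_proj \<Gamma>) (\<lambda>_. 1) u v"

definition resolves :: "'a pair_pre_digraph \<Rightarrow> 'a \<Rightarrow> 'a \<Rightarrow> 'a \<Rightarrow> bool" where
  "resolves \<Gamma> z x y \<longleftrightarrow> graph_dist \<Gamma> x z \<noteq> graph_dist \<Gamma> y z"

definition resolving_set :: "'a pair_pre_digraph \<Rightarrow> 'a set \<Rightarrow> bool" where
  "resolving_set \<Gamma> W \<longleftrightarrow>
     W \<subseteq> pverts \<Gamma> \<and>
     (\<forall>x \<in> pverts \<Gamma>. \<forall>y \<in> pverts \<Gamma>. x \<noteq> y \<longrightarrow> (\<exists>z \<in> W. resolves \<Gamma> z x y))"

definition metric_dimension :: "'a pair_pre_digraph \<Rightarrow> nat" where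
  "metric_dimension \<Gamma> = (LEAST n. \<exists>W. finite W \<and> resolving_set \<Gamma> W \<and> card W = n)"

end

theory Submission
  imports Defs "HOL-Number_Theory.Cong"
begin

text \<open>
  Write \<open>x \<le> y\<close> for \<open>x \<in> \<langle>y\<rangle>\<close>. Two vertices are adjacent in the difference graph iff they have a
  common upper bound but are incomparable, and in a product of groups of pairwise coprime orders
  this preorder is componentwise. Hence the isolated vertices are the identity and the generators
  of maximal cyclic subgroups, the latter being counted by the product of the
  \<open>|M(P\<^sub>i)|\<close>.

  Twins have equal distances to all other vertices, so a resolving set misses at most one vertex
  of each twin class. Conversely, two representatives that are not resolved by the
  nonrepresentatives are told apart only by vertices with a singleton twin class. Since \<open>w\<close> and
  \<open>w\<^sup>-\<^sup>1\<close> are twins, such a vertex is an involution, and since all involutions are twins, it is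
  the only one. Comparing the neighbourhoods of the two representatives shows that the odd part of
  the group is a \<open>p\<close>-group with a maximal cyclic subgroup of prime order and that the Sylow
  2-subgroup is larger than \<open>\<int>\<^sub>2\<close>. Having a single involution, the latter is cyclic or generalized
  quaternion.
\<close>

section \<open>Powers in a group and the arcs of the difference graph\<close>

text \<open>To resolve a pair only the distances 0 and 1 are used: a vertex resolves itself from any
  other, and a vertex adjacent to just one of two others resolves them. So everything comes down to
  comparing neighbourhoods. An involution \<open>z\<close> is adjacent exactly to the nontrivial
  elements of odd order; as this set does not depend on \<open>z\<close>, involutions are twins. If
  \<open>z\<close> is the only further vertex that tells \<open>x\<close> and \<open>y\<close>
  apart, then one of them, say \<open>x\<close>, has odd order and \<open>y\<close> has even order,
  yet all their other adjacencies agree. As for \<alpha>: the identity and the generators of maximal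
  cyclic subgroups are not vertices, so \<alpha> - 1 is the number of vertices outside a system of
  representatives. Twins make it a lower bound for every resolving set, and the additional vertex
  \<open>z\<close> of the first case costs at most one more.\<close>

definition power_le :: "('a, 'b) monoid_scheme \<Rightarrow> 'a \<Rightarrow> 'a \<Rightarrow> bool" where
  "power_le G x y \<longleftrightarrow> x \<in> generate G {y}"

definition power_joinable :: "('a, 'b) monoid_scheme \<Rightarrow> 'a \<Rightarrow> 'a \<Rightarrow> bool" where
  "power_joinable G x y \<longleftrightarrow> (\<exists>g\<in>carrier G. power_le G x g \<and> power_le G y g)"

context group
begin

lemma generate_singleton_eq_range: "g \<in> carrier G \<Longrightarrow> generate G {g} = range (\<lambda>n::int. g [^] n)"
  by (simp add: generate_pow full_SetCompr_eq)

lemma power_le_iff: "y \<in> carrier G \<Longrightarrow> power_le G x y \<longleftrightarrow> (\<exists>k::int. x = y [^] k)"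
  using generate_pow[of y] by (auto simp: power_le_def)

lemma power_le_iff_nat:
  assumes "finite (carrier G)" "y \<in> carrier G"
  shows "power_le G x y \<longleftrightarrow> (\<exists>k::nat. x = y [^] k)"
  using generate_pow_on_finite_carrier[OF assms] by (auto simp: power_le_def)

lemma power_le_closed: "y \<in> carrier G \<Longrightarrow> power_le G x y \<Longrightarrow> x \<in> carrier G"
  by (auto simp: power_le_iff)

lemma power_le_refl: "power_le G x x"
  by (simp add: power_le_def generate.incl)

lemma power_le_trans:
  assumes "power_le G x y" "power_le G y w" "w \<in> carrier G"
  shows "power_le G x w"
proof -
  obtain k l :: int where "x = y [^] k" "y = w [^] l"
    using assms power_le_iff power_le_closed by metis
  then have "x = w [^] (l * k)" using assms(3) by (simp add: int_pow_pow)
  then show ?thesis using assms(3) power_le_iff by blast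
qed

lemma one_power_le: "power_le G \<one> y"
  by (simp add: power_le_def generate.one)

lemma power_le_one_iff: "power_le G x \<one> \<longleftrightarrow> x = \<one>"
  by (simp add: power_le_def generate_one)

lemma power_le_inv: "x \<in> carrier G \<Longrightarrow> power_le G (inv x) x"
  by (simp add: power_le_def generate.inv)

lemma cyclic_subgroup_iff: "cyclic_subgroup C G \<longleftrightarrow> (\<exists>g\<in>carrier G. C = generate G {g})"
proof
  assume "cyclic_subgroup C G"
  then have C: "subgroup C G" "cyclic_group (G\<lparr>carrier := C\<rparr>)" by (auto simp: cyclic_subgroup_def)
  interpret C: group "G\<lparr>carrier := C\<rparr>" using C(1) by (rule subgroup_imp_group)
  obtain g where g: "g \<in> C" "C = range (\<lambda>n::int. g [^]\<^bsub>G\<lparr>carrier := C\<rparr>\<^esub> n)"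
    using C(2) unfolding C.cyclic_group by auto
  then have "C = range (\<lambda>n::int. g [^] n)" using int_pow_consistent[OF C(1) g(1)] by simp
  moreover have "g \<in> carrier G" using g(1) subgroup.mem_carrier[OF C(1)] by blast
  ultimately show "\<exists>g\<in>carrier G. C = generate G {g}"
    using generate_singleton_eq_range[of g] by blast
next
  assume "\<exists>g\<in>carrier G. C = generate G {g}"
  then obtain g where g: "g \<in> carrier G" "C = generate G {g}" by blast
  have C: "subgroup C G" using g generate_is_subgroup[of "{g}"] by simp
  interpret C: group "G\<lparr>carrier := C\<rparr>" using C by (rule subgroup_imp_group)
  have gC: "g \<in> C" using g(2) by (simp add: generate.incl)
  have "C = range (\<lambda>n::int. g [^] n)" using generate_singleton_eq_range[OF g(1)] g(2) by simp
  then have "C = range (\<lambda>n::int. g [^]\<^bsub>G\<lparr>carrier := C\<rparr>\<^esub> n)"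
    using int_pow_consistent[OF C gC] by simp
  then have "cyclic_group (G\<lparr>carrier := C\<rparr>)" unfolding C.cyclic_group using gC by auto
  then show "cyclic_subgroup C G" using C by (simp add: cyclic_subgroup_def)
qed

lemma generate_subset_iff_power_le:
  assumes "x \<in> carrier G" "y \<in> carrier G"
  shows "generate G {x} \<subseteq> generate G {y} \<longleftrightarrow> power_le G x y"
proof
  assume "power_le G x y"
  then show "generate G {x} \<subseteq> generate G {y}"
    using generate_subgroup_incl[of "{x}" "generate G {y}"] generate_is_subgroup[of "{y}"] assms(2)
    by (simp add: power_le_def)
qed (auto simp: power_le_def intro: generate.incl)

lemma maximal_cyclic_generators_iff:
  "x \<in> maximal_cyclic_generators G \<longleftrightarrow>
    x \<in> carrier G \<and> (\<forall>y\<in>carrier G. power_le G x y \<longrightarrow> power_le G y x)"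
proof (cases "x \<in> carrier G")
  case True
  have "maximal_cyclic_subgroup (generate G {x}) G \<longleftrightarrow>
    (\<forall>y\<in>carrier G. \<not> generate G {x} \<subset> generate G {y})"
    unfolding maximal_cyclic_subgroup_def cyclic_subgroup_iff using True by auto
  also have "\<dots> \<longleftrightarrow> (\<forall>y\<in>carrier G. power_le G x y \<longrightarrow> power_le G y x)"
    using generate_subset_iff_power_le[OF True] generate_subset_iff_power_le[OF _ True]
    by (simp add: less_le_not_le)
  finally show ?thesis using True by (simp add: maximal_cyclic_generators_def)
qed (simp add: maximal_cyclic_generators_def)

lemma arc_difference_graph_iff:
  "(x, y) \<in> parcs (difference_graph G) \<longleftrightarrow> x \<in> carrier G \<and> y \<in> carrier G \<and>
     power_joinable G x y \<and> \<not> power_le G x y \<and> \<not> power_le G y x"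
proof -
  have "(\<exists>C. cyclic_subgroup C G \<and> x \<in> C \<and> y \<in> C) \<longleftrightarrow> power_joinable G x y"
    unfolding cyclic_subgroup_iff power_joinable_def power_le_def by blast
  then show ?thesis
    using power_le_refl[of x]
    by (auto simp: difference_graph_def delete_isolated_def enhanced_power_graph_def
        power_graph_def power_le_def)
qed

lemma pverts_difference_graph_iff:
  "x \<in> pverts (difference_graph G) \<longleftrightarrow> (\<exists>y. (x, y) \<in> parcs (difference_graph G))"
proof -
  have "(x, y) \<in> parcs (difference_graph G) \<longleftrightarrow> (y, x) \<in> parcs (difference_graph G)" for x y
    unfolding arc_difference_graph_iff by (auto simp: power_joinable_def)
  moreover have "(x, y) \<in> parcs (difference_graph G) \<Longrightarrow> x \<in> carrier G" for x y
    unfolding arc_difference_graph_iff by blast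
  ultimately show ?thesis by (auto simp: difference_graph_def delete_isolated_def)
qed

text \<open>Such an element is comparable to everything joinable with it: \<one> is a power of every
  element, and a common upper bound \<open>g\<close> of \<open>x\<close> and \<open>y\<close> is a
  power of \<open>x\<close> if \<open>x\<close> is maximal, so \<open>y\<close> is one too.\<close>

lemma isolated_in_difference_graph:
  assumes "x = \<one> \<or> x \<in> maximal_cyclic_generators G"
  shows "x \<notin> pverts (difference_graph G)"
proof
  assume "x \<in> pverts (difference_graph G)"
  then obtain y g where "x \<in> carrier G" "y \<in> carrier G" "g \<in> carrier G" "power_le G x g" "power_le G y g"
    "\<not> power_le G x y" "\<not> power_le G y x"
    unfolding pverts_difference_graph_iff arc_difference_graph_iff power_joinable_def by blast
  then show False
    using assms one_power_le[of y] maximal_cyclic_generators_iff[of x] power_le_trans by blast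
qed

end

section \<open>The preorder under isomorphisms and in products of coprime orders\<close>

lemma iso_power_le:
  assumes "group G" "group H" "f \<in> iso G H" "x \<in> carrier G" "y \<in> carrier G"
  shows "power_le H (f x) (f y) \<longleftrightarrow> power_le G x y"
proof -
  interpret group_hom G H f
    using assms by (simp add: group_hom_def group_hom_axioms_def iso_def)
  have inj: "inj_on f (carrier G)" using assms by (simp add: iso_def bij_betw_def)
  have "f x = f y [^]\<^bsub>H\<^esub> k \<longleftrightarrow> x = y [^]\<^bsub>G\<^esub> k" for k :: int
    using assms(4,5) hom_int_pow[of y k] inj_onD[OF inj, of x "y [^]\<^bsub>G\<^esub> k"] by auto
  then show ?thesis using assms(4,5) G.power_le_iff H.power_le_iff by simp
qed

lemma product_group_nat_pow:
  assumes "\<And>i. i \<in> I \<Longrightarrow> group (K i)" "f \<in> carrier (product_group I K)" "i \<in> I"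
  shows "(f [^]\<^bsub>product_group I K\<^esub> (n::nat)) i = f i [^]\<^bsub>K i\<^esub> n"
  using assms by (induction n) auto

text \<open>The exponents \<open>k i\<close> that work in the single factors may differ. Since the
  orders are pairwise coprime, the Chinese remainder theorem merges them into one exponent
  \<open>n\<close> that agrees with \<open>k i\<close> modulo \<open>order (K i)\<close>.\<close>

lemma power_le_product_group:
  assumes I: "finite I" and K: "\<And>i. i \<in> I \<Longrightarrow> group (K i)" "\<And>i. i \<in> I \<Longrightarrow> finite (carrier (K i))"
    and cop: "\<And>i j. i \<in> I \<Longrightarrow> j \<in> I \<Longrightarrow> i \<noteq> j \<Longrightarrow> coprime (order (K i)) (order (K j))"
    and f: "f \<in> carrier (product_group I K)" and g: "g \<in> carrier (product_group I K)"
  shows "power_le (product_group I K) f g \<longleftrightarrow> (\<forall>i\<in>I. power_le (K i) (f i) (g i))"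
proof -
  interpret prod: group "product_group I K" using K(1) by simp
  have fin: "finite (carrier (product_group I K))" using I K by (auto intro: finite_PiE)
  have pow: "power_le (K i) (f i) (g i) \<longleftrightarrow> (\<exists>k::nat. f i = g i [^]\<^bsub>K i\<^esub> k)" if "i \<in> I" for i
    using that K g by (intro group.power_le_iff_nat) auto
  show ?thesis
  proof
    assume "power_le (product_group I K) f g"
    then obtain k :: nat where "f = g [^]\<^bsub>product_group I K\<^esub> k"
      using prod.power_le_iff_nat[OF fin g] by blast
    then have "f i = g i [^]\<^bsub>K i\<^esub> k" if "i \<in> I" for i
      using product_group_nat_pow[of I K g i k] K(1) g that by simp
    then show "\<forall>i\<in>I. power_le (K i) (f i) (g i)" using pow by blast
  next
    assume "\<forall>i\<in>I. power_le (K i) (f i) (g i)"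
    then have "\<forall>i\<in>I. \<exists>k::nat. f i = g i [^]\<^bsub>K i\<^esub> k" using pow by blast
    then obtain k :: "_ \<Rightarrow> nat" where k: "\<And>i. i \<in> I \<Longrightarrow> f i = g i [^]\<^bsub>K i\<^esub> k i" by metis
    obtain n where n: "\<And>i. i \<in> I \<Longrightarrow> [n = k i] (mod order (K i))"
      using chinese_remainder_nat[OF I, of "\<lambda>i. order (K i)" k] cop by blast
    have "f i = (g [^]\<^bsub>product_group I K\<^esub> n) i" if i: "i \<in> I" for i
    proof -
      interpret Ki: group "K i" using K(1)[OF i] .
      have gi: "g i \<in> carrier (K i)" using g i by auto
      have "int (Ki.ord (g i)) dvd int (k i) - int n"
      proof -
        have "[int n = int (k i)] (mod int (order (K i)))" using n[OF i] by (simp add: cong_int_iff)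
        then have "int (order (K i)) dvd int (k i) - int n"
          by (metis cong_iff_dvd_diff cong_sym)
        moreover have "int (Ki.ord (g i)) dvd int (order (K i))"
          using Ki.ord_dvd_group_order[OF gi] by simp
        ultimately show ?thesis by (rule dvd_trans[rotated])
      qed
      then have "g i [^]\<^bsub>K i\<^esub> int n = g i [^]\<^bsub>K i\<^esub> int (k i)" using Ki.int_pow_eq[OF gi] by blast
      then show ?thesis
        using product_group_nat_pow[of I K g i n] K(1) g i k by (simp add: int_pow_int)
    qed
    moreover have "g [^]\<^bsub>product_group I K\<^esub> n \<in> carrier (product_group I K)" using g by blast
    ultimately have "f = g [^]\<^bsub>product_group I K\<^esub> n"
      using f by (intro PiE_ext[of f I "\<lambda>i. carrier (K i)"]) auto
    then show "power_le (product_group I K) f g"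
      using prod.power_le_iff_nat[OF fin g] by blast
  qed
qed

section \<open>Distances, twins and resolving sets in a finite graph\<close>

context pair_graph
begin

lemma arc_sym: "(u, v) \<in> parcs G \<longleftrightarrow> (v, u) \<in> parcs G"
  using pair_sym_arcs unfolding symmetric_def with_proj_simps by (meson symE)

lemma no_loop: "(u, u) \<notin> parcs G"
  using pair_no_loops by fastforce

lemma awalk_cost_one: "awalk_cost (\<lambda>_. 1) p = real (length p)"
  by (induction p) (auto simp: awalk_cost_def)

text \<open>The infimum over the empty set is \<infinity>, so the comparisons of distances below
  cover vertices in different components without a case split.\<close>

lemma graph_dist_eq_Inf: "graph_dist G u v = (INF p\<in>{p. awalk u p v}. ereal (real (length p)))"
  unfolding graph_dist_def \<mu>_def awalk_cost_one ..

lemma graph_dist_le: "awalk u p v \<Longrightarrow> graph_dist G u v \<le> length p"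
  unfolding graph_dist_eq_Inf by (rule INF_lower) simp

lemma graph_dist_ge: "(\<And>p. awalk u p v \<Longrightarrow> n \<le> length p) \<Longrightarrow> real n \<le> graph_dist G u v"
  unfolding graph_dist_eq_Inf by (rule INF_greatest) auto

lemma graph_dist_self:
  assumes "u \<in> pverts G"
  shows "graph_dist G u u = 0"
proof (rule antisym)
  show "graph_dist G u u \<le> 0" using graph_dist_le[of u "[]" u] assms by (simp add: awalk_Nil_iff zero_ereal_def)
  show "0 \<le> graph_dist G u u" using graph_dist_ge[of u u 0] by (simp add: zero_ereal_def)
qed

lemma graph_dist_ge_one:
  assumes "u \<noteq> v"
  shows "1 \<le> graph_dist G u v"
proof -
  have "1 \<le> length p" if "awalk u p v" for p
    using that assms by (cases p) (auto simp: awalk_Nil_iff)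
  then have "real 1 \<le> graph_dist G u v" by (rule graph_dist_ge)
  then show ?thesis by (simp add: one_ereal_def)
qed

lemma graph_dist_eq_one_iff:
  assumes "u \<noteq> v"
  shows "graph_dist G u v = 1 \<longleftrightarrow> (u, v) \<in> parcs G"
proof
  assume "(u, v) \<in> parcs G"
  then have "awalk u [(u, v)] v" by (auto simp: awalk_Cons_iff awalk_Nil_iff dest: in_arcsD1 in_arcsD2)
  from graph_dist_le[OF this] have "graph_dist G u v \<le> 1" by (simp add: one_ereal_def)
  then show "graph_dist G u v = 1" using graph_dist_ge_one[OF assms] by simp
next
  assume dist: "graph_dist G u v = 1"
  show "(u, v) \<in> parcs G"
  proof (rule ccontr)
    assume no: "(u, v) \<notin> parcs G"
    have "2 \<le> length p" if p: "awalk u p v" for p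
    proof (rule ccontr)
      assume "\<not> 2 \<le> length p"
      then have "p = [] \<or> (\<exists>e. p = [e])" by (cases p; cases "tl p") auto
      then show False using p assms no by (auto simp: awalk_Cons_iff awalk_Nil_iff)
    qed
    then have "real 2 \<le> graph_dist G u v" by (rule graph_dist_ge)
    then show False by (simp add: dist one_ereal_def)
  qed
qed

lemma twin_arc_iff:
  assumes "(u, v) \<in> twin_rel G" "w \<noteq> u" "w \<noteq> v"
  shows "(u, w) \<in> parcs G \<longleftrightarrow> (v, w) \<in> parcs G"
  using assms unfolding twin_rel_def open_nbhd_def closed_nbhd_def by blast

text \<open>In a walk from \<open>u\<close> to \<open>w\<close> the first vertex can be replaced by
  the twin \<open>v\<close>. Should the second vertex be \<open>v\<close> itself, dropping the first
  arc gives an even shorter walk from \<open>v\<close>.\<close>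

lemma twin_graph_dist_le:
  assumes "(u, v) \<in> twin_rel G" "w \<noteq> u" "w \<noteq> v"
  shows "graph_dist G v w \<le> graph_dist G u w"
  unfolding graph_dist_eq_Inf[of u w]
proof (rule INF_greatest)
  fix p assume "p \<in> {p. awalk u p w}"
  then have p: "awalk u p w" by simp
  then obtain e q where q: "p = e # q" using assms by (cases p) (auto simp: awalk_Nil_iff)
  then obtain a where e: "e = (u, a)" "(u, a) \<in> parcs G" "awalk a q w"
    using p by (cases e) (auto simp: awalk_Cons_iff)
  show "graph_dist G v w \<le> ereal (real (length p))"
  proof (cases "a = v")
    case True
    then have "graph_dist G v w \<le> ereal (real (length q))" using e graph_dist_le by blast
    also have "\<dots> \<le> ereal (real (length p))" using q by simp
    finally show ?thesis .
  next
    case False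
    then have "(v, a) \<in> parcs G" using twin_arc_iff[of u v a] assms e no_loop by blast
    then have "awalk v ((v, a) # q) w" using e by (auto simp: awalk_Cons_iff dest: in_arcsD1)
    from graph_dist_le[OF this] show ?thesis using q by simp
  qed
qed

lemma twin_graph_dist:
  assumes "(u, v) \<in> twin_rel G" "w \<noteq> u" "w \<noteq> v"
  shows "graph_dist G u w = graph_dist G v w"
  using assms twin_graph_dist_le equiv_twin_rel[OF pair_graph_axioms]
  by (meson antisym equivE symE)

lemma resolves_self:
  assumes "x \<in> pverts G" "y \<noteq> x"
  shows "resolves G x x y"
  using graph_dist_self[OF assms(1)] graph_dist_ge_one[OF assms(2)]
  unfolding resolves_def by auto

lemma resolves_if_arc:
  assumes "w \<noteq> x" "w \<noteq> y" "(x, w) \<in> parcs G \<longleftrightarrow> (y, w) \<notin> parcs G"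
  shows "resolves G w x y"
  using graph_dist_eq_one_iff assms unfolding resolves_def by metis

lemma resolves_sym: "resolves G z x y \<longleftrightarrow> resolves G z y x"
  unfolding resolves_def by auto

text \<open>If all other vertices see \<open>x\<close> and \<open>y\<close> alike, then the closed
  neighbourhoods coincide when \<open>x\<close> and \<open>y\<close> are adjacent, and the open ones
  when they are not.\<close>

lemma not_twin_distinguished:
  assumes "x \<in> pverts G" "y \<in> pverts G" "x \<noteq> y" "(x, y) \<notin> twin_rel G"
  shows "\<exists>w. w \<noteq> x \<and> w \<noteq> y \<and> ((x, w) \<in> parcs G \<longleftrightarrow> (y, w) \<notin> parcs G)"
proof (rule ccontr)
  assume "\<not> ?thesis"
  then have same: "w = x \<or> w = y \<or> ((x, w) \<in> parcs G \<longleftrightarrow> (y, w) \<in> parcs G)" for w by blast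
  have ne: "open_nbhd G x \<noteq> open_nbhd G y" "closed_nbhd G x \<noteq> closed_nbhd G y"
    using assms unfolding twin_rel_def by auto
  show False
  proof (cases "(x, y) \<in> parcs G")
    case True
    then have "w \<in> closed_nbhd G x \<longleftrightarrow> w \<in> closed_nbhd G y" for w
      using same[of w] arc_sym[of x y] by (auto simp: closed_nbhd_def open_nbhd_def)
    then show False using ne by blast
  next
    case False
    then have "w \<in> open_nbhd G x \<longleftrightarrow> w \<in> open_nbhd G y" for w
      using same[of w] arc_sym[of x y] no_loop by (auto simp: open_nbhd_def)
    then show False using ne by blast
  qed
qed

section \<open>Systems of representatives of the twin classes\<close>

context
  fixes T
  assumes T: "system_of_representatives T (twin_classes G)"
begin

lemma representatives_subset: "T \<subseteq> pverts G"
  using T Union_quotient[OF equiv_twin_rel[OF pair_graph_axioms]]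
  by (auto simp: system_of_representatives_def twin_classes_def)

lemma representatives_twin_eq:
  assumes "x \<in> T" "y \<in> T" "(x, y) \<in> twin_rel G"
  shows "x = y"
proof -
  note eq = equiv_twin_rel[OF pair_graph_axioms]
  let ?C = "twin_rel G `` {x}"
  have x: "x \<in> pverts G" using assms(1) representatives_subset by blast
  then have "?C \<in> twin_classes G" unfolding twin_classes_def by (rule quotientI)
  moreover have "\<forall>C \<in> twin_classes G. \<exists>!w. w \<in> T \<inter> C"
    using T unfolding system_of_representatives_def by (rule conjunct2)
  ultimately have "\<exists>!w. w \<in> T \<inter> ?C" by (rule bspec[rotated])
  moreover have "x \<in> T \<inter> ?C" using assms(1) equiv_class_self[OF eq x] by (rule IntI)
  moreover have "y \<in> T \<inter> ?C" using assms(2,3) by blast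
  ultimately show ?thesis by metis
qed

lemma singleton_class_representative:
  assumes "z \<in> pverts G" "\<And>v. (z, v) \<in> twin_rel G \<Longrightarrow> v = z"
  shows "z \<in> T"
proof -
  have "twin_rel G `` {z} \<in> twin_classes G"
    unfolding twin_classes_def using assms(1) by (rule quotientI)
  moreover have "\<forall>C \<in> twin_classes G. \<exists>!w. w \<in> T \<inter> C"
    using T unfolding system_of_representatives_def by (rule conjunct2)
  ultimately have "\<exists>!w. w \<in> T \<inter> twin_rel G `` {z}" by (rule bspec[rotated])
  then obtain w where "w \<in> T" "(z, w) \<in> twin_rel G" by blast
  then show ?thesis using assms(2) by metis
qed

lemma card_representatives: "card T = card (twin_classes G)"
proof (rule bij_betw_same_card)
  note eq = equiv_twin_rel[OF pair_graph_axioms]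
  show "bij_betw (\<lambda>x. twin_rel G `` {x}) T (twin_classes G)"
  proof (rule bij_betw_imageI)
    show "inj_on (\<lambda>x. twin_rel G `` {x}) T"
    proof (rule inj_onI)
      fix x y assume xy: "x \<in> T" "y \<in> T" "twin_rel G `` {x} = twin_rel G `` {y}"
      then have "(x, y) \<in> twin_rel G"
        using representatives_subset eq_equiv_class[OF xy(3) eq] by blast
      then show "x = y" using xy representatives_twin_eq by blast
    qed
    show "(\<lambda>x. twin_rel G `` {x}) ` T = twin_classes G"
    proof
      show "(\<lambda>x. twin_rel G `` {x}) ` T \<subseteq> twin_classes G"
        using representatives_subset by (auto simp: twin_classes_def intro: quotientI)
      show "twin_classes G \<subseteq> (\<lambda>x. twin_rel G `` {x}) ` T"
      proof
        fix C assume C: "C \<in> twin_classes G"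
        then obtain x where x: "x \<in> T" "x \<in> C"
          using T unfolding system_of_representatives_def by blast
        obtain y where y: "C = twin_rel G `` {y}" "y \<in> pverts G"
          using C unfolding twin_classes_def by (rule quotientE)
        have "C = twin_rel G `` {x}" using x(2) equiv_class_eq[OF eq, of y x] by (simp add: y(1))
        then show "C \<in> (\<lambda>x. twin_rel G `` {x}) ` T" using x by blast
      qed
    qed
  qed
qed

text \<open>A nonrepresentative would resolve itself from the other vertex, so \<open>x\<close> and
  \<open>y\<close> are representatives of different classes, and some \<open>w\<close> tells their
  neighbourhoods apart. If \<open>w\<close> is a vertex, it is a representative for the same reason;
  a twin \<open>v \<noteq> w\<close> would be a nonrepresentative with the same adjacencies and
  would resolve the pair.\<close>

lemma unresolved_pair:
  assumes xy: "x \<in> pverts G" "y \<in> pverts G" "x \<noteq> y"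
    and unres: "\<And>z. z \<in> pverts G - T \<Longrightarrow> \<not> resolves G z x y"
  shows "\<exists>w. w \<noteq> x \<and> w \<noteq> y \<and> ((x, w) \<in> parcs G \<longleftrightarrow> (y, w) \<notin> parcs G)"
    and "w \<noteq> x \<Longrightarrow> w \<noteq> y \<Longrightarrow> (x, w) \<in> parcs G \<longleftrightarrow> (y, w) \<notin> parcs G \<Longrightarrow> (w, v) \<in> twin_rel G \<Longrightarrow> v = w"
proof -
  have xT: "x \<in> T" using unres[of x] resolves_self[of x y] xy by blast
  have yT: "y \<in> T" using unres[of y] resolves_self[of y x] resolves_sym xy by blast
  have "(x, y) \<notin> twin_rel G" using representatives_twin_eq[OF xT yT] xy by blast
  then show "\<exists>w. w \<noteq> x \<and> w \<noteq> y \<and> ((x, w) \<in> parcs G \<longleftrightarrow> (y, w) \<notin> parcs G)"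
    using not_twin_distinguished xy by blast
  assume w: "w \<noteq> x" "w \<noteq> y" "(x, w) \<in> parcs G \<longleftrightarrow> (y, w) \<notin> parcs G" and wv: "(w, v) \<in> twin_rel G"
  have wV: "w \<in> pverts G" "v \<in> pverts G" using wv by (auto simp: twin_rel_def)
  have wT: "w \<in> T" using unres[of w] resolves_if_arc[OF w] wV by blast
  show "v = w"
  proof (rule ccontr)
    assume "v \<noteq> w"
    then have vT: "v \<notin> T" using representatives_twin_eq[OF wT _ wv] by blast
    then have v: "v \<noteq> x" "v \<noteq> y" using xT yT by auto
    have "(x, v) \<in> parcs G \<longleftrightarrow> (x, w) \<in> parcs G" "(y, v) \<in> parcs G \<longleftrightarrow> (y, w) \<in> parcs G"
      using twin_arc_iff[OF wv, of x] twin_arc_iff[OF wv, of y] v w arc_sym by metis+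
    then have "resolves G v x y" using resolves_if_arc[of v x y] v w by blast
    then show False using unres vT wV by blast
  qed
qed

end

section \<open>Lower bound for resolving sets from the twin classes\<close>

lemma card_resolving_set_ge:
  assumes W: "resolving_set G W"
  shows "card (pverts G) \<le> card W + card (twin_classes G)"
proof -
  note eq = equiv_twin_rel[OF pair_graph_axioms]
  have sub: "W \<subseteq> pverts G" using W by (simp add: resolving_set_def)
  have fin: "finite (twin_classes G)"
    unfolding twin_classes_def by (rule finite_quotient[OF pair_finite_verts]) (use eq in \<open>auto elim: equivE simp: twin_rel_def\<close>)
  have "inj_on (\<lambda>x. twin_rel G `` {x}) (pverts G - W)"
  proof (rule inj_onI, rule ccontr)
    fix x y assume xy: "x \<in> pverts G - W" "y \<in> pverts G - W"
      "twin_rel G `` {x} = twin_rel G `` {y}" "x \<noteq> y"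
    then have tw: "(x, y) \<in> twin_rel G" using eq_equiv_class[OF xy(3) eq] by blast
    obtain z where "z \<in> W" "resolves G z x y" using W xy unfolding resolving_set_def by blast
    then show False using twin_graph_dist[OF tw, of z] xy unfolding resolves_def by blast
  qed
  moreover have "(\<lambda>x. twin_rel G `` {x}) ` (pverts G - W) \<subseteq> twin_classes G"
    by (auto simp: twin_classes_def intro: quotientI)
  ultimately have "card (pverts G - W) \<le> card (twin_classes G)" using fin by (rule card_inj_on_le)
  then show ?thesis
    using card_Diff_subset[OF finite_subset[OF sub pair_finite_verts] sub] by linarith
qed

text \<open>The given \<open>W\<close> provides the witness without which \<open>LEAST\<close> would
  be unspecified; the second bound is then applied to a resolving set of minimal size.\<close>

lemma metric_dimension_bounds:
  assumes W: "resolving_set G W"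
  shows "metric_dimension G \<le> card W"
    and "card (pverts G) \<le> metric_dimension G + card (twin_classes G)"
proof -
  have fin: "finite W"
    using W finite_subset[OF _ pair_finite_verts] by (simp add: resolving_set_def)
  let ?P = "\<lambda>n. \<exists>W. finite W \<and> resolving_set G W \<and> card W = n"
  have P: "?P (card W)" using W fin by blast
  show "metric_dimension G \<le> card W" unfolding metric_dimension_def using P by (rule Least_le)
  have "?P (metric_dimension G)" unfolding metric_dimension_def using P by (rule LeastI)
  then show "card (pverts G) \<le> metric_dimension G + card (twin_classes G)"
    using card_resolving_set_ge by metis
qed

end

section \<open>Pairs of vertices separated by a single neighbour\<close>

text \<open>\<open>A\<close> abstracts a 2-group with the single involution \<open>z\<close> and \<open>H\<close> a group of odd order, both
  preordered by \<open>x \<in> \<langle>y\<rangle>\<close>; \<open>adj\<close> is adjacency in the difference graph of their product.\<close>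

locale gen_orders =
  fixes A :: "'a set" and leA :: "'a \<Rightarrow> 'a \<Rightarrow> bool" and one z :: 'a
    and H :: "'h set" and leH :: "'h \<Rightarrow> 'h \<Rightarrow> bool" and e :: 'h
  assumes A: "one \<in> A" "z \<in> A" "z \<noteq> one"
    and reflA: "a \<in> A \<Longrightarrow> leA a a"
    and one_leA: "a \<in> A \<Longrightarrow> leA one a"
    and leA_one: "a \<in> A \<Longrightarrow> leA a one \<Longrightarrow> a = one"
    and z_leA: "a \<in> A \<Longrightarrow> a \<noteq> one \<Longrightarrow> leA z a"
    and leA_z: "a \<in> A \<Longrightarrow> leA a z \<Longrightarrow> a = one \<or> a = z"
    and H: "e \<in> H"
    and reflH: "h \<in> H \<Longrightarrow> leH h h"
    and transH: "h \<in> H \<Longrightarrow> k \<in> H \<Longrightarrow> l \<in> H \<Longrightarrow> leH h k \<Longrightarrow> leH k l \<Longrightarrow> leH h l"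
    and e_leH: "h \<in> H \<Longrightarrow> leH e h"
    and leH_e: "h \<in> H \<Longrightarrow> leH h e \<Longrightarrow> h = e"
    and equivH: "h \<in> H \<Longrightarrow> h \<noteq> e \<Longrightarrow> \<exists>t\<in>H. t \<noteq> h \<and> leH t h \<and> leH h t"
begin

definition compA where "compA a b \<longleftrightarrow> (\<exists>c\<in>A. leA a c \<and> leA b c)"

definition compH where "compH h k \<longleftrightarrow> (\<exists>l\<in>H. leH h l \<and> leH k l)"

definition adj where
  "adj x y \<longleftrightarrow> compA (fst x) (fst y) \<and> compH (snd x) (snd y) \<and>
     \<not> (leA (fst x) (fst y) \<and> leH (snd x) (snd y)) \<and>
     \<not> (leA (fst y) (fst x) \<and> leH (snd y) (snd x))"

text \<open>Not a down-set: of all that is joinable with \<open>h\<close>, only the elements above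
  \<open>h\<close> are left out. An incomparable joinable element belongs to both
  \<open>lowers h\<close> and \<open>uppers h\<close>, an element equivalent to \<open>h\<close> to
  neither.\<close>

definition lowers where "lowers h = {k \<in> H. compH k h \<and> \<not> leH h k}"

definition uppers where "uppers h = {k \<in> H. compH k h \<and> \<not> leH k h}"

lemma compA_one: "a \<in> A \<Longrightarrow> compA one a" "a \<in> A \<Longrightarrow> compA a one"
  using A reflA one_leA by (auto simp: compA_def)

lemma compA_z: "a \<in> A \<Longrightarrow> compA z a"
  using A reflA z_leA one_leA by (cases "a = one") (auto simp: compA_def)

lemma compH_sym: "compH h k \<longleftrightarrow> compH k h"
  by (auto simp: compH_def)

lemma compH_le: "h \<in> H \<Longrightarrow> k \<in> H \<Longrightarrow> leH h k \<Longrightarrow> compH h k"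
  using reflH by (auto simp: compH_def)

lemma compH_mono:
  assumes "compH h k" "leH t h" "t \<in> H" "h \<in> H"
  shows "compH t k"
  using assms transH unfolding compH_def by blast

text \<open>Fixing the first components settles the order between them: \<open>one\<close> lies
  below everything and \<open>z\<close> below everything but \<open>one\<close>. In this and the
  next four lemmas only the comparisons of second components that are still open remain.\<close>

lemma adj_one_one: "h \<in> H \<Longrightarrow> k \<in> H \<Longrightarrow> adj (one, h) (one, k) \<longleftrightarrow> k \<in> lowers h \<inter> uppers h"
  using A reflA compA_one compH_sym[of h k] by (auto simp: adj_def lowers_def uppers_def)

lemma adj_one_nonone:
  "h \<in> H \<Longrightarrow> k \<in> H \<Longrightarrow> a \<in> A \<Longrightarrow> a \<noteq> one \<Longrightarrow> adj (one, h) (a, k) \<longleftrightarrow> k \<in> lowers h"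
  using compA_one one_leA leA_one compH_sym[of h k] by (auto simp: adj_def lowers_def)

lemma adj_z_one:
  "h \<in> H \<Longrightarrow> k \<in> H \<Longrightarrow> adj (z, h) (one, k) \<longleftrightarrow> k \<in> uppers h"
  using A compA_one one_leA leA_one compH_sym[of h k] by (auto simp: adj_def uppers_def)

lemma adj_z_z: "h \<in> H \<Longrightarrow> k \<in> H \<Longrightarrow> adj (z, h) (z, k) \<longleftrightarrow> k \<in> lowers h \<inter> uppers h"
  using A reflA compA_z compH_sym[of h k] by (auto simp: adj_def lowers_def uppers_def)

lemma adj_z_above:
  "h \<in> H \<Longrightarrow> k \<in> H \<Longrightarrow> a \<in> A \<Longrightarrow> a \<noteq> one \<Longrightarrow> a \<noteq> z \<Longrightarrow> adj (z, h) (a, k) \<longleftrightarrow> k \<in> lowers h"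
  using compA_z z_leA leA_z compH_sym[of h k] by (auto simp: adj_def lowers_def)

text \<open>The neighbours with first component \<open>one\<close>, \<open>z\<close>, or anything else are governed by \<open>uppers\<close> and
  \<open>lowers\<close>, so equality of the neighbourhoods turns into equations between these sets; they
  collapse because \<open>uppers y' \<subseteq> lowers y'\<close> already forces \<open>y'\<close> to be maximal.\<close>

lemma indistinguishable:
  assumes x': "x' \<in> H" "x' \<noteq> e" and b: "b \<in> A" "b \<noteq> one" and y': "y' \<in> H"
    and y_not_z: "(b, y') \<noteq> (z, e)"
    and indist: "\<forall>w\<in>A \<times> H - {(one, x'), (b, y'), (z, e)}. adj (one, x') w \<longleftrightarrow> adj (b, y') w"
    and not_isolated: "w1 \<in> A" "w' \<in> H" "adj (b, y') (w1, w')"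
  shows "\<exists>a\<in>A. a \<noteq> one \<and> a \<noteq> z" "y' \<noteq> e" "\<forall>h\<in>H. leH y' h \<longrightarrow> leH h y'"
    "lowers x' = {e}" "lowers y' \<subseteq> {e}"
proof -
  have same: "adj (one, x') (w1, w') \<longleftrightarrow> adj (b, y') (w1, w')"
    if "w1 \<in> A" "w' \<in> H" "(w1, w') \<noteq> (one, x')" "(w1, w') \<noteq> (b, y')" "(w1, w') \<noteq> (z, e)" for w1 w'
    using indist that by blast
  have e_lower: "e \<in> lowers h" if "h \<in> H" "h \<noteq> e" for h
    using that H e_leH leH_e compH_le by (auto simp: lowers_def)
  \<comment> \<open>A test vertex equivalent to \<open>x'\<close> but different from it, for use
    where \<open>x'\<close> itself is excluded from the comparison.\<close>
  obtain t where t: "t \<in> H" "t \<noteq> x'" "leH t x'" "leH x' t" using equivH x' by blast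
  \<comment> \<open>For any other \<open>b\<close> the vertex \<open>(b, e)\<close> is a legitimate
    test and forces \<open>y' = e\<close>. Then \<open>(one, t)\<close> is adjacent to
    \<open>(b, e)\<close> but not to \<open>(one, x')\<close>.\<close>
  have bz: "b = z"
  proof (rule ccontr)
    assume "b \<noteq> z"
    have "y' = e"
    proof (rule ccontr)
      assume "y' \<noteq> e"
      then have "adj (one, x') (b, e) \<longleftrightarrow> adj (b, y') (b, e)"
        using same[of b e] b H \<open>b \<noteq> z\<close> by auto
      moreover have "adj (one, x') (b, e)" using adj_one_nonone[OF x'(1) H b] e_lower x' by blast
      moreover have "\<not> adj (b, y') (b, e)" using reflA[OF b(1)] e_leH[OF y'] by (simp add: adj_def)
      ultimately show False by blast
    qed
    have "t \<noteq> e" using t x' leH_e[of x'] by blast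
    have "\<not> leA b one" "\<not> leH t e" using leA_one b leH_e t(1) \<open>t \<noteq> e\<close> by blast+
    then have "adj (b, e) (one, t)"
      using compA_one(2)[OF b(1)] compH_le[OF H t(1) e_leH[OF t(1)]] by (simp add: adj_def)
    moreover have "\<not> adj (one, x') (one, t)" using reflA[OF A(1)] t by (simp add: adj_def)
    ultimately show False using same[of one t] A b t \<open>y' = e\<close> by auto
  qed
  show y'e: "y' \<noteq> e" using y_not_z bz by blast
  obtain s where s: "s \<in> H" "s \<noteq> y'" "leH s y'" "leH y' s" using equivH y' y'e by blast
  have one_iff: "w \<in> lowers x' \<inter> uppers x' \<longleftrightarrow> w \<in> uppers y'" if "w \<in> H" "w \<noteq> x'" for w
    using same[of one w] A that adj_one_one[OF x'(1) that(1)] adj_z_one[OF y' that(1)]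
    by (simp add: bz)
  have z_iff: "w \<in> lowers x' \<longleftrightarrow> w \<in> lowers y' \<inter> uppers y'" if "w \<in> H" "w \<noteq> e" "w \<noteq> y'" for w
    using same[of z w] A that adj_one_nonone[OF x'(1) that(1) A(2,3)] adj_z_z[OF y' that(1)]
    by (simp add: bz)
  \<comment> \<open>\<open>one_iff\<close> says nothing about \<open>x'\<close>, but it covers the
    equivalent \<open>t\<close>, which would land in \<open>uppers x'\<close> although
    \<open>leH t x'\<close>.\<close>
  have x'_upper: "x' \<notin> uppers y'"
  proof
    assume "x' \<in> uppers y'"
    then have "compH t y'" "\<not> leH t y'"
      using compH_mono[of x' y' t] transH[of x' t y'] t x'(1) y' unfolding uppers_def by blast+
    then have "t \<in> uppers y'" using t(1) unfolding uppers_def by blast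
    then have "t \<in> uppers x'" using one_iff t by blast
    then show False using t by (simp add: uppers_def)
  qed
  \<comment> \<open>The same device for \<open>z_iff\<close>: the equivalent \<open>s\<close> of
    \<open>y'\<close> would land in \<open>uppers y'\<close> although
    \<open>leH s y'\<close>.\<close>
  have y'_lower: "y' \<notin> lowers x'"
  proof
    assume "y' \<in> lowers x'"
    then have "compH s x'" "\<not> leH x' s"
      using compH_mono[of y' x' s] transH[of x' s y'] s x'(1) y' unfolding lowers_def by blast+
    then have "s \<in> lowers x'" using s(1) unfolding lowers_def by blast
    moreover have "s \<noteq> e" using s y' y'e leH_e[of y'] by blast
    ultimately have "s \<in> uppers y'" using z_iff s by blast
    then show False using s by (simp add: uppers_def)
  qed
  have up: "w \<in> lowers y'" if "w \<in> uppers y'" for w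
  proof -
    have w: "w \<in> H" "w \<noteq> y'" "w \<noteq> e" "w \<noteq> x'"
      using that reflH[OF y'] e_leH[OF y'] x'_upper unfolding uppers_def by blast+
    then have "w \<in> lowers x'" using one_iff that by blast
    then show ?thesis using z_iff w by blast
  qed
  have max: "leH h y'" if "h \<in> H" "leH y' h" for h
  proof (rule ccontr)
    assume "\<not> leH h y'"
    then have "h \<in> uppers y'" using that compH_le[OF y' that] compH_sym[of h y'] unfolding uppers_def by blast
    then show False using up[of h] that(2) unfolding lowers_def by blast
  qed
  then show "\<forall>h\<in>H. leH y' h \<longrightarrow> leH h y'" by blast
  have no_upper: "uppers y' = {}"
  proof (rule ccontr)
    assume "uppers y' \<noteq> {}"
    then obtain h l where "h \<in> H" "\<not> leH h y'" "l \<in> H" "leH h l" "leH y' l"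
      by (auto simp: uppers_def compH_def)
    then show False using max[of l] transH[of h l y'] y' by blast
  qed
  have low: "w = e" if "w \<in> lowers x'" for w
  proof (rule ccontr)
    assume "w \<noteq> e"
    moreover have "w \<in> H" "w \<noteq> y'" using that y'_lower by (auto simp: lowers_def)
    ultimately show False using z_iff that no_upper by blast
  qed
  then show "lowers x' = {e}" using e_lower x' by blast
  \<comment> \<open>Vertices with first component beyond \<open>one\<close> and \<open>z\<close> see
    both \<open>(one, x')\<close> and \<open>(z, y')\<close> through \<open>lowers\<close>
    alone.\<close>
  have above: "lowers x' = lowers y'" if a: "a \<in> A" "a \<noteq> one" "a \<noteq> z" for a
  proof -
    have "w \<in> lowers x' \<longleftrightarrow> w \<in> lowers y'" if "w \<in> H" for w
      using same[of a w] a adj_one_nonone[OF x'(1) that a(1,2)] adj_z_above[OF y' that a] that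
      by (simp add: bz)
    then show ?thesis by (auto simp: lowers_def)
  qed
  \<comment> \<open>If \<open>one\<close> and \<open>z\<close> were the only first components, every
    neighbour of \<open>(z, y')\<close> would have its second component in the empty set
    \<open>uppers y'\<close>; but \<open>(b, y')\<close> has a neighbour.\<close>
  show ex: "\<exists>a\<in>A. a \<noteq> one \<and> a \<noteq> z"
  proof (rule ccontr)
    assume "\<not> ?thesis"
    then have "w1 = one \<or> w1 = z" using not_isolated by blast
    then show False
      using not_isolated adj_z_one[OF y' not_isolated(2)] adj_z_z[OF y' not_isolated(2)] no_upper
      by (auto simp: bz)
  qed
  then show "lowers y' \<subseteq> {e}" using above low by blast
qed

end

section \<open>Finite 2-groups with a single involution\<close>

lemma (in group) conj_hom:
  assumes "g \<in> carrier G"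
  shows "group_hom G G (\<lambda>x. g \<otimes> x \<otimes> inv g)"
proof unfold_locales
  have "g \<otimes> (x \<otimes> y) \<otimes> inv g = g \<otimes> x \<otimes> inv g \<otimes> (g \<otimes> y \<otimes> inv g)"
    if "x \<in> carrier G" "y \<in> carrier G" for x y
  proof -
    have "inv g \<otimes> (g \<otimes> (y \<otimes> inv g)) = y \<otimes> inv g"
      using that assms by (metis inv_closed l_inv l_one m_assoc m_closed)
    then show ?thesis using that assms by (simp add: m_assoc)
  qed
  then show "(\<lambda>x. g \<otimes> x \<otimes> inv g) \<in> hom G G"
    using assms by (auto simp: hom_def)
qed

lemma (in group) conj_int_pow:
  assumes "g \<in> carrier G" "x \<in> carrier G"
  shows "(g \<otimes> x \<otimes> inv g) [^] (k::int) = g \<otimes> x [^] k \<otimes> inv g"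
  using group_hom.hom_int_pow[OF conj_hom, of g x k] assms by simp

lemma (in group) conj_nat_pow:
  assumes "g \<in> carrier G" "x \<in> carrier G"
  shows "(g \<otimes> x \<otimes> inv g) [^] (k::nat) = g \<otimes> x [^] k \<otimes> inv g"
  using conj_int_pow[OF assms, of "int k"] by (simp add: int_pow_int)

lemma (in group) conj_eq_iff_comm:
  assumes "g \<in> carrier G" "x \<in> carrier G"
  shows "g \<otimes> x \<otimes> inv g = x \<longleftrightarrow> g \<otimes> x = x \<otimes> g"
proof -
  have "x = g \<otimes> x \<otimes> inv g \<longleftrightarrow> g \<otimes> x = x \<otimes> g"
    by (rule inv_solve_right) (use assms in auto)
  then show ?thesis by metis
qed

lemma (in group) generate_singleton_iff:
  assumes "c \<in> carrier G"
  shows "x \<in> generate G {c} \<longleftrightarrow> (\<exists>k::int. x = c [^] k)"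
  using generate_pow[OF assms] by auto

lemma (in group) lower_central_subset: "lower_central G n \<subseteq> carrier G"
proof (induction n)
  case (Suc n)
  then show ?case by (auto intro!: generate_incl)
qed auto

text \<open>A set that escapes \<open>N\<close> under commutators with all elements would put elements outside \<open>N\<close>
  into every term of the lower central series.\<close>

lemma (in group) nilpotent_ex_commutators_in:
  assumes nil: "nilpotent_group G" and "S \<noteq> {}" "S \<subseteq> carrier G" and one: "\<one> \<notin> S"
  shows "\<exists>x\<in>S. \<forall>g\<in>carrier G. x \<otimes> g \<otimes> inv x \<otimes> inv g \<notin> S"
proof (rule ccontr)
  assume "\<not> ?thesis"
  then have step: "\<exists>g\<in>carrier G. x \<otimes> g \<otimes> inv x \<otimes> inv g \<in> S" if "x \<in> S" for x
    using that by blast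
  have meets: "S \<inter> lower_central G n \<noteq> {}" for n
  proof (induction n)
    case 0
    then show ?case using assms by auto
  next
    case (Suc n)
    then obtain x where x: "x \<in> S" "x \<in> lower_central G n" by auto
    obtain g where "g \<in> carrier G" "x \<otimes> g \<otimes> inv x \<otimes> inv g \<in> S" using step x by blast
    then show ?case using x by (auto intro!: generate.incl)
  qed
  obtain n where "lower_central G n = {\<one>}"
    using nil unfolding nilpotent_group_def by blast
  then show False using one meets[of n] by auto
qed

lemma (in group) inv_cancel_left [simp]:
  assumes "g \<in> carrier G" "x \<in> carrier G"
  shows "g \<otimes> (inv g \<otimes> x) = x" "inv g \<otimes> (g \<otimes> x) = x"
  using assms by (metis inv_closed l_inv r_inv l_one m_assoc)+

lemma odd_dvd_two_power_cancel:
  fixes w x :: int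
  assumes "odd w" "2 ^ n dvd w * x"
  shows "2 ^ n dvd x"
proof -
  have "coprime (2 ^ n) w" using assms by simp
  then show ?thesis using assms coprime_dvd_mult_right_iff by blast
qed

text \<open>An odd \<open>w\<close> is invertible modulo \<open>2 ^ n\<close>, so \<open>i\<close>
  is \<open>- k\<close> times the inverse \<open>v\<close>.\<close>

lemma odd_solve_two_power:
  fixes w k :: int
  assumes "odd w"
  shows "\<exists>i. 2 ^ n dvd i * w + k"
proof -
  have "coprime w (2 ^ n)" using assms by simp
  then obtain v where "[w * v = 1] (mod 2 ^ n)" using cong_solve_coprime_int by blast
  then have "2 ^ n dvd - k * (w * v - 1)" by (simp add: cong_iff_dvd_diff)
  also have "- k * (w * v - 1) = (- k * v) * w + k" by (simp add: algebra_simps)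
  finally show ?thesis by blast
qed

text \<open>Hence inversion is not the square of an automorphism of a cyclic 2-group of order at
  least 4; this is how the lemma is used.\<close>

lemma not_four_dvd_square_plus_one:
  fixes u :: int
  shows "\<not> 4 dvd u * u + 1"
proof (cases "even u")
  case True
  then obtain k where "u = 2 * k" by blast
  then have "u * u + 1 = 4 * (k * k) + 1" by simp
  then show ?thesis by presburger
next
  case False
  then obtain k where "u = 2 * k + 1" by (metis oddE)
  then have "u * u + 1 = 4 * (k * k + k) + 2" by (simp add: algebra_simps)
  then show ?thesis by presburger
qed

locale two_group_one_involution = group G for G (structure) +
  fixes N :: nat and z
  assumes order: "order G = 2 ^ N"
    and nilpotent: "nilpotent_group G"
    and z: "z \<in> carrier G" "z \<noteq> \<one>" "z \<otimes> z = \<one>"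
    and uniq: "\<And>y. y \<in> carrier G \<Longrightarrow> y \<otimes> y = \<one> \<Longrightarrow> y = \<one> \<or> y = z"
begin

lemma finite_carrier: "finite (carrier G)"
  using order order_gt_0_iff_finite by simp

lemma ord_two_power:
  assumes "x \<in> carrier G"
  shows "\<exists>n. ord x = 2 ^ n"
  using ord_dvd_group_order[OF assms] order divides_primepow_nat[of 2] by auto

text \<open>Raising \<open>x\<close> to half of its order gives an element other than \<one> with
  square \<one>, which by uniqueness is \<open>z\<close>.\<close>

lemma generate_contains_z:
  assumes x: "x \<in> carrier G" "x \<noteq> \<one>"
  shows "\<exists>n. ord x = 2 ^ Suc n \<and> x [^] (2 ^ n :: nat) = z"
proof -
  obtain m where m: "ord x = 2 ^ m" using ord_two_power x by blast
  have "m \<noteq> 0" using m x ord_eq_1 by (metis power_0)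
  then obtain n where n: "m = Suc n" using not0_implies_Suc by blast
  have "x [^] (2 ^ n :: nat) \<otimes> x [^] (2 ^ n :: nat) = x [^] (2 ^ m :: nat)"
    using x n by (simp add: nat_pow_mult mult_2)
  also have "\<dots> = \<one>" using m x by (metis pow_ord_eq_1)
  finally have "x [^] (2 ^ n :: nat) = \<one> \<or> x [^] (2 ^ n :: nat) = z" using uniq x by blast
  moreover have "x [^] (2 ^ n :: nat) \<noteq> \<one>"
    using x m n by (simp add: pow_eq_id power_dvd_imp_le)
  ultimately show ?thesis using m n by blast
qed

text \<open>A conjugate of an involution is an involution, and there is only one.\<close>

lemma z_central:
  assumes g: "g \<in> carrier G"
  shows "g \<otimes> z \<otimes> inv g = z"
proof -
  have "(g \<otimes> z \<otimes> inv g) \<otimes> (g \<otimes> z \<otimes> inv g) = g \<otimes> (z \<otimes> z) \<otimes> inv g"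
    using g z(1) by (simp add: m_assoc)
  then have "g \<otimes> z \<otimes> inv g = \<one> \<or> g \<otimes> z \<otimes> inv g = z"
    using uniq g z by simp
  moreover have "g \<otimes> z \<otimes> inv g \<noteq> \<one>"
  proof
    assume "g \<otimes> z \<otimes> inv g = \<one>"
    moreover have "z = inv g \<otimes> (g \<otimes> z \<otimes> inv g) \<otimes> g"
      using g z(1) by (simp add: m_assoc)
    ultimately show False using g z(2) by simp
  qed
  ultimately show ?thesis by blast
qed

text \<open>Replaces an element outside a subgroup by one that is just outside: repeated squaring
  reaches \<one>, as the order is a power of 2, and the last power before the first entry into
  \<open>S\<close> has its square in \<open>S\<close>.\<close>

lemma least_two_power_in:
  assumes g: "g \<in> carrier G" "\<one> \<in> S" "g \<notin> S"
  obtains s where "g [^] (2 ^ s :: nat) \<notin> S" "g [^] (2 ^ Suc s :: nat) \<in> S"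
    "\<And>t. t \<le> s \<Longrightarrow> g [^] (2 ^ t :: nat) \<notin> S"
proof -
  let ?P = "\<lambda>s. g [^] (2 ^ s :: nat) \<in> S"
  have P: "?P N" using pow_order_eq_1[OF g(1)] g(2) by (simp add: order)
  have "\<not> ?P 0" using g by simp
  then have "(LEAST s. ?P s) \<noteq> 0" using LeastI[of ?P, OF P] by metis
  then obtain s where s: "(LEAST s. ?P s) = Suc s" using not0_implies_Suc by blast
  show ?thesis
  proof
    show "g [^] (2 ^ Suc s :: nat) \<in> S" using LeastI[of ?P, OF P] s by simp
    show "g [^] (2 ^ t :: nat) \<notin> S" if "t \<le> s" for t
      using not_less_Least[of t ?P] s that by auto
    then show "g [^] (2 ^ s :: nat) \<notin> S" by blast
  qed
qed

text \<open>The central \<open>z\<close> generates a normal cyclic subgroup, so the choice is not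
  vacuous and the largest one is nontrivial. Maximality is measured by order, which excludes any
  normal cyclic subgroup that properly contains \<langle>c\<rangle>.\<close>

lemma ex_maximal_normal_cyclic:
  obtains c where "c \<in> carrier G" "c \<noteq> \<one>"
    "\<And>g. g \<in> carrier G \<Longrightarrow> g \<otimes> c \<otimes> inv g \<in> generate G {c}"
    "\<And>d. d \<in> carrier G \<Longrightarrow> \<forall>g\<in>carrier G. g \<otimes> d \<otimes> inv g \<in> generate G {d}
      \<Longrightarrow> ord d \<le> ord c"
proof -
  let ?S = "{c \<in> carrier G. \<forall>g \<in> carrier G. g \<otimes> c \<otimes> inv g \<in> generate G {c}}"
  have zS: "z \<in> ?S" using z(1) by (simp add: z_central generate.incl)
  have fin: "finite (ord ` ?S)" using finite_carrier by simp
  then have "Max (ord ` ?S) \<in> ord ` ?S" using zS by (intro Max_in) auto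
  then obtain c where c: "c \<in> ?S" "ord c = Max (ord ` ?S)" by (elim imageE) simp
  have max: "ord d \<le> ord c" if "d \<in> ?S" for d
    unfolding c(2) using that fin by (intro Max_ge) auto
  have "c \<noteq> \<one>"
  proof
    assume "c = \<one>"
    then have "ord z \<le> 1" using max[OF zS] by simp
    moreover have "ord z \<ge> 1" using ord_ge_1[OF finite_carrier] z by blast
    ultimately show False using z(1,2) ord_eq_1[OF z(1)] by simp
  qed
  then show ?thesis using that[of c] c(1) max by simp
qed

end

locale two_group_normal_cyclic = two_group_one_involution +
  fixes c
  assumes c: "c \<in> carrier G" "c \<noteq> \<one>"
    and normal: "\<And>g. g \<in> carrier G \<Longrightarrow> g \<otimes> c \<otimes> inv g \<in> generate G {c}"
    and maximal: "\<And>d. d \<in> carrier G \<Longrightarrow> \<forall>g\<in>carrier G. g \<otimes> d \<otimes> inv g \<in> generate G {d}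
      \<Longrightarrow> ord d \<le> ord c"
begin

abbreviation "C \<equiv> generate G {c}"

lemma C_subgroup: "subgroup C G"
  using c by (intro generate_is_subgroup) auto

lemma C_iff: "x \<in> C \<longleftrightarrow> (\<exists>k::int. x = c [^] k)"
  using generate_singleton_iff c by blast

lemma one_in_C: "\<one> \<in> C" by (rule generate.one)

lemma z_in_C: "z \<in> C"
  using generate_contains_z[OF c] by (metis C_iff int_pow_int)

lemma square_eq_one_in_C:
  assumes "x \<in> carrier G" "x \<otimes> x = \<one>"
  shows "x \<in> C"
  using uniq[OF assms] z_in_C one_in_C by auto

lemma comm_C:
  assumes "x \<in> carrier G" "x \<otimes> c = c \<otimes> x" "y \<in> C"
  shows "x \<otimes> y = y \<otimes> x"
proof -
  obtain k :: int where k: "y = c [^] k" using assms C_iff by blast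
  have "x \<otimes> c \<otimes> inv x = c" using conj_eq_iff_comm[of x c] assms c by blast
  then have "x \<otimes> y \<otimes> inv x = y" using k conj_int_pow[of x c k] assms c by simp
  then show ?thesis using k conj_eq_iff_comm[of x y] assms c by simp
qed

text \<open>\<open>C\<close> is its own centralizer: otherwise some \<open>x\<close> outside \<open>C\<close> with \<open>x\<^sup>2 \<in> C\<close> is central
  modulo \<open>C\<close> and centralizes it. Then either \<open>C\<close> is a proper subgroup of the normal subgroup
  \<open>\<langle>x\<rangle>\<close>, or a translate of \<open>x\<close> by \<open>C\<close> is a new involution.\<close>

lemma centralizer_C:
  assumes "x \<in> carrier G" "x \<otimes> c = c \<otimes> x"
  shows "x \<in> C"
proof (rule ccontr)
  assume "x \<notin> C"
  define S where "S = {x \<in> carrier G. x \<otimes> c = c \<otimes> x} - C"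
  have "\<exists>x\<in>S. \<forall>g\<in>carrier G. x \<otimes> g \<otimes> inv x \<otimes> inv g \<notin> S"
  proof (rule nilpotent_ex_commutators_in[OF nilpotent])
    show "S \<noteq> {}" using \<open>x \<notin> C\<close> assms unfolding S_def by blast
    show "S \<subseteq> carrier G" "\<one> \<notin> S" using one_in_C unfolding S_def by blast+
  qed
  then obtain y where "y \<in> S"
    and yS: "\<And>g. g \<in> carrier G \<Longrightarrow> y \<otimes> g \<otimes> inv y \<otimes> inv g \<notin> S"
    by blast
  then have y: "y \<in> carrier G" "y \<otimes> c = c \<otimes> y" "y \<notin> C"
    unfolding S_def by blast+
  \<comment> \<open>The centralizer of \<open>C\<close> is normal because \<open>C\<close> is:
    moving a conjugate of \<open>w\<close> past \<open>c\<close> amounts to moving \<open>w\<close>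
    past the conjugate \<open>d\<close> of \<open>c\<close>, which is again in
    \<open>C\<close>.\<close>
  have centr: "g \<otimes> w \<otimes> inv g \<otimes> c = c \<otimes> (g \<otimes> w \<otimes> inv g)"
    if g: "g \<in> carrier G" and w: "w \<in> carrier G" "w \<otimes> c = c \<otimes> w" for g w
  proof -
    define d where "d = inv g \<otimes> c \<otimes> g"
    have "d \<in> C" using normal[of "inv g"] g by (simp add: d_def)
    then have comm: "w \<otimes> d = d \<otimes> w" using comm_C w by blast
    have "g \<otimes> w \<otimes> inv g \<otimes> c = g \<otimes> (w \<otimes> d) \<otimes> inv g"
      using g w(1) c(1) by (simp add: d_def m_assoc)
    also have "\<dots> = c \<otimes> (g \<otimes> w \<otimes> inv g)"
      unfolding comm using g w(1) c(1) by (simp add: d_def m_assoc)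
    finally show ?thesis .
  qed
  \<comment> \<open>The commutator is \<open>y\<close> times a conjugate of its inverse, so it
    centralizes \<open>c\<close>; since it is not in \<open>S\<close>, it lies in
    \<open>C\<close>.\<close>
  have ycomm: "y \<otimes> g \<otimes> inv y \<otimes> inv g \<in> C" if g: "g \<in> carrier G" for g
  proof -
    have "c \<otimes> inv y = inv y \<otimes> (y \<otimes> c) \<otimes> inv y" using y(1) c(1) by simp
    also have "\<dots> = inv y \<otimes> c" unfolding y(2) using y(1) c(1) by (simp add: m_assoc)
    finally have iy: "inv y \<otimes> c = c \<otimes> inv y" by simp
    define d where "d = g \<otimes> inv y \<otimes> inv g"
    have d: "d \<in> carrier G" "d \<otimes> c = c \<otimes> d"
      using centr[OF g _ iy] y(1) g by (simp_all add: d_def)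
    have e: "y \<otimes> g \<otimes> inv y \<otimes> inv g = y \<otimes> d" using y(1) g by (simp add: d_def m_assoc)
    have "y \<otimes> d \<otimes> c = y \<otimes> c \<otimes> d" using y(1) d c(1) by (simp add: m_assoc)
    also have "\<dots> = c \<otimes> (y \<otimes> d)" unfolding y(2) using y(1) d(1) c(1) by (simp add: m_assoc)
    finally have "y \<otimes> d \<otimes> c = c \<otimes> (y \<otimes> d)" .
    then show ?thesis using yS[OF g] y(1) d(1) unfolding e S_def by blast
  qed
  obtain s where s: "y [^] (2 ^ s :: nat) \<notin> C" "y [^] (2 ^ Suc s :: nat) \<in> C"
    using least_two_power_in[OF y(1) one_in_C y(3)] by blast
  \<comment> \<open>The last repeated square of \<open>y\<close> outside \<open>C\<close>. As a
    power of \<open>y\<close> it still centralizes \<open>c\<close> and is still central modulo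
    \<open>C\<close>.\<close>
  define x where "x = y [^] (2 ^ s :: nat)"
  have x: "x \<in> carrier G" "x \<notin> C" using s y by (auto simp: x_def)
  have xc: "x \<otimes> c = c \<otimes> x"
  proof -
    have "c \<otimes> y \<otimes> inv c = y" using conj_eq_iff_comm[OF c(1) y(1)] y(2) by metis
    then have "c \<otimes> x \<otimes> inv c = x" using conj_nat_pow[OF c(1) y(1)] by (simp add: x_def)
    then show ?thesis using conj_eq_iff_comm[OF c(1) x(1)] by metis
  qed
  have xx: "x \<otimes> x \<in> C"
  proof -
    have "x \<otimes> x = y [^] (2 ^ s + 2 ^ s :: nat)"
      unfolding x_def by (rule nat_pow_mult[OF y(1)])
    also have "2 ^ s + 2 ^ s = (2 ^ Suc s :: nat)"
      by simp
    finally show ?thesis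
      using s(2) by argo
  qed
  \<comment> \<open>Conjugation changes \<open>y\<close> by a factor \<open>n \<in> C\<close> that
    commutes with \<open>y\<close>, so it changes a power of \<open>y\<close> by the same power of
    \<open>n\<close>.\<close>
  have xg: "\<exists>n\<in>C. g \<otimes> x \<otimes> inv g = x \<otimes> n" if g: "g \<in> carrier G" for g
  proof -
    define n where "n = inv (y \<otimes> g \<otimes> inv y \<otimes> inv g)"
    have n: "n \<in> C" unfolding n_def by (rule subgroup.m_inv_closed[OF C_subgroup ycomm[OF g]])
    then have nc: "n \<in> carrier G" using subgroup.mem_carrier[OF C_subgroup] by simp
    have "g \<otimes> y \<otimes> inv g = n \<otimes> y"
      using g y(1) by (simp add: n_def inv_mult_group m_assoc)
    also have "\<dots> = y \<otimes> n" using comm_C[OF y(1,2) n] by simp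
    finally have "g \<otimes> x \<otimes> inv g = (y \<otimes> n) [^] (2 ^ s :: nat)"
      using conj_nat_pow[OF g y(1)] by (simp add: x_def)
    also have "\<dots> = x \<otimes> n [^] (2 ^ s :: nat)"
      using pow_mult_distrib[OF comm_C[OF y(1,2) n] y(1) nc] by (simp add: x_def)
    finally have "g \<otimes> x \<otimes> inv g = x \<otimes> n [^] (2 ^ s :: nat)" .
    moreover have "n [^] (2 ^ s :: nat) \<in> C"
      using subgroup_int_pow_closed[OF C_subgroup n, of "2 ^ s"] int_pow_int[of G n "2 ^ s"] by simp
    ultimately show ?thesis by blast
  qed
  obtain k :: int where k: "x \<otimes> x = c [^] k" using xx C_iff by blast
  show False
  proof (cases "even k")
    case True
    then obtain l where l: "k = 2 * l" by blast
    \<comment> \<open>\<open>c [^] l\<close> has the same square as \<open>x\<close> and commutes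
      with it; the quotient therefore has square \<one>.\<close>
    define w where "w = x \<otimes> c [^] (- l)"
    have cl: "c [^] (- l) \<in> C" using C_iff by blast
    have w: "w \<in> carrier G" using x(1) c(1) by (simp add: w_def)
    have "w \<otimes> w = x \<otimes> (c [^] (- l) \<otimes> x) \<otimes> c [^] (- l)"
      using x(1) c(1) by (simp add: w_def m_assoc)
    also have "\<dots> = x \<otimes> x \<otimes> (c [^] (- l) \<otimes> c [^] (- l))"
      unfolding comm_C[OF x(1) xc cl, symmetric] using x(1) c(1) by (simp add: m_assoc)
    also have "\<dots> = c [^] (k + (- l + - l))" using c(1) by (simp only: k int_pow_mult)
    also have "\<dots> = \<one>" using l c(1) by simp
    finally have "w \<in> C" using square_eq_one_in_C w by blast
    then have "w \<otimes> c [^] l \<in> C" using C_subgroup C_iff subgroup.m_closed by metis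
    moreover have "w \<otimes> c [^] l = x" using x(1) c(1)
      by (simp add: w_def m_assoc int_pow_neg)
    ultimately show False using x(2) by simp
  next
    case False
    obtain n where n: "ord c = 2 ^ n" using ord_two_power c by blast
    \<comment> \<open>The inverse of the odd \<open>k\<close> modulo the order of \<open>c\<close>;
      it recovers \<open>c\<close> from \<open>c [^] k = x \<otimes> x\<close>, so that
      \<open>c\<close> is a power of \<open>x\<close>.\<close>
    obtain i where i: "2 ^ n dvd i * k + - 1" using odd_solve_two_power[OF False] by blast
    have "c = (c [^] k) [^] i"
      using i n int_pow_eq[OF c(1), of 1 "k * i"] c(1)
      by (simp add: int_pow_pow mult.commute[of i])
    also have "\<dots> = (x [^] (2::int)) [^] i"
      using x(1) by (simp flip: k add: int_pow_mult[of x 1 1, simplified])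
    also have "\<dots> = x [^] (2 * i)" using x(1) by (simp add: int_pow_pow)
    finally have cx: "c = x [^] (2 * i)" .
    then have CX: "C \<subseteq> generate G {x}"
      using x(1) generate_is_subgroup[of "{x}"] generate_singleton_iff[OF x(1), of c]
      by (intro generate_subgroup_incl) blast+
    have "ord x \<le> ord c"
    proof (rule maximal[OF x(1)], rule ballI)
      fix g assume "g \<in> carrier G"
      then obtain n where "n \<in> C" "g \<otimes> x \<otimes> inv g = x \<otimes> n" using xg by blast
      then show "g \<otimes> x \<otimes> inv g \<in> generate G {x}"
        using CX by (auto intro: generate.eng generate.incl)
    qed
    moreover have "finite (generate G {x})"
      using finite_subset[OF generate_incl finite_carrier] x(1) by blast
    ultimately have "C = generate G {x}"
      using card_seteq[OF _ CX] generate_pow_card[OF x(1)] generate_pow_card[OF c(1)] by simp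
    then show False using x(2) generate.incl[of x "{x}" G] by simp
  qed
qed

lemma conj_C:
  assumes "g \<in> carrier G" "g \<otimes> c \<otimes> inv g = c [^] (u::int)"
  shows "g \<otimes> c [^] (v::int) \<otimes> inv g = c [^] (u * v)"
  using conj_int_pow[OF assms(1) c(1), of v] assms(2) c(1) by (simp add: int_pow_pow)

text \<open>If \<open>g\<close> acts on \<open>C\<close> as \<open>c \<mapsto> c\<^sup>u\<close>, then \<open>u\<^sup>2 \<equiv> 1\<close> modulo \<open>|C| = 2\<^sup>n\<^sup>+\<^sup>1\<close>, and for \<open>u\<close> other than
  \<open>-1\<close> some \<open>c\<^sup>ig\<close> would be a second involution.\<close>

lemma square_in_C_inverts:
  assumes g: "g \<in> carrier G" "g \<notin> C" and gg: "g \<otimes> g \<in> C"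
  shows "g \<otimes> c \<otimes> inv g = inv c"
proof -
  obtain n where n: "ord c = 2 ^ Suc n" using generate_contains_z c by blast
  have eq: "c [^] i = c [^] j \<longleftrightarrow> 2 ^ Suc n dvd j - i" for i j :: int
    using int_pow_eq[OF c(1), of i j] by (simp add: n)
  obtain u :: int where u: "g \<otimes> c \<otimes> inv g = c [^] u" using normal[OF g(1)] C_iff by blast
  obtain k :: int where k: "g \<otimes> g = c [^] k" using gg C_iff by blast
  note conj = conj_C[OF g(1) u]
  have "c [^] (1::int) = c [^] (u * u)"
  proof -
    have "c [^] (u * u) = g \<otimes> (g \<otimes> c \<otimes> inv g) \<otimes> inv g" by (simp only: u conj)
    also have "\<dots> = (g \<otimes> g) \<otimes> c \<otimes> inv (g \<otimes> g)"
      using g(1) c(1) by (simp add: m_assoc inv_mult_group)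
    also have "\<dots> = c"
    proof -
      have "c \<otimes> (g \<otimes> g) = (g \<otimes> g) \<otimes> c" by (rule comm_C[OF c(1) refl gg])
      then show ?thesis using conj_eq_iff_comm[of "g \<otimes> g" c] g(1) c(1) by simp
    qed
    finally show ?thesis using c(1) by (simp add: int_pow_1)
  qed
  then have uu: "2 ^ Suc n dvd u * u - 1" unfolding eq .
  \<comment> \<open>\<open>g\<close> commutes with its own square.\<close>
  have "c [^] k = c [^] (u * k)"
    using conj[of k] g(1) by (simp add: m_assoc flip: k)
  then have ku: "2 ^ Suc n dvd u * k - k" unfolding eq .
  \<comment> \<open>The expression is the exponent of the square of
    \<open>c [^] i \<otimes> g\<close>. If it vanished modulo the order, this element would lie in
    \<open>C\<close>, and so would \<open>g\<close>.\<close>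
  have noinv: "\<not> 2 ^ Suc n dvd i * (1 + u) + k" for i
  proof
    assume "2 ^ Suc n dvd i * (1 + u) + k"
    then have "c [^] (0::int) = c [^] (i + u * i + k)"
      unfolding eq by (simp add: algebra_simps)
    also have "\<dots> = c [^] i \<otimes> c [^] (u * i) \<otimes> c [^] k"
      using c(1) by (simp only: int_pow_mult)
    also have "\<dots> = c [^] i \<otimes> (g \<otimes> c [^] i \<otimes> inv g) \<otimes> (g \<otimes> g)"
      by (simp only: conj k)
    also have "\<dots> = (c [^] i \<otimes> g) \<otimes> (c [^] i \<otimes> g)"
      using c(1) g(1) by (simp add: m_assoc)
    finally have "c [^] i \<otimes> g \<in> C"
      using square_eq_one_in_C[of "c [^] i \<otimes> g"] c(1) g(1) by simp
    then have "c [^] (- i) \<otimes> (c [^] i \<otimes> g) \<in> C"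
      using C_iff subgroup.m_closed[OF C_subgroup, of "c [^] (- i)"] by blast
    moreover have "c [^] (- i) \<otimes> (c [^] i \<otimes> g) = g"
      using c(1) g(1) by (simp add: int_pow_neg)
    ultimately show False using g(2) by simp
  qed
  have "2 dvd u * u - 1" using uu by (rule dvd_trans[rotated]) simp
  then have "odd u" by auto
  then obtain m where m: "u = 2 * m + 1" by (metis oddE)
  \<comment> \<open>The residue of the odd \<open>u\<close> modulo 4 decides which of
    \<open>u + 1\<close> and \<open>u - 1\<close> is twice an odd number. If it is
    \<open>u + 1\<close>, then \<open>noinv\<close> makes \<open>k\<close> odd, \<open>ku\<close>
    gives \<open>u = 1\<close> modulo the order, and \<open>g\<close> would centralize
    \<open>C\<close>. If it is \<open>u - 1\<close>, then \<open>uu\<close> and \<open>ku\<close>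
    make \<open>u + 1\<close> and \<open>k\<close> multiples of \<open>2 ^ n\<close>.\<close>
  consider t where "u = 4 * t + 1" | t where "u = 4 * t + 3"
  proof (cases "even m")
    case True
    then show ?thesis using m that(1)[of "m div 2"] by auto
  next
    case False
    then show ?thesis using m that(2)[of "m div 2"] by (auto elim!: oddE)
  qed
  then have "2 ^ Suc n dvd u + 1"
  proof cases
    case 1
    have "odd k"
    proof
      assume "even k"
      then obtain l where l: "k = 2 * l" by blast
      have "odd (2 * t + 1)" by simp
      then obtain i where "2 ^ n dvd i * (2 * t + 1) + l" using odd_solve_two_power by blast
      then have "2 * 2 ^ n dvd 2 * (i * (2 * t + 1) + l)" by (rule mult_dvd_mono[OF dvd_refl])
      also have "2 * (i * (2 * t + 1) + l) = i * (1 + u) + k" by (simp add: 1 l algebra_simps)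
      finally show False using noinv by simp
    qed
    moreover have "2 ^ Suc n dvd k * (u - 1)" using ku by (simp add: algebra_simps)
    ultimately have "2 ^ Suc n dvd u - 1" by (rule odd_dvd_two_power_cancel)
    then have "c [^] (1::int) = c [^] u" unfolding eq .
    then have "g \<otimes> c \<otimes> inv g = c" using u c(1) by (simp add: int_pow_1)
    then have "g \<in> C" using conj_eq_iff_comm[OF g(1) c(1)] centralizer_C[OF g(1)] by blast
    then show ?thesis using g(2) by blast
  next
    case 2
    have t: "odd (2 * t + 1)" by simp
    have "2 * 2 ^ n dvd 2 * ((2 * t + 1) * (u + 1))" using uu by (simp add: 2 algebra_simps)
    then have "2 ^ n dvd (2 * t + 1) * (u + 1)" by simp
    then obtain e where e: "u + 1 = 2 ^ n * e" using odd_dvd_two_power_cancel[OF t] by blast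
    have "2 * 2 ^ n dvd 2 * ((2 * t + 1) * k)" using ku by (simp add: 2 algebra_simps)
    then have "2 ^ n dvd (2 * t + 1) * k" by simp
    then obtain f where f: "k = 2 ^ n * f" using odd_dvd_two_power_cancel[OF t] by blast
    \<comment> \<open>Only one factor 2 is missing: \<open>noinv\<close> at \<open>i = 0\<close>
      says that \<open>f\<close> is odd, and at \<open>i = 1\<close> that \<open>e + f\<close> is
      odd, so \<open>e\<close> is even.\<close>
    have "odd f" using noinv[of 0] f by auto
    have "even e"
    proof (rule ccontr)
      assume "odd e"
      then have "2 dvd e + f" using \<open>odd f\<close> by simp
      then have "2 ^ n * 2 dvd 2 ^ n * (e + f)" by simp
      also have "2 ^ n * (e + f) = 1 * (1 + u) + k" using e f by (simp add: algebra_simps)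
      finally show False using noinv[of 1] by (simp add: mult.commute)
    qed
    then show ?thesis using e by auto
  qed
  then have "c [^] (- 1 :: int) = c [^] u" unfolding eq by simp
  then show ?thesis using u c(1) by (simp add: int_pow_neg int_pow_1)
qed

text \<open>On a group of order 2 inversion is the identity, so \<open>g\<close> would centralize
  \<open>C\<close> and lie in it.\<close>

lemma inverts_not_in_C_ord:
  assumes g: "g \<in> carrier G" "g \<notin> C" and inv: "g \<otimes> c \<otimes> inv g = inv c"
    and n: "ord c = 2 ^ Suc n"
  shows "n > 0"
proof (rule ccontr)
  assume "\<not> n > 0"
  then have "c [^] (2::nat) = \<one>" using n pow_ord_eq_1[OF c(1)] by simp
  then have "c \<otimes> c = \<one>" using c(1) by (simp add: numeral_2_eq_2)
  then have "inv c = c" using c(1) by (simp add: inv_equality)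
  then have "g \<in> C" using inv conj_eq_iff_comm[OF g(1) c(1)] centralizer_C[OF g(1)] by simp
  then show False using g(2) by blast
qed

text \<open>Otherwise some power \<open>h\<close> of \<open>g\<close> has its square outside
  \<open>C\<close> and its fourth power inside. Then \<open>h \<otimes> h\<close> inverts
  \<open>c\<close>, so \<open>h\<close> acts on \<open>C\<close> by an exponent \<open>u\<close>
  with \<open>u * u = - 1\<close> modulo the order of \<open>c\<close>, which is divisible by
  4.\<close>

lemma square_in_C:
  assumes g: "g \<in> carrier G"
  shows "g \<otimes> g \<in> C"
proof (rule ccontr)
  assume gg: "g \<otimes> g \<notin> C"
  obtain n where n: "ord c = 2 ^ Suc n" using generate_contains_z c by blast
  obtain s where s: "(g \<otimes> g) [^] (2 ^ s :: nat) \<notin> C" "(g \<otimes> g) [^] (2 ^ Suc s :: nat) \<in> C"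
    using least_two_power_in[of "g \<otimes> g" C] g one_in_C gg by auto
  define h where "h = g [^] (2 ^ s :: nat)"
  have h: "h \<in> carrier G" using g by (simp add: h_def)
  have hh: "h \<otimes> h = (g \<otimes> g) [^] (2 ^ s :: nat)"
    using pow_mult_distrib[OF refl g g, of "2 ^ s"] by (simp add: h_def)
  then have "h \<otimes> h \<otimes> (h \<otimes> h) = (g \<otimes> g) [^] (2 ^ s + 2 ^ s :: nat)"
    using nat_pow_mult[of "g \<otimes> g" "2 ^ s" "2 ^ s"] g by simp
  also have "2 ^ s + 2 ^ s = (2 ^ Suc s :: nat)" by simp
  finally have hhhh: "h \<otimes> h \<otimes> (h \<otimes> h) \<in> C" using s(2) by argo
  have hhC: "h \<otimes> h \<notin> C" using s(1) hh by argo
  have inv: "(h \<otimes> h) \<otimes> c \<otimes> inv (h \<otimes> h) = inv c"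
    by (rule square_in_C_inverts[OF _ hhC hhhh]) (use h in simp)
  have "n > 0" by (rule inverts_not_in_C_ord[OF _ hhC inv n]) (use h in simp)
  obtain u :: int where u: "h \<otimes> c \<otimes> inv h = c [^] u" using normal[OF h] C_iff by blast
  have "c [^] (- 1 :: int) = h \<otimes> (h \<otimes> c \<otimes> inv h) \<otimes> inv h"
    using inv h c(1) by (simp add: m_assoc inv_mult_group int_pow_neg int_pow_1)
  also have "\<dots> = c [^] (u * u)" by (simp only: u conj_C[OF h u])
  finally have "2 ^ Suc n dvd u * u + 1" using int_pow_eq[OF c(1), of "- 1" "u * u"] n by simp
  moreover have "(4::int) dvd 2 ^ Suc n"
    using \<open>n > 0\<close> le_imp_power_dvd[of 2 "Suc n" "2::int"] by simp
  ultimately show False using not_four_dvd_square_plus_one dvd_trans by blast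
qed

text \<open>Every element outside \<open>C\<close> inverts \<open>c\<close>, so two of them differ
  by an element that centralizes \<open>c\<close> and hence lies in \<open>C\<close>: the index of
  \<open>C\<close> is 2. With \<open>b \<otimes> b = z\<close> the defining relations hold, and the
  homomorphism that they induce is surjective between groups of equal order.\<close>

lemma iso_generalized_quaternion:
  assumes b: "b \<in> carrier G" "b \<notin> C"
  shows "\<exists>r\<ge>1. G \<cong> generalized_quaternion (2 ^ r)"
proof -
  obtain n where n: "ord c = 2 ^ Suc n" "c [^] (2 ^ n :: nat) = z"
    using generate_contains_z c by blast
  have inv: "g \<otimes> c \<otimes> inv g = inv c" if "g \<in> carrier G" "g \<notin> C" for g
    using square_in_C_inverts[OF that square_in_C[OF that(1)]] .
  have "n > 0" using inverts_not_in_C_ord[OF b inv[OF b] n(1)] .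
  have bb: "b \<otimes> b = z"
  proof -
    obtain k :: int where k: "b \<otimes> b = c [^] k" using square_in_C[OF b(1)] C_iff by blast
    \<comment> \<open>Conjugation by \<open>b\<close> fixes \<open>b \<otimes> b\<close> as a power
      of \<open>b\<close> and inverts it as an element of \<open>C\<close>.\<close>
    have "b \<otimes> (b \<otimes> b) \<otimes> inv b = (b \<otimes> c \<otimes> inv b) [^] k"
      using conj_int_pow[OF b(1) c(1), of k] by (simp add: k)
    also have "\<dots> = inv (b \<otimes> b)"
      using c(1) by (simp add: inv[OF b] k int_pow_inv)
    finally have "b \<otimes> b = inv (b \<otimes> b)" using b(1) by (simp add: m_assoc)
    then have "(b \<otimes> b) \<otimes> (b \<otimes> b) = \<one>" using b(1) r_inv[of "b \<otimes> b"] by simp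
    then have "b \<otimes> b = \<one> \<or> b \<otimes> b = z" using uniq b(1) by simp
    then show ?thesis using square_eq_one_in_C[OF b(1)] b(2) by blast
  qed
  have bC: "\<exists>y\<in>C. g = b \<otimes> y" if g: "g \<in> carrier G" "g \<notin> C" for g
  proof
    have "(inv b \<otimes> g) \<otimes> c \<otimes> inv (inv b \<otimes> g) = inv b \<otimes> (g \<otimes> c \<otimes> inv g) \<otimes> b"
      using g(1) b(1) c(1) by (simp add: m_assoc inv_mult_group)
    also have "\<dots> = inv b \<otimes> (b \<otimes> c \<otimes> inv b) \<otimes> b" by (simp only: inv[OF g] inv[OF b])
    also have "\<dots> = c" using b(1) c(1) by (simp add: m_assoc)
    finally show "inv b \<otimes> g \<in> C"
      using conj_eq_iff_comm[of "inv b \<otimes> g" c] centralizer_C[of "inv b \<otimes> g"] b(1) g(1) c(1)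
      by simp
    show "g = b \<otimes> (inv b \<otimes> g)" using b(1) g(1) by simp
  qed
  have C_sub: "C \<subseteq> carrier G" using subgroup.subset[OF C_subgroup] .
  have carrier: "carrier G = C \<union> (\<lambda>y. b \<otimes> y) ` C"
    using bC b(1) C_sub by blast
  have "order G = card C + card ((\<lambda>y. b \<otimes> y) ` C)"
    unfolding order_def carrier
  proof (rule card_Un_disjoint)
    show "finite C" using C_sub finite_carrier finite_subset by blast
    then show "finite ((\<lambda>y. b \<otimes> y) ` C)" by blast
    show "C \<inter> (\<lambda>y. b \<otimes> y) ` C = {}"
    proof (rule ccontr)
      assume "C \<inter> (\<lambda>y. b \<otimes> y) ` C \<noteq> {}"
      then obtain y where y: "y \<in> C" "b \<otimes> y \<in> C" by blast
      have "b \<otimes> y \<otimes> inv y \<in> C"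
        by (rule subgroup.m_closed[OF C_subgroup y(2) subgroup.m_inv_closed[OF C_subgroup y(1)]])
      moreover have "b \<otimes> y \<otimes> inv y = b"
        using y(1) C_sub b(1) by (simp add: m_assoc subsetD)
      ultimately show False using b(2) by simp
    qed
  qed
  also have "card ((\<lambda>y. b \<otimes> y) ` C) = card C"
    using b(1) C_sub by (intro card_image inj_onI) (simp add: subset_iff)
  also have "card C = 2 ^ Suc n" using generate_pow_card[OF c(1)] n by simp
  finally have ord: "order G = 4 * 2 ^ n" by simp
  let ?Q = "generalized_quaternion (2 ^ n)"
  have "\<exists>f \<in> hom ?Q G. f (1, False) = c \<and> f (0, True) = b"
  proof (rule generalized_quaternion_universal[OF is_group c(1) b(1)])
    show "c [^] (2 * 2 ^ n :: nat) = \<one>" using pow_ord_eq_1[OF c(1)] n(1) by simp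
    show "c [^] (2 ^ n :: nat) = b [^] (2::nat)" using n(2) bb b(1) by (simp add: numeral_2_eq_2)
    have "b \<otimes> inv c = b \<otimes> (b \<otimes> c \<otimes> inv b)" by (simp only: inv[OF b])
    also have "\<dots> = (b \<otimes> b) \<otimes> c \<otimes> inv b" using b(1) c(1) by (simp add: m_assoc)
    also have "(b \<otimes> b) \<otimes> c = c \<otimes> (b \<otimes> b)"
      using comm_C[OF c(1) refl z_in_C] by (simp add: bb)
    finally show "c \<otimes> b = b \<otimes> inv c" using b(1) c(1) by (simp add: m_assoc)
    show "2 \<le> (2 ^ n :: nat)" using \<open>n > 0\<close> self_le_power[of 2 n] by simp
  qed
  then obtain f where f: "f \<in> hom ?Q G" "f (1, False) = c" "f (0, True) = b" by blast
  interpret Q: group ?Q by (rule generalized_quaternion_group) simp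
  interpret f: group_hom ?Q G f by unfold_locales (rule f(1))
  have img: "subgroup (f ` carrier ?Q) G" by (rule f.img_is_subgroup)
  have "(0::int) < 2 ^ n" by simp
  then have "(1::int) < 2 * 2 ^ n" by linarith
  then have in_Q: "(1, False) \<in> carrier ?Q" "(0, True) \<in> carrier ?Q"
    by (auto simp: generalized_quaternion_def)
  have cb: "c \<in> f ` carrier ?Q" "b \<in> f ` carrier ?Q"
    using imageI[OF in_Q(1), of f] imageI[OF in_Q(2), of f] by (simp_all only: f(2,3))
  have "C \<subseteq> f ` carrier ?Q" by (rule generate_subgroup_incl[OF _ img]) (use cb(1) in blast)
  moreover have "(\<lambda>y. b \<otimes> y) ` C \<subseteq> f ` carrier ?Q"
    by (rule image_subsetI) (rule subgroup.m_closed[OF img cb(2) subsetD[OF calculation]])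
  ultimately have "carrier G \<subseteq> f ` carrier ?Q"
    unfolding carrier by (rule Un_least)
  then have surj: "f ` carrier ?Q = carrier G"
    using subgroup.subset[OF img] by blast
  have "inj_on f (carrier ?Q)"
  proof (rule eq_card_imp_inj_on)
    show "finite (carrier ?Q)" by (simp add: generalized_quaternion_def)
    show "card (f ` carrier ?Q) = card (carrier ?Q)"
      using surj ord order_generalized_quaternion[of "2 ^ n"] by (simp add: order_def)
  qed
  then have "f \<in> iso ?Q G" using f(1) surj by (simp add: iso_def bij_betw_def)
  then have "G \<cong> ?Q" using Q.iso_sym is_isoI by blast
  then show ?thesis using \<open>n > 0\<close> by (metis One_nat_def Suc_leI)
qed

lemma iso_integer_mod_group:
  assumes "carrier G = C"
  shows "G \<cong> integer_mod_group (ord c)"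
proof -
  have "ord c > 0" using ord_ge_1[OF finite_carrier c(1)] by simp
  let ?f = "\<lambda>i::int. c [^] i"
  have cmod: "c [^] (i mod int (ord c)) = c [^] i" for i :: int
    using int_pow_eq[OF c(1)] by (simp add: minus_mod_eq_mult_div)
  have "?f \<in> hom (integer_mod_group (ord c)) G"
    using c(1) by (auto simp: hom_def cmod int_pow_mult)
  moreover have "inj_on ?f {0..<int (ord c)}"
  proof (rule inj_onI)
    fix i j assume ij: "i \<in> {0..<int (ord c)}" "j \<in> {0..<int (ord c)}" and "c [^] i = c [^] j"
    then have "int (ord c) dvd j - i" using int_pow_eq[OF c(1)] by blast
    then have "j mod int (ord c) = i mod int (ord c)" by (simp add: mod_eq_dvd_iff)
    then show "i = j" using ij by simp
  qed
  moreover have "?f ` {0..<int (ord c)} = carrier G"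
  proof
    show "carrier G \<subseteq> ?f ` {0..<int (ord c)}"
    proof
      fix x assume "x \<in> carrier G"
      then obtain i where "x = c [^] (i mod int (ord c))" using assms C_iff cmod by auto
      then show "x \<in> ?f ` {0..<int (ord c)}" using \<open>ord c > 0\<close> by simp
    qed
  qed (use c(1) in auto)
  ultimately have "?f \<in> iso (integer_mod_group (ord c)) G"
    using \<open>ord c > 0\<close> by (simp add: iso_def bij_betw_def carrier_integer_mod_group)
  then show ?thesis using group.iso_sym[OF group_integer_mod_group] is_isoI by blast
qed

end

text \<open>The classical description of the finite 2-groups with one involution. The bound on the
  order discards the group of order 2, for which the exponent \<open>n\<close> would be 1.\<close>

theorem (in two_group_one_involution) cyclic_or_generalized_quaternion:
  assumes "order G > 2"
  shows "(\<exists>n>1. G \<cong> integer_mod_group (2 ^ n)) \<or> (\<exists>r\<ge>1. G \<cong> generalized_quaternion (2 ^ r))"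
proof -
  obtain c where c: "c \<in> carrier G" "c \<noteq> \<one>"
    "\<And>g. g \<in> carrier G \<Longrightarrow> g \<otimes> c \<otimes> inv g \<in> generate G {c}"
    "\<And>d. d \<in> carrier G \<Longrightarrow> \<forall>g\<in>carrier G. g \<otimes> d \<otimes> inv g \<in> generate G {d}
      \<Longrightarrow> ord d \<le> ord c"
    using ex_maximal_normal_cyclic by blast
  interpret two_group_normal_cyclic G N z c by unfold_locales (fact c)+
  show ?thesis
  proof (cases "carrier G = C")
    case True
    obtain n where n: "ord c = 2 ^ n" using ord_two_power c by blast
    have "order G = 2 ^ n" using True generate_pow_card[OF c(1)] n by (simp add: order_def)
    then have "n > 1" using assms by (cases n; cases "n - 1") auto
    then show ?thesis using iso_integer_mod_group[OF True] n by auto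
  next
    case False
    then obtain b where "b \<in> carrier G" "b \<notin> C" using subgroup.subset[OF C_subgroup] by blast
    then show ?thesis using iso_generalized_quaternion by blast
  qed
qed

section \<open>Products of groups of coprime prime power orders\<close>

lemma (in group) involution_power:
  assumes "order G = 2 ^ e" "b \<in> carrier G" "b \<noteq> \<one>"
  shows "\<exists>k::nat. b [^] k \<noteq> \<one> \<and> b [^] k \<otimes> b [^] k = \<one>"
proof -
  obtain m where m: "ord b = 2 ^ m"
    using ord_dvd_group_order[OF assms(2)] assms(1) divides_primepow_nat[of 2] by auto
  have "m \<noteq> 0" using m assms(3) ord_eq_1[OF assms(2)] by (cases m) auto
  then obtain n where n: "m = Suc n" using not0_implies_Suc by blast
  have "b [^] (2 ^ n :: nat) \<noteq> \<one>"
    using assms(2) m n by (simp add: pow_eq_id power_dvd_imp_le)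
  moreover have "b [^] (2 ^ n :: nat) \<otimes> b [^] (2 ^ n :: nat) = b [^] (2 ^ n + 2 ^ n :: nat)"
    by (rule nat_pow_mult[OF assms(2)])
  moreover have "(2 ^ n + 2 ^ n :: nat) = ord b" using m n by simp
  ultimately show ?thesis using pow_ord_eq_1[OF assms(2)] by metis
qed

text \<open>The exponent of an involution is an odd multiple of half of \<open>ord c\<close>, and
  two odd multiples of that half differ by a multiple of \<open>ord c\<close>.\<close>

lemma (in group) cyclic_involution_unique:
  assumes c: "c \<in> carrier G" and a: "power_le G a c" "a \<noteq> \<one>" "a \<otimes> a = \<one>"
    and b: "power_le G b c" "b \<noteq> \<one>" "b \<otimes> b = \<one>"
  shows "a = b"
proof -
  have half: "\<exists>w. 2 * s = int (ord c) * w \<and> odd w"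
    if "x = c [^] (s::int)" "x \<noteq> \<one>" "x \<otimes> x = \<one>" for x s
  proof -
    have "c [^] (s + s) = \<one>" using that(1,3) c by (simp only: int_pow_mult)
    then obtain w where w: "s + s = int (ord c) * w" using int_pow_eq_id[OF c] by blast
    have "odd w"
    proof
      assume "even w"
      then obtain v where "w = 2 * v" by blast
      then have "s = int (ord c) * v" using w by simp
      then show False using that(1,2) int_pow_eq_id[OF c] by simp
    qed
    then show ?thesis using w by auto
  qed
  obtain s t :: int where st: "a = c [^] s" "b = c [^] t"
    using a(1) b(1) power_le_iff[OF c] by blast
  obtain u where u: "2 * s = int (ord c) * u" "odd u" using half[OF st(1) a(2,3)] by blast
  obtain v where v: "2 * t = int (ord c) * v" "odd v" using half[OF st(2) b(2,3)] by blast
  have "even (v - u)" using u(2) v(2) by simp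
  then obtain w where w: "v - u = 2 * w" by (rule evenE)
  have "2 * (t - s) = int (ord c) * (v - u)" using u(1) v(1) by (simp add: right_diff_distrib)
  then have "t - s = int (ord c) * w" unfolding w by simp
  then have "int (ord c) dvd t - s" by simp
  then show ?thesis using int_pow_eq[OF c] st by blast
qed

text \<open>Some power of \<open>b\<close> is an involution. It lies with \<open>a\<close> in a
  common cyclic group, which has only one.\<close>

lemma (in group) involution_power_le:
  assumes "order G = 2 ^ e" and a: "a \<noteq> \<one>" "a \<otimes> a = \<one>" and b: "b \<in> carrier G" "b \<noteq> \<one>"
    and join: "power_joinable G a b"
  shows "power_le G a b"
proof -
  obtain c where c: "c \<in> carrier G" "power_le G a c" "power_le G b c"
    using join unfolding power_joinable_def by blast
  obtain k :: nat where k: "b [^] k \<noteq> \<one>" "b [^] k \<otimes> b [^] k = \<one>"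
    using involution_power[OF assms(1) b] by blast
  have le: "power_le G (b [^] k) b" using power_le_iff[OF b(1)] by (metis int_pow_int)
  then have "power_le G (b [^] k) c" using power_le_trans c by blast
  then have "a = b [^] k" using cyclic_involution_unique[OF c(1,2) a _ k] by blast
  then show ?thesis using le by simp
qed

lemma (in group) square_one_odd_order:
  assumes "odd (order G)" "x \<in> carrier G" "x \<otimes> x = \<one>"
  shows "x = \<one>"
proof -
  have "x [^] (2::nat) = \<one>" using assms(2,3) by (simp add: numeral_2_eq_2)
  then have "ord x dvd 2" using pow_eq_id[OF assms(2)] by blast
  then have "ord x = 1 \<or> ord x = 2" using two_is_prime_nat prime_nat_iff by blast
  moreover have "ord x \<noteq> 2" using ord_dvd_group_order[OF assms(2)] assms(1) by auto
  ultimately show ?thesis using ord_eq_1[OF assms(2)] by blast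
qed

text \<open>\<open>K i\<close> plays the Sylow subgroup for \<open>p i\<close>, and elements of
  \<open>G\<close> are studied through their coordinates \<open>\<phi> x i\<close>. A second factor
  is always at hand for building elements that are incomparable to a given one.\<close>

locale nilpotent_product = group G for G :: "('a, 'b) monoid_scheme" (structure) +
  fixes I :: "'i set" and K :: "'i \<Rightarrow> ('a, 'b) monoid_scheme" and p :: "'i \<Rightarrow> nat"
    and \<phi> :: "'a \<Rightarrow> 'i \<Rightarrow> 'a"
  assumes finite_carrier: "finite (carrier G)"
    and finite_I: "finite I" and two_factors: "i \<in> I \<Longrightarrow> \<exists>j\<in>I. j \<noteq> i" and I_ne: "I \<noteq> {}"
    and K_nilpotent: "i \<in> I \<Longrightarrow> nilpotent_group (K i)"
    and p_prime: "i \<in> I \<Longrightarrow> prime (p i)" and p_inj: "inj_on p I"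
    and K_order: "i \<in> I \<Longrightarrow> \<exists>e>0. order (K i) = p i ^ e"
    and \<phi>_iso: "\<phi> \<in> iso G (product_group I K)"
begin

abbreviation "D \<equiv> difference_graph G"

lemma K_group: "i \<in> I \<Longrightarrow> group (K i)"
  using K_nilpotent by (simp add: nilpotent_group_def)

lemma K_order_gt_1: "i \<in> I \<Longrightarrow> order (K i) > 1"
  using K_order[of i] prime_gt_1_nat[OF p_prime[of i]] one_less_power[of "p i"] by auto

lemma K_odd_order:
  assumes "i \<in> I" "p i \<noteq> 2"
  shows "odd (order (K i))"
proof -
  have "odd (p i)" using primes_dvd_imp_eq[OF two_is_prime_nat p_prime[OF assms(1)]] assms(2) by auto
  then show ?thesis using K_order[OF assms(1)] by auto
qed

lemma K_finite: "i \<in> I \<Longrightarrow> finite (carrier (K i))"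
  by (rule card_ge_0_finite) (use K_order_gt_1[of i] in \<open>simp add: order_def\<close>)

lemma K_coprime:
  assumes "i \<in> I" "j \<in> I" "i \<noteq> j"
  shows "coprime (order (K i)) (order (K j))"
proof -
  have "p i \<noteq> p j" using inj_onD[OF p_inj _ assms(1,2)] assms(3) by blast
  then have "coprime (p i) (p j)" using primes_coprime p_prime assms by blast
  then show ?thesis using K_order[OF assms(1)] K_order[OF assms(2)] by auto
qed

lemma K_nontrivial:
  assumes "i \<in> I"
  obtains g where "g \<in> carrier (K i)" "g \<noteq> \<one>\<^bsub>K i\<^esub>"
proof -
  have "carrier (K i) \<noteq> {\<one>\<^bsub>K i\<^esub>}" using K_order_gt_1[OF assms] by (auto simp: order_def)
  moreover have "\<one>\<^bsub>K i\<^esub> \<in> carrier (K i)" using K_group[OF assms] group.is_monoid monoid.one_closed by blast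
  ultimately show ?thesis using that by blast
qed

lemma product_is_group: "group (product_group I K)"
  using K_group by simp

sublocale phi: group_hom G "product_group I K" \<phi>
  using \<phi>_iso product_is_group is_group by (simp add: group_hom_def group_hom_axioms_def iso_def)

lemma phi_closed: "x \<in> carrier G \<Longrightarrow> i \<in> I \<Longrightarrow> \<phi> x i \<in> carrier (K i)"
  using phi.hom_closed[of x] by auto

lemma phi_one: "i \<in> I \<Longrightarrow> \<phi> \<one> i = \<one>\<^bsub>K i\<^esub>"
  using phi.hom_one by simp

lemma phi_mult: "x \<in> carrier G \<Longrightarrow> y \<in> carrier G \<Longrightarrow> i \<in> I \<Longrightarrow> \<phi> (x \<otimes> y) i = \<phi> x i \<otimes>\<^bsub>K i\<^esub> \<phi> y i"
  using phi.hom_mult[of x y] by simp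

lemma phi_bij: "bij_betw \<phi> (carrier G) (\<Pi>\<^sub>E i\<in>I. carrier (K i))"
  using \<phi>_iso by (simp add: iso_def)

lemma phi_eqI:
  assumes "x \<in> carrier G" "y \<in> carrier G" "\<And>i. i \<in> I \<Longrightarrow> \<phi> x i = \<phi> y i"
  shows "x = y"
proof -
  have "\<phi> x \<in> (\<Pi>\<^sub>E i\<in>I. carrier (K i))" "\<phi> y \<in> (\<Pi>\<^sub>E i\<in>I. carrier (K i))"
    using assms phi_bij bij_betwE by blast+
  then have "\<phi> x = \<phi> y" using assms(3) by (rule PiE_ext)
  then show ?thesis using assms phi_bij by (meson bij_betw_imp_inj_on inj_onD)
qed

lemma phi_surj:
  assumes "\<And>i. i \<in> I \<Longrightarrow> f i \<in> carrier (K i)"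
  obtains x where "x \<in> carrier G" "\<And>i. i \<in> I \<Longrightarrow> \<phi> x i = f i"
proof -
  have "restrict f I \<in> \<phi> ` carrier G"
    using assms phi_bij by (simp add: bij_betw_def)
  then obtain x where x: "x \<in> carrier G" "\<phi> x = restrict f I" by (elim imageE) simp
  show ?thesis by (rule that[of x]) (simp_all add: x)
qed

lemma phi_update:
  assumes "x \<in> carrier G" "i \<in> I" "a \<in> carrier (K i)"
  obtains y where "y \<in> carrier G" "\<phi> y i = a" "\<And>j. j \<in> I \<Longrightarrow> j \<noteq> i \<Longrightarrow> \<phi> y j = \<phi> x j"
proof -
  have "((\<phi> x)(i := a)) j \<in> carrier (K j)" if "j \<in> I" for j
    using assms phi_closed that by simp
  then obtain y where "y \<in> carrier G" "\<And>j. j \<in> I \<Longrightarrow> \<phi> y j = ((\<phi> x)(i := a)) j"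
    using phi_surj by blast
  then show ?thesis using that[of y] assms(2) by simp
qed

lemma power_le_phi_iff:
  assumes "x \<in> carrier G" "y \<in> carrier G"
  shows "power_le G x y \<longleftrightarrow> (\<forall>i\<in>I. power_le (K i) (\<phi> x i) (\<phi> y i))"
proof -
  have "power_le G x y \<longleftrightarrow> power_le (product_group I K) (\<phi> x) (\<phi> y)"
    using iso_power_le[OF is_group product_is_group \<phi>_iso assms] by simp
  also have "\<dots> \<longleftrightarrow> (\<forall>i\<in>I. power_le (K i) (\<phi> x i) (\<phi> y i))"
    using assms phi.hom_closed
    by (intro power_le_product_group finite_I K_group K_finite K_coprime) auto
  finally show ?thesis .
qed

lemma power_joinable_phi_iff:
  assumes "x \<in> carrier G" "y \<in> carrier G"
  shows "power_joinable G x y \<longleftrightarrow> (\<forall>i\<in>I. power_joinable (K i) (\<phi> x i) (\<phi> y i))"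
proof
  assume "power_joinable G x y"
  then obtain g where g: "g \<in> carrier G" "power_le G x g" "power_le G y g"
    by (auto simp: power_joinable_def)
  then show "\<forall>i\<in>I. power_joinable (K i) (\<phi> x i) (\<phi> y i)"
    using phi_closed[OF g(1)] power_le_phi_iff assms unfolding power_joinable_def by blast
next
  assume "\<forall>i\<in>I. power_joinable (K i) (\<phi> x i) (\<phi> y i)"
  then have "\<forall>i\<in>I. \<exists>g. g \<in> carrier (K i) \<and> power_le (K i) (\<phi> x i) g \<and> power_le (K i) (\<phi> y i) g"
    unfolding power_joinable_def by blast
  then obtain f where f: "\<And>i. i \<in> I \<Longrightarrow> f i \<in> carrier (K i) \<and>
      power_le (K i) (\<phi> x i) (f i) \<and> power_le (K i) (\<phi> y i) (f i)"
    by metis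
  obtain g where g: "g \<in> carrier G" "\<And>i. i \<in> I \<Longrightarrow> \<phi> g i = f i" using phi_surj[of f] f by blast
  then have "power_le G x g" "power_le G y g" using power_le_phi_iff assms f by simp_all
  then show "power_joinable G x y" using g(1) by (auto simp: power_joinable_def)
qed

lemma power_joinable_K_I:
  assumes "i \<in> I" "g \<in> carrier (K i)" "power_le (K i) a g" "power_le (K i) b g"
  shows "power_joinable (K i) a b"
  using assms by (auto simp: power_joinable_def)

lemma power_le_K_refl: "i \<in> I \<Longrightarrow> power_le (K i) a a"
  using group.power_le_refl[OF K_group] .

lemma one_power_le_K: "i \<in> I \<Longrightarrow> power_le (K i) \<one>\<^bsub>K i\<^esub> a"
  using group.one_power_le[OF K_group] .

lemma power_le_one_K: "i \<in> I \<Longrightarrow> power_le (K i) a \<one>\<^bsub>K i\<^esub> \<longleftrightarrow> a = \<one>\<^bsub>K i\<^esub>"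
  using group.power_le_one_iff[OF K_group] .

text \<open>If a single coordinate could be enlarged, enlarging it and keeping the others would
  enlarge \<open>x\<close>.\<close>

lemma maximal_cyclic_generators_phi_iff:
  "x \<in> maximal_cyclic_generators G \<longleftrightarrow>
    x \<in> carrier G \<and> (\<forall>i\<in>I. \<phi> x i \<in> maximal_cyclic_generators (K i))"
proof (cases "x \<in> carrier G")
  case x: True
  have "(\<forall>y\<in>carrier G. power_le G x y \<longrightarrow> power_le G y x) \<longleftrightarrow>
    (\<forall>i\<in>I. \<forall>g\<in>carrier (K i). power_le (K i) (\<phi> x i) g \<longrightarrow> power_le (K i) g (\<phi> x i))"
  proof (intro iffI ballI impI)
    fix i g assume max: "\<forall>y\<in>carrier G. power_le G x y \<longrightarrow> power_le G y x"
      and i: "i \<in> I" and g: "g \<in> carrier (K i)" "power_le (K i) (\<phi> x i) g"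
    obtain y where y: "y \<in> carrier G" "\<phi> y i = g" "\<And>j. j \<in> I \<Longrightarrow> j \<noteq> i \<Longrightarrow> \<phi> y j = \<phi> x j"
      using phi_update[OF x i g(1)] by blast
    have "power_le (K j) (\<phi> x j) (\<phi> y j)" if "j \<in> I" for j
      using y g(2) that power_le_K_refl by (cases "j = i") auto
    then have "power_le G x y" using power_le_phi_iff x y(1) by blast
    then have "power_le G y x" using max y(1) by blast
    then show "power_le (K i) g (\<phi> x i)" using power_le_phi_iff[OF y(1) x] y(2) i by blast
  next
    fix y assume "\<forall>i\<in>I. \<forall>g\<in>carrier (K i). power_le (K i) (\<phi> x i) g \<longrightarrow> power_le (K i) g (\<phi> x i)"
      and y: "y \<in> carrier G" "power_le G x y"
    then show "power_le G y x" using power_le_phi_iff x phi_closed by metis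
  qed
  then show ?thesis
    using x maximal_cyclic_generators_iff[of x] group.maximal_cyclic_generators_iff[OF K_group] phi_closed[OF x]
    by auto
qed (simp add: maximal_cyclic_generators_iff)

lemma card_maximal_cyclic_generators:
  "card (maximal_cyclic_generators G) = (\<Prod>i\<in>I. card (maximal_cyclic_generators (K i)))"
proof -
  have sub: "maximal_cyclic_generators (K i) \<subseteq> carrier (K i)" for i
    by (auto simp: maximal_cyclic_generators_def)
  have "\<phi> ` maximal_cyclic_generators G = (\<Pi>\<^sub>E i\<in>I. maximal_cyclic_generators (K i))"
  proof
    show "\<phi> ` maximal_cyclic_generators G \<subseteq> (\<Pi>\<^sub>E i\<in>I. maximal_cyclic_generators (K i))"
    proof (rule image_subsetI)
      fix x assume "x \<in> maximal_cyclic_generators G"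
      then have "x \<in> carrier G" "\<forall>i\<in>I. \<phi> x i \<in> maximal_cyclic_generators (K i)"
        using maximal_cyclic_generators_phi_iff by blast+
      then show "\<phi> x \<in> (\<Pi>\<^sub>E i\<in>I. maximal_cyclic_generators (K i))"
        using phi.hom_closed[of x] by (simp add: PiE_iff)
    qed
    show "(\<Pi>\<^sub>E i\<in>I. maximal_cyclic_generators (K i)) \<subseteq> \<phi> ` maximal_cyclic_generators G"
    proof
      fix f assume f: "f \<in> (\<Pi>\<^sub>E i\<in>I. maximal_cyclic_generators (K i))"
      then have "f \<in> (\<Pi>\<^sub>E i\<in>I. carrier (K i))" using sub by (auto simp: PiE_iff)
      then have "f \<in> \<phi> ` carrier G" using phi_bij by (simp add: bij_betw_def)
      then obtain x where "x \<in> carrier G" "f = \<phi> x" by (elim imageE) simp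
      then show "f \<in> \<phi> ` maximal_cyclic_generators G"
        using f by (auto simp: maximal_cyclic_generators_phi_iff PiE_iff)
    qed
  qed
  moreover have "inj_on \<phi> (maximal_cyclic_generators G)"
    using phi_bij by (rule inj_on_subset[OF bij_betw_imp_inj_on]) (auto simp: maximal_cyclic_generators_def)
  from card_image[OF this] have
    "card (\<phi> ` maximal_cyclic_generators G) = card (maximal_cyclic_generators G)" .
  ultimately have "card (maximal_cyclic_generators G) = card (\<Pi>\<^sub>E i\<in>I. maximal_cyclic_generators (K i))"
    by simp
  then show ?thesis by (simp add: card_PiE finite_I)
qed

lemma arcI:
  assumes "x \<in> carrier G" "y \<in> carrier G"
    and "\<And>i. i \<in> I \<Longrightarrow> power_joinable (K i) (\<phi> x i) (\<phi> y i)"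
    and "i \<in> I" "\<not> power_le (K i) (\<phi> x i) (\<phi> y i)" "j \<in> I" "\<not> power_le (K j) (\<phi> y j) (\<phi> x j)"
  shows "(x, y) \<in> parcs D"
  unfolding arc_difference_graph_iff
  using assms power_le_phi_iff[OF assms(1,2)] power_le_phi_iff[OF assms(2,1)]
    power_joinable_phi_iff[OF assms(1,2)] by blast

text \<open>Let coordinate \<open>i\<close> of a nonidentity \<open>x\<close> lie strictly below
  \<open>g\<close>. If another coordinate \<open>j\<close> is nontrivial, a neighbour arises by
  raising coordinate \<open>i\<close> to \<open>g\<close> and replacing coordinate \<open>j\<close>
  by the identity. If not, \<open>x\<close> lives in coordinate \<open>i\<close> alone, and any
  nontrivial element that lives in another coordinate is a neighbour.\<close>

lemma pverts_eq: "pverts D = carrier G - {\<one>} - maximal_cyclic_generators G"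
proof
  show "pverts D \<subseteq> carrier G - {\<one>} - maximal_cyclic_generators G"
    using isolated_in_difference_graph pverts_difference_graph_iff arc_difference_graph_iff by blast
  show "carrier G - {\<one>} - maximal_cyclic_generators G \<subseteq> pverts D"
  proof
    fix x assume "x \<in> carrier G - {\<one>} - maximal_cyclic_generators G"
    then have x: "x \<in> carrier G" "x \<noteq> \<one>" "x \<notin> maximal_cyclic_generators G" by auto
    then obtain i where i: "i \<in> I" "\<phi> x i \<notin> maximal_cyclic_generators (K i)"
      using maximal_cyclic_generators_phi_iff by blast
    then obtain g where g: "g \<in> carrier (K i)" "power_le (K i) (\<phi> x i) g" "\<not> power_le (K i) g (\<phi> x i)"
      using group.maximal_cyclic_generators_iff[OF K_group[OF i(1)]] phi_closed[OF x(1) i(1)] by blast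
    have "\<exists>w. (x, w) \<in> parcs D"
    proof (cases "\<exists>j\<in>I. j \<noteq> i \<and> \<phi> x j \<noteq> \<one>\<^bsub>K j\<^esub>")
      case True
      then obtain j where j: "j \<in> I" "j \<noteq> i" "\<phi> x j \<noteq> \<one>\<^bsub>K j\<^esub>" by blast
      obtain v where v: "v \<in> carrier G" "\<phi> v i = g" "\<And>l. l \<in> I \<Longrightarrow> l \<noteq> i \<Longrightarrow> \<phi> v l = \<phi> x l"
        using phi_update[OF x(1) i(1) g(1)] by blast
      have "\<one>\<^bsub>K j\<^esub> \<in> carrier (K j)" using K_group[OF j(1)] group.is_monoid monoid.one_closed by blast
      then obtain w where w: "w \<in> carrier G" "\<phi> w j = \<one>\<^bsub>K j\<^esub>" "\<And>l. l \<in> I \<Longrightarrow> l \<noteq> j \<Longrightarrow> \<phi> w l = \<phi> v l"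
        using phi_update[OF v(1) j(1)] by blast
      have "power_joinable (K l) (\<phi> x l) (\<phi> w l)" if l: "l \<in> I" for l
      proof (rule power_joinable_K_I[OF l phi_closed[OF v(1) l]])
        show "power_le (K l) (\<phi> x l) (\<phi> v l)"
          using v g(2) l power_le_K_refl by (cases "l = i") auto
        show "power_le (K l) (\<phi> w l) (\<phi> v l)"
          using w l power_le_K_refl one_power_le_K by (cases "l = j") auto
      qed
      moreover have "\<phi> w i = g" using w(3) v(2) i(1) j(2) by simp
      ultimately have "(x, w) \<in> parcs D"
        using arcI[OF x(1) w(1) _ j(1) _ i(1)] g(3) w(2) j power_le_one_K by simp
      then show ?thesis by blast
    next
      case False
      then have xj: "\<phi> x j = \<one>\<^bsub>K j\<^esub>" if "j \<in> I" "j \<noteq> i" for j using that by blast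
      have xi: "\<phi> x i \<noteq> \<one>\<^bsub>K i\<^esub>"
      proof
        assume "\<phi> x i = \<one>\<^bsub>K i\<^esub>"
        then have "\<phi> x j = \<phi> \<one> j" if "j \<in> I" for j using xj that phi_one by (cases "j = i") auto
        then show False using phi_eqI[OF x(1) one_closed] x(2) by blast
      qed
      obtain j where j: "j \<in> I" "j \<noteq> i" using two_factors[OF i(1)] by blast
      obtain h where h: "h \<in> carrier (K j)" "h \<noteq> \<one>\<^bsub>K j\<^esub>" using K_nontrivial[OF j(1)] by blast
      obtain w where w: "w \<in> carrier G" "\<phi> w j = h" "\<And>l. l \<in> I \<Longrightarrow> l \<noteq> j \<Longrightarrow> \<phi> w l = \<phi> \<one> l"
        using phi_update[OF one_closed j(1) h(1)] by blast
      have "power_joinable (K l) (\<phi> x l) (\<phi> w l)" if l: "l \<in> I" for l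
      proof (cases "l = i")
        case True
        then show ?thesis
          using power_joinable_K_I[OF l phi_closed[OF x(1) l]] w(3) l j power_le_K_refl one_power_le_K phi_one
          by simp
      next
        case False
        then show ?thesis
          using power_joinable_K_I[OF l phi_closed[OF w(1) l]] xj l power_le_K_refl one_power_le_K
          by simp
      qed
      moreover have "\<phi> w i = \<one>\<^bsub>K i\<^esub>" using w(3) i(1) j phi_one by simp
      ultimately have "(x, w) \<in> parcs D"
        using arcI[OF x(1) w(1) _ i(1) _ j(1)] power_le_one_K i(1) j w(2) xj xi h(2) by simp
      then show ?thesis by blast
    qed
    then show "x \<in> pverts D" using pverts_difference_graph_iff by blast
  qed
qed

text \<open>The summand 1 is the identity. It is not among the generators of maximal cyclic
  subgroups because the factors are nontrivial.\<close>

lemma card_pverts: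
  "card (pverts D) + 1 + (\<Prod>i\<in>I. card (maximal_cyclic_generators (K i))) = order G"
proof -
  let ?M = "maximal_cyclic_generators G"
  have sub: "?M \<subseteq> carrier G" by (auto simp: maximal_cyclic_generators_def)
  have "\<one> \<notin> ?M"
  proof
    assume one: "\<one> \<in> ?M"
    obtain i where i: "i \<in> I" using I_ne by blast
    obtain g where g: "g \<in> carrier (K i)" "g \<noteq> \<one>\<^bsub>K i\<^esub>" using K_nontrivial[OF i] by blast
    have "\<one>\<^bsub>K i\<^esub> \<in> maximal_cyclic_generators (K i)"
      using one maximal_cyclic_generators_phi_iff i phi_one by metis
    then have "power_le (K i) g \<one>\<^bsub>K i\<^esub>"
      using group.maximal_cyclic_generators_iff[OF K_group[OF i]] g(1) one_power_le_K[OF i] by blast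
    then show False using power_le_one_K[OF i] g(2) by blast
  qed
  moreover have "finite ?M" using sub finite_carrier finite_subset by blast
  ultimately have "card (insert \<one> ?M) = Suc (card ?M)" by simp
  moreover have "pverts D = carrier G - insert \<one> ?M" using pverts_eq by blast
  moreover have "card (carrier G - insert \<one> ?M) = card (carrier G) - card (insert \<one> ?M)"
    using sub finite_carrier finite_subset by (intro card_Diff_subset) auto
  moreover have "card (insert \<one> ?M) \<le> card (carrier G)"
    using sub finite_carrier by (intro card_mono) auto
  ultimately show ?thesis
    using card_maximal_cyclic_generators by (simp add: order_def)
qed

lemma D_pair_graph: "pair_graph D"
  using pair_graph_difference_graph[OF finite_carrier] .

text \<open>Adjacency depends only on the cyclic subgroup that an element generates.\<close>

lemma twin_if_power_le:
  assumes "x \<in> pverts D" "y \<in> carrier G" "power_le G x y" "power_le G y x"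
  shows "(x, y) \<in> twin_rel D"
proof -
  have x: "x \<in> carrier G" using assms(1) pverts_eq by blast
  have "(x, v) \<in> parcs D \<longleftrightarrow> (y, v) \<in> parcs D" for v
    unfolding arc_difference_graph_iff power_joinable_def
    using assms(2-4) x power_le_trans[of x y] power_le_trans[of y x] power_le_trans[of v x y]
      power_le_trans[of v y x] by blast
  then have "open_nbhd D x = open_nbhd D y" "y \<in> pverts D"
    using assms(1) pverts_difference_graph_iff by (auto simp: open_nbhd_def)
  then show ?thesis using assms(1) by (simp add: twin_rel_def)
qed

lemma involution_component:
  assumes "z \<in> carrier G" "z \<noteq> \<one>" "z \<otimes> z = \<one>"
  obtains i where "i \<in> I" "p i = 2" "\<phi> z i \<noteq> \<one>\<^bsub>K i\<^esub>" "\<And>j. j \<in> I \<Longrightarrow> j \<noteq> i \<Longrightarrow> \<phi> z j = \<one>\<^bsub>K j\<^esub>"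
proof -
  have p2: "p i = 2" if i: "i \<in> I" "\<phi> z i \<noteq> \<one>\<^bsub>K i\<^esub>" for i
  proof (rule ccontr)
    assume p: "p i \<noteq> 2"
    have "\<phi> z i \<otimes>\<^bsub>K i\<^esub> \<phi> z i = \<one>\<^bsub>K i\<^esub>"
      using phi_mult[OF assms(1,1) i(1)] phi_one[OF i(1)] assms(3) by simp
    then show False
      using group.square_one_odd_order[OF K_group[OF i(1)] K_odd_order[OF i(1) p] phi_closed[OF assms(1) i(1)]] i(2)
      by blast
  qed
  have "\<exists>i\<in>I. \<phi> z i \<noteq> \<one>\<^bsub>K i\<^esub>"
    using phi_eqI[OF assms(1) one_closed] phi_one assms(2) by metis
  then obtain i where i: "i \<in> I" "\<phi> z i \<noteq> \<one>\<^bsub>K i\<^esub>" by blast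
  have "\<phi> z j = \<one>\<^bsub>K j\<^esub>" if j: "j \<in> I" "j \<noteq> i" for j
  proof (rule ccontr)
    assume "\<phi> z j \<noteq> \<one>\<^bsub>K j\<^esub>"
    then have "p j = p i" using p2 i j(1) by simp
    then show False using inj_onD[OF p_inj _ j(1) i(1)] j(2) by blast
  qed
  then show ?thesis using that[OF i(1) p2[OF i] i(2)] by blast
qed

text \<open>Since \<open>z\<close> is trivial outside \<open>i0\<close>, only that coordinate
  decides whether \<open>z\<close> is a power of \<open>v\<close>. If \<open>v\<close> is joinable
  with \<open>z\<close> and nontrivial there, its coordinate has that of \<open>z\<close> among its
  powers. If \<open>v\<close> is trivial there, the two live in disjoint sets of
  coordinates.\<close>

lemma involution_arc_iff:
  assumes z: "z \<in> carrier G" "z \<noteq> \<one>" "z \<otimes> z = \<one>"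
    and i0: "i0 \<in> I" "p i0 = 2"
  shows "(z, v) \<in> parcs D \<longleftrightarrow> v \<in> carrier G \<and> v \<noteq> \<one> \<and> \<phi> v i0 = \<one>\<^bsub>K i0\<^esub>"
proof -
  obtain i where i: "i \<in> I" "p i = 2" "\<phi> z i \<noteq> \<one>\<^bsub>K i\<^esub>"
    "\<And>j. j \<in> I \<Longrightarrow> j \<noteq> i \<Longrightarrow> \<phi> z j = \<one>\<^bsub>K j\<^esub>"
    using involution_component[OF z] by blast
  have "i = i0" using inj_onD[OF p_inj _ i(1) i0(1)] i(2) i0(2) by simp
  note i = i[unfolded this]
  show ?thesis
  proof
    assume "(z, v) \<in> parcs D"
    then have v: "v \<in> carrier G" "power_joinable G z v" "\<not> power_le G z v" "\<not> power_le G v z"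
      unfolding arc_difference_graph_iff by blast+
    have "v \<noteq> \<one>" using v(4) one_power_le by blast
    have join: "power_joinable (K i0) (\<phi> z i0) (\<phi> v i0)"
      using v(2) power_joinable_phi_iff[OF z(1) v(1)] i0(1) by blast
    have "power_le (K j) (\<phi> z j) (\<phi> v j)" if "j \<in> I" "j \<noteq> i0" for j
      using i(4)[OF that] one_power_le_K[OF that(1)] by simp
    then have nle: "\<not> power_le (K i0) (\<phi> z i0) (\<phi> v i0)"
      using v(3) power_le_phi_iff[OF z(1) v(1)] by blast
    obtain e where e: "order (K i0) = 2 ^ e" using K_order[OF i0(1)] i0(2) by auto
    have sq: "\<phi> z i0 \<otimes>\<^bsub>K i0\<^esub> \<phi> z i0 = \<one>\<^bsub>K i0\<^esub>"
      using phi_mult[OF z(1,1) i0(1)] phi_one[OF i0(1)] z(3) by simp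
    have "\<phi> v i0 = \<one>\<^bsub>K i0\<^esub>"
      using group.involution_power_le[OF K_group[OF i0(1)] e i(3) sq phi_closed[OF v(1) i0(1)] _ join] nle
      by blast
    then show "v \<in> carrier G \<and> v \<noteq> \<one> \<and> \<phi> v i0 = \<one>\<^bsub>K i0\<^esub>" using v(1) \<open>v \<noteq> \<one>\<close> by blast
  next
    assume v: "v \<in> carrier G \<and> v \<noteq> \<one> \<and> \<phi> v i0 = \<one>\<^bsub>K i0\<^esub>"
    have "\<exists>j\<in>I. \<phi> v j \<noteq> \<one>\<^bsub>K j\<^esub>" using phi_eqI[of v \<one>] phi_one v one_closed by metis
    then obtain j where j: "j \<in> I" "\<phi> v j \<noteq> \<one>\<^bsub>K j\<^esub>" by blast
    then have "j \<noteq> i0" using v by blast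
    show "(z, v) \<in> parcs D"
    proof (rule arcI[OF z(1) _ _ i0(1) _ j(1)])
      show "v \<in> carrier G" using v by blast
      show "\<not> power_le (K i0) (\<phi> z i0) (\<phi> v i0)" using v i(3) power_le_one_K[OF i0(1)] by simp
      show "\<not> power_le (K j) (\<phi> v j) (\<phi> z j)"
        using j i(4)[OF j(1) \<open>j \<noteq> i0\<close>] power_le_one_K[OF j(1)] by simp
      fix l assume l: "l \<in> I"
      show "power_joinable (K l) (\<phi> z l) (\<phi> v l)"
      proof (cases "l = i0")
        case True
        then show ?thesis
          using power_joinable_K_I[OF l phi_closed[OF z(1) l]] v l power_le_K_refl one_power_le_K by simp
      next
        case False
        then show ?thesis
          using power_joinable_K_I[OF l phi_closed[OF _ l], of v] v i(4)[OF l] l power_le_K_refl one_power_le_K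
          by simp
      qed
    qed
  qed
qed

lemma involution_in_pverts:
  assumes z: "z \<in> carrier G" "z \<noteq> \<one>" "z \<otimes> z = \<one>"
  shows "z \<in> pverts D"
proof -
  obtain i where i: "i \<in> I" "p i = 2" using involution_component[OF z] by blast
  obtain j where j: "j \<in> I" "j \<noteq> i" using two_factors[OF i(1)] by blast
  obtain h where h: "h \<in> carrier (K j)" "h \<noteq> \<one>\<^bsub>K j\<^esub>" using K_nontrivial[OF j(1)] by blast
  obtain w where w: "w \<in> carrier G" "\<phi> w j = h" "\<And>l. l \<in> I \<Longrightarrow> l \<noteq> j \<Longrightarrow> \<phi> w l = \<phi> \<one> l"
    using phi_update[OF one_closed j(1) h(1)] by blast
  have "w \<noteq> \<one>" using w(2) h(2) phi_one[OF j(1)] by blast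
  moreover have "\<phi> w i = \<one>\<^bsub>K i\<^esub>" using w(3) i(1) j(2) phi_one by simp
  ultimately show ?thesis
    using involution_arc_iff[OF z i] w(1) pverts_difference_graph_iff by blast
qed

lemma involutions_twin:
  assumes z: "z \<in> carrier G" "z \<noteq> \<one>" "z \<otimes> z = \<one>" and w: "w \<in> carrier G" "w \<noteq> \<one>" "w \<otimes> w = \<one>"
  shows "(z, w) \<in> twin_rel D"
proof -
  obtain i where i: "i \<in> I" "p i = 2" using involution_component[OF z] by blast
  have "open_nbhd D z = open_nbhd D w"
    using involution_arc_iff[OF z i] involution_arc_iff[OF w i] by (simp add: open_nbhd_def)
  then show ?thesis using involution_in_pverts z w by (simp add: twin_rel_def)
qed

lemma singleton_class_involution:
  assumes "w \<in> pverts D" "\<forall>v. (w, v) \<in> twin_rel D \<longrightarrow> v = w"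
  shows "w \<in> carrier G" "w \<noteq> \<one>" "w \<otimes> w = \<one>"
    "\<And>y. y \<in> carrier G \<Longrightarrow> y \<otimes> y = \<one> \<Longrightarrow> y = \<one> \<or> y = w"
proof -
  show w: "w \<in> carrier G" "w \<noteq> \<one>" using assms(1) pverts_eq by blast+
  have "power_le G w (inv w)" using power_le_inv[of "inv w"] w(1) by simp
  then have "inv w = w"
    using twin_if_power_le[OF assms(1) inv_closed[OF w(1)]] power_le_inv[OF w(1)] assms(2) by blast
  then show ww: "w \<otimes> w = \<one>" using r_inv[OF w(1)] by simp
  fix y assume "y \<in> carrier G" "y \<otimes> y = \<one>"
  then show "y = \<one> \<or> y = w" using involutions_twin[OF w ww] assms(2) by blast
qed

end

section \<open>Products with exactly one involution\<close>

locale nilpotent_product_one_involution = nilpotent_product +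
  fixes z i0
  assumes z: "z \<in> carrier G" "z \<noteq> \<one>" "z \<otimes> z = \<one>"
    and z_unique: "\<And>y. y \<in> carrier G \<Longrightarrow> y \<otimes> y = \<one> \<Longrightarrow> y = \<one> \<or> y = z"
    and i0: "i0 \<in> I" "p i0 = 2"
begin

lemmas z_arc_iff = involution_arc_iff[OF z i0]

lemma phi_z_i0: "\<phi> z i0 \<noteq> \<one>\<^bsub>K i0\<^esub>" and phi_z_other: "j \<in> I \<Longrightarrow> j \<noteq> i0 \<Longrightarrow> \<phi> z j = \<one>\<^bsub>K j\<^esub>"
proof -
  obtain i where i: "i \<in> I" "p i = 2" "\<phi> z i \<noteq> \<one>\<^bsub>K i\<^esub>"
    "\<And>j. j \<in> I \<Longrightarrow> j \<noteq> i \<Longrightarrow> \<phi> z j = \<one>\<^bsub>K j\<^esub>"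
    using involution_component[OF z] by blast
  have "i = i0" using inj_onD[OF p_inj _ i(1) i0(1)] i(2) i0(2) by simp
  note i = i[unfolded this]
  show "\<phi> z i0 \<noteq> \<one>\<^bsub>K i0\<^esub>" "j \<in> I \<Longrightarrow> j \<noteq> i0 \<Longrightarrow> \<phi> z j = \<one>\<^bsub>K j\<^esub>" using i by blast+
qed

text \<open>An element of the factor with square one, extended by identities, still has square one
  in \<open>G\<close>, so the uniqueness of \<open>z\<close> descends to coordinate
  \<open>i0\<close>.\<close>

lemma K_i0_one_involution: "\<exists>e. two_group_one_involution (K i0) e (\<phi> z i0)"
proof -
  interpret K0: group "K i0" using K_group[OF i0(1)] .
  obtain e where e: "order (K i0) = 2 ^ e" using K_order[OF i0(1)] i0(2) by auto
  have "two_group_one_involution (K i0) e (\<phi> z i0)"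
  proof unfold_locales
    show "order (K i0) = 2 ^ e" "nilpotent_group (K i0)" using e K_nilpotent[OF i0(1)] .
    show "\<phi> z i0 \<in> carrier (K i0)" "\<phi> z i0 \<noteq> \<one>\<^bsub>K i0\<^esub>"
      using phi_closed[OF z(1) i0(1)] phi_z_i0 .
    show "\<phi> z i0 \<otimes>\<^bsub>K i0\<^esub> \<phi> z i0 = \<one>\<^bsub>K i0\<^esub>"
      using phi_mult[OF z(1,1) i0(1)] phi_one[OF i0(1)] z(3) by simp
    fix a assume a: "a \<in> carrier (K i0)" "a \<otimes>\<^bsub>K i0\<^esub> a = \<one>\<^bsub>K i0\<^esub>"
    obtain y where y: "y \<in> carrier G" "\<phi> y i0 = a" "\<And>l. l \<in> I \<Longrightarrow> l \<noteq> i0 \<Longrightarrow> \<phi> y l = \<phi> \<one> l"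
      using phi_update[OF one_closed i0(1) a(1)] by blast
    have "\<phi> (y \<otimes> y) l = \<phi> \<one> l" if l: "l \<in> I" for l
    proof (cases "l = i0")
      case True
      then show ?thesis using phi_mult[OF y(1,1) l] y(2) a(2) phi_one[OF l] by simp
    next
      case False
      then show ?thesis
        using phi_mult[OF y(1,1) l] phi_mult[OF one_closed one_closed l] y(3)[OF l] by simp
    qed
    then have "y \<otimes> y = \<one>" using phi_eqI[of "y \<otimes> y" \<one>] y(1) by blast
    then have "y = \<one> \<or> y = z" using z_unique y(1) by blast
    then show "a = \<one>\<^bsub>K i0\<^esub> \<or> a = \<phi> z i0" using y(2) phi_one[OF i0(1)] by blast
  qed
  then show ?thesis by blast
qed

lemma phi_z_power_le:
  assumes "a \<in> carrier (K i0)" "a \<noteq> \<one>\<^bsub>K i0\<^esub>"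
  shows "power_le (K i0) (\<phi> z i0) a"
proof -
  obtain e where "two_group_one_involution (K i0) e (\<phi> z i0)" using K_i0_one_involution by blast
  then interpret K0: two_group_one_involution "K i0" e "\<phi> z i0" .
  show ?thesis
    using K0.generate_contains_z[OF assms] K0.power_le_iff_nat[OF K0.finite_carrier assms(1)] by metis
qed

lemma power_le_phi_z:
  assumes "power_le (K i0) a (\<phi> z i0)"
  shows "a = \<one>\<^bsub>K i0\<^esub> \<or> a = \<phi> z i0"
proof -
  obtain e where "two_group_one_involution (K i0) e (\<phi> z i0)" using K_i0_one_involution by blast
  then interpret K0: two_group_one_involution "K i0" e "\<phi> z i0" .
  obtain k :: nat where k: "a = \<phi> z i0 [^]\<^bsub>K i0\<^esub> k"
    using K0.power_le_iff_nat[OF K0.finite_carrier K0.z(1)] assms by blast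
  have "a \<otimes>\<^bsub>K i0\<^esub> a = (\<phi> z i0 \<otimes>\<^bsub>K i0\<^esub> \<phi> z i0) [^]\<^bsub>K i0\<^esub> k"
    unfolding k by (rule K0.pow_mult_distrib[OF refl K0.z(1,1), symmetric])
  also have "\<dots> = \<one>\<^bsub>K i0\<^esub>" by (simp add: K0.z(3))
  finally show ?thesis using K0.uniq[of a] k K0.z(1) by blast
qed

text \<open>A twin \<open>x\<close> of \<open>z\<close> is tested with three vertices. Its inverse,
  to which \<open>x\<close> is not adjacent, shows that the 2-part of \<open>x\<close> is
  nontrivial; the odd part of \<open>x\<close>, to which \<open>x\<close> is not adjacent either,
  must then be trivial. So \<open>x\<close> lies strictly above \<open>z\<close> in the 2-factor,
  and \<open>z\<close> with a nontrivial coordinate \<open>h\<close> added is adjacent to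
  \<open>x\<close> but not to \<open>z\<close>.\<close>

lemma z_class_singleton:
  assumes "(z, x) \<in> twin_rel D"
  shows "x = z"
proof (rule ccontr)
  assume "x \<noteq> z"
  interpret D: pair_graph D by (rule D_pair_graph)
  have xV: "x \<in> pverts D" using assms by (simp add: twin_rel_def)
  then have x: "x \<in> carrier G" "x \<noteq> \<one>" using pverts_eq by blast+
  have arc_iff: "(z, v) \<in> parcs D \<longleftrightarrow> (x, v) \<in> parcs D" if "v \<noteq> z" "v \<noteq> x" for v
    using D.twin_arc_iff[OF assms that] .
  have "x \<otimes> x \<noteq> \<one>" using z_unique x \<open>x \<noteq> z\<close> by blast
  then have inv_x: "inv x \<noteq> x" using r_inv[OF x(1)] by auto
  have "(x, inv x) \<notin> parcs D"
    unfolding arc_difference_graph_iff using power_le_inv[OF x(1)] by blast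
  moreover have "inv x \<noteq> z"
  proof
    assume "inv x = z"
    then have "x = inv z" using x(1) by auto
    also have "\<dots> = z" using inv_equality[OF z(3) z(1,1)] .
    finally show False using \<open>x \<noteq> z\<close> by blast
  qed
  ultimately have "(z, inv x) \<notin> parcs D" using arc_iff[of "inv x"] inv_x by blast
  then have "\<phi> (inv x) i0 \<noteq> \<one>\<^bsub>K i0\<^esub>"
    using z_arc_iff[of "inv x"] x inv_eq_1_iff by blast
  moreover have "\<phi> x i0 = \<one>\<^bsub>K i0\<^esub> \<Longrightarrow> \<phi> (inv x) i0 = \<one>\<^bsub>K i0\<^esub>"
    using power_le_phi_iff[OF inv_closed[OF x(1)] x(1)] power_le_inv[OF x(1)] i0(1) power_le_one_K[OF i0(1)]
    by metis
  ultimately have xi0: "\<phi> x i0 \<noteq> \<one>\<^bsub>K i0\<^esub>" by blast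
  have one_i0: "\<one>\<^bsub>K i0\<^esub> \<in> carrier (K i0)" using phi_closed[OF one_closed i0(1)] phi_one[OF i0(1)] by simp
  have x_other: "\<phi> x j = \<one>\<^bsub>K j\<^esub>" if j: "j \<in> I" "j \<noteq> i0" for j
  proof (rule ccontr)
    assume xj: "\<phi> x j \<noteq> \<one>\<^bsub>K j\<^esub>"
    obtain v where v: "v \<in> carrier G" "\<phi> v i0 = \<one>\<^bsub>K i0\<^esub>" "\<And>l. l \<in> I \<Longrightarrow> l \<noteq> i0 \<Longrightarrow> \<phi> v l = \<phi> x l"
      using phi_update[OF x(1) i0(1) one_i0] by blast
    have "v \<noteq> \<one>" using v(3)[OF j] xj phi_one[OF j(1)] by auto
    moreover have "power_le (K l) (\<phi> v l) (\<phi> x l)" if "l \<in> I" for l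
      using v(2,3) that power_le_K_refl one_power_le_K by (cases "l = i0") auto
    then have "power_le G v x" using power_le_phi_iff[OF v(1) x(1)] by blast
    then have "(x, v) \<notin> parcs D" unfolding arc_difference_graph_iff by blast
    moreover have "v \<noteq> x" using v(2) xi0 by blast
    moreover have "v \<noteq> z" using v(2) phi_z_i0 by blast
    ultimately show False using arc_iff[of v] z_arc_iff[of v] v(1,2) by blast
  qed
  have xi0z: "\<phi> x i0 \<noteq> \<phi> z i0"
  proof
    assume "\<phi> x i0 = \<phi> z i0"
    then have "\<phi> x l = \<phi> z l" if "l \<in> I" for l
      using that x_other phi_z_other by (cases "l = i0") auto
    then show False using phi_eqI[OF x(1) z(1)] \<open>x \<noteq> z\<close> by blast
  qed
  obtain j where j: "j \<in> I" "j \<noteq> i0" using two_factors[OF i0(1)] by blast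
  obtain h where h: "h \<in> carrier (K j)" "h \<noteq> \<one>\<^bsub>K j\<^esub>" using K_nontrivial[OF j(1)] by blast
  obtain w where w: "w \<in> carrier G" "\<phi> w j = h" "\<And>l. l \<in> I \<Longrightarrow> l \<noteq> j \<Longrightarrow> \<phi> w l = \<phi> z l"
    using phi_update[OF z(1) j(1) h(1)] by blast
  have wi0: "\<phi> w i0 = \<phi> z i0" using w(3)[OF i0(1)] j(2) by blast
  have le: "power_le (K i0) (\<phi> z i0) (\<phi> x i0)"
    using phi_z_power_le[OF phi_closed[OF x(1) i0(1)] xi0] .
  have "(x, w) \<in> parcs D"
  proof (rule arcI[OF x(1) w(1) _ i0(1) _ j(1)])
    show "\<not> power_le (K i0) (\<phi> x i0) (\<phi> w i0)" using power_le_phi_z xi0 xi0z unfolding wi0 by blast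
    show "\<not> power_le (K j) (\<phi> w j) (\<phi> x j)"
      unfolding w(2) x_other[OF j] using power_le_one_K[OF j(1)] h(2) by blast
    fix l assume l: "l \<in> I"
    show "power_joinable (K l) (\<phi> x l) (\<phi> w l)"
    proof (cases "l = i0")
      case True
      then show ?thesis
        using power_joinable_K_I[OF l phi_closed[OF x(1) l]] power_le_K_refl[OF l] le wi0 by simp
    next
      case False
      then show ?thesis
        using power_joinable_K_I[OF l phi_closed[OF w(1) l]] power_le_K_refl[OF l] one_power_le_K[OF l]
          x_other[OF l] by simp
    qed
  qed
  moreover have "w \<noteq> z" using w(2) h(2) phi_z_other[OF j] by blast
  moreover have "w \<noteq> x" using wi0 xi0z by auto
  ultimately have "(z, w) \<in> parcs D" using arc_iff by blast
  then show False using z_arc_iff[of w] wi0 phi_z_i0 by simp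
qed

section \<open>Splitting the product into its 2-part and its odd part\<close>

abbreviation "J \<equiv> I - {i0}"

definition "le_J f g \<longleftrightarrow> (\<forall>i\<in>J. power_le (K i) (f i) (g i))"

definition "one_J = (\<lambda>i\<in>J. \<one>\<^bsub>K i\<^esub>)"

definition "split_i0 x = (\<phi> x i0, restrict (\<phi> x) J)"

lemma one_closed_K: "i \<in> I \<Longrightarrow> \<one>\<^bsub>K i\<^esub> \<in> carrier (K i)"
  using phi_closed[OF one_closed] phi_one by metis

lemma one_J_eqI: "f \<in> (\<Pi>\<^sub>E i\<in>J. carrier (K i)) \<Longrightarrow> (\<And>i. i \<in> J \<Longrightarrow> f i = \<one>\<^bsub>K i\<^esub>) \<Longrightarrow> f = one_J"
  by (rule PiE_ext[of f J "\<lambda>i. carrier (K i)"]) (auto simp: one_J_def one_closed_K)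

lemma inv_eq_self_other:
  assumes i: "i \<in> J" and a: "a \<in> carrier (K i)" "inv\<^bsub>K i\<^esub> a = a"
  shows "a = \<one>\<^bsub>K i\<^esub>"
proof (rule group.square_one_odd_order[OF K_group])
  show iI: "i \<in> I" using i by blast
  have "p i \<noteq> 2" using inj_onD[OF p_inj _ iI i0(1)] i i0(2) by auto
  then show "odd (order (K i))" by (rule K_odd_order[OF iI])
  show "a \<in> carrier (K i)" by (rule a(1))
  show "a \<otimes>\<^bsub>K i\<^esub> a = \<one>\<^bsub>K i\<^esub>" using group.r_inv[OF K_group[OF iI] a(1)] a(2) by simp
qed

sublocale gen: gen_orders "carrier (K i0)" "power_le (K i0)" "\<one>\<^bsub>K i0\<^esub>" "\<phi> z i0"
  "\<Pi>\<^sub>E i\<in>J. carrier (K i)" le_J one_J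
proof
  show "\<one>\<^bsub>K i0\<^esub> \<in> carrier (K i0)" "\<phi> z i0 \<in> carrier (K i0)" "\<phi> z i0 \<noteq> \<one>\<^bsub>K i0\<^esub>"
    using one_closed_K[OF i0(1)] phi_closed[OF z(1) i0(1)] phi_z_i0 .
  show "one_J \<in> (\<Pi>\<^sub>E i\<in>J. carrier (K i))" by (auto simp: one_J_def one_closed_K)
  show "power_le (K i0) a a" "power_le (K i0) \<one>\<^bsub>K i0\<^esub> a" for a
    using power_le_K_refl[OF i0(1)] one_power_le_K[OF i0(1)] by blast+
  show "power_le (K i0) a \<one>\<^bsub>K i0\<^esub> \<Longrightarrow> a = \<one>\<^bsub>K i0\<^esub>" for a using power_le_one_K[OF i0(1)] by blast
  show "a \<in> carrier (K i0) \<Longrightarrow> a \<noteq> \<one>\<^bsub>K i0\<^esub> \<Longrightarrow> power_le (K i0) (\<phi> z i0) a" for a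
    by (rule phi_z_power_le)
  show "power_le (K i0) a (\<phi> z i0) \<Longrightarrow> a = \<one>\<^bsub>K i0\<^esub> \<or> a = \<phi> z i0" for a
    by (rule power_le_phi_z)
  show "le_J h h" for h using power_le_K_refl by (simp add: le_J_def)
  show "le_J one_J h" for h using one_power_le_K by (simp add: le_J_def one_J_def)
  fix h assume h: "h \<in> (\<Pi>\<^sub>E i\<in>J. carrier (K i))"
  then have hi: "h i \<in> carrier (K i)" if "i \<in> J" for i using that by (rule PiE_mem)
  show "h = one_J" if "le_J h one_J"
    using that power_le_one_K by (intro one_J_eqI[OF h]) (simp add: le_J_def one_J_def)
  \<comment> \<open>The witness is the coordinatewise inverse: it generates the same subgroup in
    each coordinate and, as these groups have odd order, differs from any nontrivial
    \<open>h\<close>.\<close>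
  show "\<exists>t\<in>\<Pi>\<^sub>E i\<in>J. carrier (K i). t \<noteq> h \<and> le_J t h \<and> le_J h t" if "h \<noteq> one_J"
  proof (intro bexI conjI)
    let ?t = "\<lambda>i\<in>J. inv\<^bsub>K i\<^esub> (h i)"
    have inv_closed: "inv\<^bsub>K i\<^esub> (h i) \<in> carrier (K i)" if "i \<in> J" for i
      using group.inv_closed[OF K_group hi[OF that]] that by blast
    show "?t \<in> (\<Pi>\<^sub>E i\<in>J. carrier (K i))" using inv_closed by (simp add: restrict_PiE_iff)
    show "?t \<noteq> h"
    proof
      assume eq: "?t = h"
      have "h i = \<one>\<^bsub>K i\<^esub>" if "i \<in> J" for i
        using inv_eq_self_other[OF that hi[OF that]] fun_cong[OF eq, of i] that by simp
      then show False using one_J_eqI[OF h] \<open>h \<noteq> one_J\<close> by blast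
    qed
    have "power_le (K i) (inv\<^bsub>K i\<^esub> (h i)) (h i)" if "i \<in> J" for i
      using group.power_le_inv[OF K_group hi[OF that]] that by blast
    then show "le_J ?t h" by (simp add: le_J_def)
    have "power_le (K i) (h i) (inv\<^bsub>K i\<^esub> (h i))" if "i \<in> J" for i
      using group.power_le_inv[OF K_group inv_closed[OF that]] group.inv_inv[OF K_group hi[OF that]] that
      by simp
    then show "le_J h ?t" by (simp add: le_J_def)
  qed
  fix k l assume "k \<in> (\<Pi>\<^sub>E i\<in>J. carrier (K i))" and l: "l \<in> (\<Pi>\<^sub>E i\<in>J. carrier (K i))"
    and hkl: "le_J h k" "le_J k l"
  show "le_J h l"
    unfolding le_J_def
  proof
    fix i assume i: "i \<in> J"
    show "power_le (K i) (h i) (l i)"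
      using group.power_le_trans[OF K_group, of i "h i" "k i" "l i"] hkl i PiE_mem[OF l i]
      unfolding le_J_def by blast
  qed
qed

lemma compH_iff:
  "gen.compH f g \<longleftrightarrow> (\<forall>i\<in>J. power_joinable (K i) (f i) (g i))"
proof
  assume "gen.compH f g"
  then obtain l where l: "l \<in> (\<Pi>\<^sub>E i\<in>J. carrier (K i))" "le_J f l" "le_J g l"
    unfolding gen.compH_def by blast
  then show "\<forall>i\<in>J. power_joinable (K i) (f i) (g i)"
    using PiE_mem[OF l(1)] unfolding le_J_def power_joinable_def by blast
next
  assume "\<forall>i\<in>J. power_joinable (K i) (f i) (g i)"
  then have "\<forall>i\<in>J. \<exists>l. l \<in> carrier (K i) \<and> power_le (K i) (f i) l \<and> power_le (K i) (g i) l"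
    unfolding power_joinable_def by blast
  then obtain l where l: "\<And>i. i \<in> J \<Longrightarrow> l i \<in> carrier (K i) \<and> power_le (K i) (f i) (l i) \<and> power_le (K i) (g i) (l i)"
    by metis
  then have "restrict l J \<in> (\<Pi>\<^sub>E i\<in>J. carrier (K i))" by (simp add: restrict_PiE_iff)
  moreover have "le_J f (restrict l J)" "le_J g (restrict l J)" using l by (simp_all add: le_J_def)
  ultimately show "gen.compH f g" unfolding gen.compH_def by blast
qed

lemma split_i0_mem:
  "x \<in> carrier G \<Longrightarrow> \<phi> x i0 \<in> carrier (K i0)"
  "x \<in> carrier G \<Longrightarrow> restrict (\<phi> x) J \<in> (\<Pi>\<^sub>E i\<in>J. carrier (K i))"
  using phi_closed i0(1) by (auto simp: restrict_PiE_iff)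

lemma adj_split_i0_iff:
  assumes "x \<in> carrier G" "y \<in> carrier G"
  shows "gen.adj (split_i0 x) (split_i0 y) \<longleftrightarrow> (x, y) \<in> parcs D"
proof -
  have I: "(\<forall>i\<in>I. Q i) \<longleftrightarrow> Q i0 \<and> (\<forall>i\<in>J. Q i)" for Q using i0(1) by blast
  have le: "power_le G v w \<longleftrightarrow> power_le (K i0) (\<phi> v i0) (\<phi> w i0) \<and> le_J (restrict (\<phi> v) J) (restrict (\<phi> w) J)"
    if "v \<in> carrier G" "w \<in> carrier G" for v w
    unfolding power_le_phi_iff[OF that] le_J_def I[of "\<lambda>i. power_le (K i) (\<phi> v i) (\<phi> w i)"] by simp
  have "power_joinable G x y \<longleftrightarrow> gen.compA (\<phi> x i0) (\<phi> y i0) \<and> gen.compH (restrict (\<phi> x) J) (restrict (\<phi> y) J)"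
    unfolding power_joinable_phi_iff[OF assms] compH_iff gen.compA_def power_joinable_def[symmetric]
      I[of "\<lambda>i. power_joinable (K i) (\<phi> x i) (\<phi> y i)"] by simp
  then show ?thesis
    unfolding arc_difference_graph_iff gen.adj_def split_i0_def fst_conv snd_conv
    using assms le[OF assms] le[OF assms(2,1)] by blast
qed

lemma split_i0_inj:
  assumes "x \<in> carrier G" "y \<in> carrier G" "split_i0 x = split_i0 y"
  shows "x = y"
proof (rule phi_eqI[OF assms(1,2)])
  fix i assume i: "i \<in> I"
  have eq: "\<phi> x i0 = \<phi> y i0" "restrict (\<phi> x) J = restrict (\<phi> y) J"
    using assms(3) by (simp_all add: split_i0_def)
  show "\<phi> x i = \<phi> y i"
    using eq(1) fun_cong[OF eq(2), of i] i by (cases "i = i0") simp_all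
qed

lemma split_i0_surj:
  assumes "a \<in> carrier (K i0)" "h \<in> (\<Pi>\<^sub>E i\<in>J. carrier (K i))"
  obtains w where "w \<in> carrier G" "split_i0 w = (a, h)"
proof -
  have "(h(i0 := a)) i \<in> carrier (K i)" if "i \<in> I" for i
    using assms that PiE_mem[OF assms(2)] by simp
  then obtain w where w: "w \<in> carrier G" "\<And>i. i \<in> I \<Longrightarrow> \<phi> w i = (h(i0 := a)) i" using phi_surj by blast
  have "restrict (\<phi> w) J = h"
    using w(2) by (intro PiE_ext[OF split_i0_mem(2)[OF w(1)] assms(2)]) simp
  then have "split_i0 w = (a, h)" using w(2) i0(1) by (simp add: split_i0_def)
  then show ?thesis using that w(1) by blast
qed

lemma split_i0_z: "split_i0 z = (\<phi> z i0, one_J)"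
proof -
  have "restrict (\<phi> z) J = one_J"
    by (rule one_J_eqI[OF split_i0_mem(2)[OF z(1)]]) (use phi_z_other in simp)
  then show ?thesis by (simp add: split_i0_def)
qed

text \<open>Of the two vertices, \<open>x\<close> has odd order and \<open>y\<close> even order. The
  triviality of \<open>lowers x'\<close> leaves room for only one odd prime; that of
  \<open>lowers y'\<close> leaves nothing strictly between the identity and the maximal
  \<open>y'\<close>, which gives prime order.\<close>

lemma indistinguishable_structure:
  assumes x: "x \<in> pverts D" "(x, z) \<in> parcs D"
    and y: "y \<in> pverts D" "(y, z) \<notin> parcs D" "y \<noteq> z"
    and same: "\<And>w. w \<in> carrier G \<Longrightarrow> w \<noteq> x \<Longrightarrow> w \<noteq> y \<Longrightarrow> w \<noteq> z \<Longrightarrow>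
      (x, w) \<in> parcs D \<longleftrightarrow> (y, w) \<in> parcs D"
  shows "\<exists>a\<in>carrier (K i0). a \<noteq> \<one>\<^bsub>K i0\<^esub> \<and> a \<noteq> \<phi> z i0"
    and "\<exists>j\<in>J. J = {j} \<and> (\<exists>g\<in>maximal_cyclic_generators (K j). prime (card (generate (K j) {g})))"
proof -
  interpret D: pair_graph D by (rule D_pair_graph)
  have xG: "x \<in> carrier G" "x \<noteq> \<one>" and yG: "y \<in> carrier G" "y \<noteq> \<one>" using x y pverts_eq by blast+
  define x' where "x' = restrict (\<phi> x) J"
  define y' where "y' = restrict (\<phi> y) J"
  define b where "b = \<phi> y i0"
  have x': "x' \<in> (\<Pi>\<^sub>E i\<in>J. carrier (K i))" and y': "y' \<in> (\<Pi>\<^sub>E i\<in>J. carrier (K i))"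
    and b: "b \<in> carrier (K i0)"
    using split_i0_mem xG yG by (simp_all add: x'_def y'_def b_def)
  have "\<phi> x i0 = \<one>\<^bsub>K i0\<^esub>" using x(2) D.arc_sym z_arc_iff by blast
  then have sx: "split_i0 x = (\<one>\<^bsub>K i0\<^esub>, x')" by (simp add: split_i0_def x'_def)
  have sy: "split_i0 y = (b, y')" by (simp add: split_i0_def b_def y'_def)
  have "b \<noteq> \<one>\<^bsub>K i0\<^esub>" using y(2) yG D.arc_sym z_arc_iff by (auto simp: b_def)
  have "split_i0 \<one> = (\<one>\<^bsub>K i0\<^esub>, one_J)"
    using one_J_eqI[OF split_i0_mem(2)[OF one_closed]] phi_one i0(1) by (simp add: split_i0_def)
  then have "x' \<noteq> one_J" using split_i0_inj[OF xG(1) one_closed] xG(2) sx by auto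
  have "(b, y') \<noteq> (\<phi> z i0, one_J)"
    using split_i0_inj[OF yG(1) z(1)] y(3) unfolding sy split_i0_z by blast
  have indist: "\<forall>w\<in>carrier (K i0) \<times> (\<Pi>\<^sub>E i\<in>J. carrier (K i)) -
      {(\<one>\<^bsub>K i0\<^esub>, x'), (b, y'), (\<phi> z i0, one_J)}.
    gen.adj (\<one>\<^bsub>K i0\<^esub>, x') w \<longleftrightarrow> gen.adj (b, y') w"
  proof
    fix w assume w: "w \<in> carrier (K i0) \<times> (\<Pi>\<^sub>E i\<in>J. carrier (K i)) -
      {(\<one>\<^bsub>K i0\<^esub>, x'), (b, y'), (\<phi> z i0, one_J)}"
    then have "fst w \<in> carrier (K i0)" "snd w \<in> (\<Pi>\<^sub>E i\<in>J. carrier (K i))"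
      by (simp_all add: mem_Times_iff)
    then obtain v where "v \<in> carrier G" "split_i0 v = (fst w, snd w)" by (rule split_i0_surj)
    then have v: "v \<in> carrier G" "split_i0 v = w" by simp_all
    have "v \<noteq> x" "v \<noteq> y" "v \<noteq> z" using w
      unfolding v(2)[symmetric] sx[symmetric] sy[symmetric] split_i0_z[symmetric] by blast+
    then show "gen.adj (\<one>\<^bsub>K i0\<^esub>, x') w \<longleftrightarrow> gen.adj (b, y') w"
      using same[OF v(1)] adj_split_i0_iff[OF xG(1) v(1)] adj_split_i0_iff[OF yG(1) v(1)]
      unfolding sx sy v(2) by blast
  qed
  obtain w where "(y, w) \<in> parcs D" using y(1) pverts_difference_graph_iff by blast
  then have w: "w \<in> carrier G" "(y, w) \<in> parcs D" using arc_difference_graph_iff by blast+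
  have "gen.adj (b, y') (\<phi> w i0, restrict (\<phi> w) J)"
    using adj_split_i0_iff[OF yG(1) w(1)] w(2) unfolding sy by (simp add: split_i0_def)
  note ind = gen.indistinguishable[OF x' \<open>x' \<noteq> one_J\<close> b \<open>b \<noteq> \<one>\<^bsub>K i0\<^esub>\<close> y'
      \<open>(b, y') \<noteq> (\<phi> z i0, one_J)\<close> indist split_i0_mem[OF w(1)] this]
  show "\<exists>a\<in>carrier (K i0). a \<noteq> \<one>\<^bsub>K i0\<^esub> \<and> a \<noteq> \<phi> z i0" by (rule ind(1))
  obtain j where j: "j \<in> J" "x' j \<noteq> \<one>\<^bsub>K j\<^esub>" using one_J_eqI[OF x'] \<open>x' \<noteq> one_J\<close> by blast
  have J: "J = {j}"
  proof (rule ccontr)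
    assume "J \<noteq> {j}"
    then obtain i where i: "i \<in> J" "i \<noteq> j" using j(1) by blast
    \<comment> \<open>A nontrivial element above \<open>x' i\<close>: supported on \<open>i\<close>
      alone, it stays joinable with \<open>x'\<close> but is not above it, as coordinate
      \<open>j\<close> is missing. So it would be a nontrivial member of
      \<open>lowers x'\<close>.\<close>
    obtain u where u: "u \<in> carrier (K i)" "u \<noteq> \<one>\<^bsub>K i\<^esub>" "power_le (K i) (x' i) u"
    proof (cases "x' i = \<one>\<^bsub>K i\<^esub>")
      case True
      then show ?thesis using K_nontrivial[of i] i(1) one_power_le_K[of i] that by auto
    next
      case False
      then show ?thesis using that PiE_mem[OF x' i(1)] i(1) power_le_K_refl[of i] by auto
    qed
    define w where "w = one_J(i := u)"
    have w: "w \<in> (\<Pi>\<^sub>E i\<in>J. carrier (K i))"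
      using gen.H u(1) i(1) by (auto simp: w_def PiE_iff extensional_def)
    have "gen.compH w x'"
      unfolding compH_iff
    proof
      fix l assume l: "l \<in> J"
      then have lI: "l \<in> I" by blast
      show "power_joinable (K l) (w l) (x' l)"
      proof (cases "l = i")
        case True
        then show ?thesis
          using power_joinable_K_I[OF lI] u power_le_K_refl[OF lI] by (simp add: w_def)
      next
        case False
        then show ?thesis
          using power_joinable_K_I[OF lI PiE_mem[OF x' l]] power_le_K_refl[OF lI] one_power_le_K[OF lI] l
          by (simp add: w_def one_J_def)
      qed
    qed
    moreover have "\<not> le_J x' w"
    proof -
      have "w j = \<one>\<^bsub>K j\<^esub>" using j(1) i(2) by (simp add: w_def one_J_def)
      then have "\<not> power_le (K j) (x' j) (w j)" using j power_le_one_K[of j] by simp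
      then show ?thesis using j(1) unfolding le_J_def by blast
    qed
    ultimately have "w \<in> gen.lowers x'" using w by (simp add: gen.lowers_def)
    then have "w = one_J" using ind(4) by blast
    from fun_cong[OF this, of i] have "u = \<one>\<^bsub>K i\<^esub>" using i(1) by (simp add: w_def one_J_def)
    then show False using u(2) by blast
  qed
  have jI: "j \<in> I" using j(1) by blast
  interpret Kj: group "K j" using K_group[OF jI] .
  define g where "g = y' j"
  have g: "g \<in> carrier (K j)" unfolding g_def using PiE_mem[OF y' j(1)] .
  have le_J: "le_J f h \<longleftrightarrow> power_le (K j) (f j) (h j)" for f h
    unfolding le_J_def J by simp
  have const: "(\<lambda>i\<in>J. h) \<in> (\<Pi>\<^sub>E i\<in>J. carrier (K i))" if "h \<in> carrier (K j)" for h
    using that by (simp add: J restrict_PiE_iff)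
  have const_j: "(\<lambda>i\<in>J. h) j = h" for h using j(1) by simp
  have g1: "g \<noteq> \<one>\<^bsub>K j\<^esub>"
  proof
    assume "g = \<one>\<^bsub>K j\<^esub>"
    then have "y' = one_J" using J by (intro one_J_eqI[OF y']) (simp add: g_def)
    then show False using ind(2) by blast
  qed
  have max: "g \<in> maximal_cyclic_generators (K j)"
    unfolding Kj.maximal_cyclic_generators_iff
  proof (intro conjI g ballI impI)
    fix h assume h: "h \<in> carrier (K j)" "power_le (K j) g h"
    then show "power_le (K j) h g"
      using bspec[OF ind(3) const[OF h(1)]] unfolding le_J const_j g_def by blast
  qed
  let ?n = "Kj.ord g"
  have "?n \<noteq> 1" using g1 Kj.ord_eq_1[OF g] by blast
  \<comment> \<open>Because \<open>q\<close> divides the order, the \<open>q\<close>-th power of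
    \<open>g\<close> lies strictly below \<open>g\<close>. It must then be the identity, and the
    order of \<open>g\<close> is \<open>q\<close>.\<close>
  then obtain q where q: "prime q" "q dvd ?n" using prime_factor_nat by blast
  have wg: "power_le (K j) (g [^]\<^bsub>K j\<^esub> q) g"
    using Kj.power_le_iff[OF g] by (metis int_pow_int)
  have nle: "\<not> power_le (K j) g (g [^]\<^bsub>K j\<^esub> q)"
  proof
    assume "power_le (K j) g (g [^]\<^bsub>K j\<^esub> q)"
    then obtain k :: int where k: "g = (g [^]\<^bsub>K j\<^esub> q) [^]\<^bsub>K j\<^esub> k"
      using Kj.power_le_iff[of "g [^]\<^bsub>K j\<^esub> q"] g by blast
    also have "\<dots> = (g [^]\<^bsub>K j\<^esub> int q) [^]\<^bsub>K j\<^esub> k" by (simp add: int_pow_int)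
    also have "\<dots> = g [^]\<^bsub>K j\<^esub> (int q * k)" using g by (simp add: Kj.int_pow_pow)
    finally have "g [^]\<^bsub>K j\<^esub> (1::int) = g [^]\<^bsub>K j\<^esub> (int q * k)" using g by simp
    then have "int ?n dvd int q * k - 1" unfolding Kj.int_pow_eq[OF g] .
    moreover have "int q dvd int ?n" using q(2) by simp
    ultimately have "int q dvd int q * k - 1" by (rule dvd_trans[rotated])
    then have "int q dvd 1" using dvd_diff_right_iff[of "int q" "int q * k" 1] by simp
    then show False using q(1) by auto
  qed
  have "(\<lambda>i\<in>J. g [^]\<^bsub>K j\<^esub> q) \<in> gen.lowers y'"
    unfolding gen.lowers_def
  proof (intro CollectI conjI const)
    show "g [^]\<^bsub>K j\<^esub> q \<in> carrier (K j)" using g by simp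
    show "\<not> le_J y' (\<lambda>i\<in>J. g [^]\<^bsub>K j\<^esub> q)" using nle unfolding le_J const_j g_def .
    show "gen.compH (\<lambda>i\<in>J. g [^]\<^bsub>K j\<^esub> q) y'"
      using gen.compH_le[OF const[of "g [^]\<^bsub>K j\<^esub> q"] y'] g wg unfolding le_J const_j g_def by simp
  qed
  then have "(\<lambda>i\<in>J. g [^]\<^bsub>K j\<^esub> q) = one_J" using ind(5) by blast
  from fun_cong[OF this, of j] have "g [^]\<^bsub>K j\<^esub> q = \<one>\<^bsub>K j\<^esub>"
    using j(1) by (simp add: one_J_def)
  then have "?n dvd q" using Kj.pow_eq_id[OF g] by blast
  then have "?n = q" using q(1) \<open>?n \<noteq> 1\<close> prime_nat_iff[of q] by blast
  then have "prime (card (generate (K j) {g}))" using Kj.generate_pow_card[OF g] q(1) by simp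
  then show "\<exists>j\<in>J. J = {j} \<and> (\<exists>g\<in>maximal_cyclic_generators (K j). prime (card (generate (K j) {g})))"
    using J j(1) max by blast
qed

end

section \<open>Pairs left unresolved by the nonrepresentatives\<close>

context nilpotent_product
begin

text \<open>Each vertex that distinguishes the neighbourhoods is alone in its twin class, hence is
  the unique involution. So there is just one such vertex, and off \<open>z\<close> the
  neighbourhoods agree.\<close>

lemma unresolved_distinguished_by_involution:
  assumes T: "system_of_representatives T (twin_classes D)"
    and xy: "x \<in> pverts D" "y \<in> pverts D" "x \<noteq> y"
    and unres: "\<And>z. z \<in> pverts D - T \<Longrightarrow> \<not> resolves D z x y"
  obtains z i0 where "nilpotent_product_one_involution G I K p \<phi> z i0"
    "z \<noteq> x" "z \<noteq> y" "(x, z) \<in> parcs D \<longleftrightarrow> (y, z) \<notin> parcs D"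
    "\<And>w. w \<in> carrier G \<Longrightarrow> w \<noteq> x \<Longrightarrow> w \<noteq> y \<Longrightarrow> w \<noteq> z \<Longrightarrow> (x, w) \<in> parcs D \<longleftrightarrow> (y, w) \<in> parcs D"
proof -
  interpret D: pair_graph D by (rule D_pair_graph)
  have sing: "v = w" if "w \<noteq> x" "w \<noteq> y" "(x, w) \<in> parcs D \<longleftrightarrow> (y, w) \<notin> parcs D" "(w, v) \<in> twin_rel D" for w v
    by (rule D.unresolved_pair(2)[OF T xy _ that]) (use unres in blast)
  have inv: "w \<in> pverts D \<and> (\<forall>v. (w, v) \<in> twin_rel D \<longrightarrow> v = w)"
    if "w \<noteq> x" "w \<noteq> y" "(x, w) \<in> parcs D \<longleftrightarrow> (y, w) \<notin> parcs D" for w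
    using sing[OF that] that(3) D.in_arcsD2 by blast
  have "\<exists>w. w \<noteq> x \<and> w \<noteq> y \<and> ((x, w) \<in> parcs D \<longleftrightarrow> (y, w) \<notin> parcs D)"
    by (rule D.unresolved_pair(1)[OF T xy]) (use unres in blast)
  then obtain z where z: "z \<noteq> x" "z \<noteq> y" "(x, z) \<in> parcs D \<longleftrightarrow> (y, z) \<notin> parcs D" by blast
  note zi = singleton_class_involution[OF conjunct1[OF inv[OF z]] conjunct2[OF inv[OF z]]]
  obtain i0 where i0: "i0 \<in> I" "p i0 = 2" using involution_component[OF zi(1,2,3)] by blast
  have "nilpotent_product_one_involution G I K p \<phi> z i0"
    by unfold_locales (use zi i0 in blast)+
  moreover have "(x, w) \<in> parcs D \<longleftrightarrow> (y, w) \<in> parcs D"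
    if w: "w \<in> carrier G" "w \<noteq> x" "w \<noteq> y" "w \<noteq> z" for w
  proof (rule ccontr)
    assume "\<not> ?thesis"
    then have dist: "(x, w) \<in> parcs D \<longleftrightarrow> (y, w) \<notin> parcs D" by blast
    note w_inv = inv[OF w(2,3) dist]
    note wi = singleton_class_involution[OF conjunct1[OF w_inv] conjunct2[OF w_inv]]
    show False using zi(4)[OF wi(1,3)] wi(2) w(4) by blast
  qed
  ultimately show ?thesis using that z by blast
qed

lemma unresolved_structure:
  assumes "system_of_representatives T (twin_classes D)"
    and "x \<in> pverts D" "y \<in> pverts D" "x \<noteq> y"
    and "\<And>z. z \<in> pverts D - T \<Longrightarrow> \<not> resolves D z x y"
  obtains i0 j g e z where "I = {i0, j}" "i0 \<noteq> j" "p i0 = 2"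
    "two_group_one_involution (K i0) e z" "order (K i0) > 2"
    "g \<in> maximal_cyclic_generators (K j)" "prime (card (generate (K j) {g}))"
proof -
  interpret D: pair_graph D by (rule D_pair_graph)
  obtain z i0 where nz: "nilpotent_product_one_involution G I K p \<phi> z i0"
    and z: "z \<noteq> x" "z \<noteq> y" "(x, z) \<in> parcs D \<longleftrightarrow> (y, z) \<notin> parcs D"
    and same: "\<And>w. w \<in> carrier G \<Longrightarrow> w \<noteq> x \<Longrightarrow> w \<noteq> y \<Longrightarrow> w \<noteq> z \<Longrightarrow> (x, w) \<in> parcs D \<longleftrightarrow> (y, w) \<in> parcs D"
    using unresolved_distinguished_by_involution[OF assms] by blast
  interpret Z: nilpotent_product_one_involution G I K p \<phi> z i0 by (rule nz)
  \<comment> \<open>The names are exchanged, if necessary, so that \<open>x'\<close> is the vertex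
    adjacent to \<open>z\<close>.\<close>
  obtain x' y' where x'y': "x' \<in> pverts D" "(x', z) \<in> parcs D" "y' \<in> pverts D" "(y', z) \<notin> parcs D" "y' \<noteq> z"
    and same': "\<And>w. w \<in> carrier G \<Longrightarrow> w \<noteq> x' \<Longrightarrow> w \<noteq> y' \<Longrightarrow> w \<noteq> z \<Longrightarrow> (x', w) \<in> parcs D \<longleftrightarrow> (y', w) \<in> parcs D"
  proof (cases "(x, z) \<in> parcs D")
    case True
    then show ?thesis using that[of x y] assms(2,3) z same by blast
  next
    case False
    then show ?thesis using that[of y x] assms(2,3) z same by blast
  qed
  note str = Z.indistinguishable_structure[OF x'y' same']
  obtain a where a: "a \<in> carrier (K i0)" "a \<noteq> \<one>\<^bsub>K i0\<^esub>" "a \<noteq> \<phi> z i0" using str(1) by blast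
  \<comment> \<open>Three different elements exclude a 2-factor of order 2.\<close>
  have "{\<one>\<^bsub>K i0\<^esub>, \<phi> z i0, a} \<subseteq> carrier (K i0)"
    using a(1) phi_closed[OF Z.z(1) Z.i0(1)] Z.one_closed_K[OF Z.i0(1)] by blast
  from card_mono[OF K_finite[OF Z.i0(1)] this] have "order (K i0) > 2"
    using a(2,3) Z.phi_z_i0 by (simp add: order_def)
  moreover obtain j g where j: "j \<in> I - {i0}" "I - {i0} = {j}" and
    g: "g \<in> maximal_cyclic_generators (K j)" "prime (card (generate (K j) {g}))"
    using str(2) by blast
  moreover obtain e where "two_group_one_involution (K i0) e (\<phi> z i0)"
    using Z.K_i0_one_involution by blast
  moreover have "I = {i0, j}" "i0 \<noteq> j" using j Z.i0(1) by blast+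
  ultimately show ?thesis using that Z.i0(2) by blast
qed

text \<open>A pair that the nonrepresentatives fail to resolve is distinguished by the adjacency to
  the only involution, so adding that involution resolves it.\<close>

lemma resolving_with_involution:
  assumes T: "system_of_representatives T (twin_classes D)"
    and z: "z \<in> carrier G" "z \<noteq> \<one>" "z \<otimes> z = \<one>" "z \<in> T"
  shows "resolving_set D ((pverts D - T) \<union> {z})"
  unfolding resolving_set_def
proof (intro conjI ballI impI)
  interpret D: pair_graph D by (rule D_pair_graph)
  have zV: "z \<in> pverts D" using involution_in_pverts z by blast
  then show "pverts D - T \<union> {z} \<subseteq> pverts D" by blast
  fix x y assume xy: "x \<in> pverts D" "y \<in> pverts D" "x \<noteq> y"
  show "\<exists>w\<in>pverts D - T \<union> {z}. resolves D w x y"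
  proof (rule ccontr)
    assume no: "\<not> ?thesis"
    then have unres: "\<And>w. w \<in> pverts D - T \<Longrightarrow> \<not> resolves D w x y" and noz: "\<not> resolves D z x y" by blast+
    obtain z' i0 where nz: "nilpotent_product_one_involution G I K p \<phi> z' i0"
      and z': "z' \<noteq> x" "z' \<noteq> y" "(x, z') \<in> parcs D \<longleftrightarrow> (y, z') \<notin> parcs D"
      using unresolved_distinguished_by_involution[OF T xy unres] by blast
    interpret Z: nilpotent_product_one_involution G I K p \<phi> z' i0 by (rule nz)
    have "z = z'" using Z.z_unique z by blast
    then show False using D.resolves_if_arc[OF z'] noz by blast
  qed
qed

lemma one_involution_representative:
  assumes T: "system_of_representatives T (twin_classes D)"
    and z: "z \<in> carrier G" "z \<noteq> \<one>" "z \<otimes> z = \<one>"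
    and uniq: "\<And>y. y \<in> carrier G \<Longrightarrow> y \<otimes> y = \<one> \<Longrightarrow> y = \<one> \<or> y = z"
  shows "z \<in> T"
proof -
  interpret D: pair_graph D by (rule D_pair_graph)
  obtain i0 where i0: "i0 \<in> I" "p i0 = 2" using involution_component[OF z] by blast
  interpret Z: nilpotent_product_one_involution G I K p \<phi> z i0
    by unfold_locales (use z uniq i0 in blast)+
  show ?thesis
    by (rule D.singleton_class_representative[OF T involution_in_pverts[OF z]]) (rule Z.z_class_singleton)
qed

end

section \<open>Nilpotency of subgroups and the involution of an exceptional group\<close>

lemma (in group) subgroup_nilpotent:
  assumes "nilpotent_group G" and H: "subgroup H G"
  shows "nilpotent_group (G\<lparr>carrier := H\<rparr>)"
proof -
  interpret H: group "G\<lparr>carrier := H\<rparr>" using H by (rule subgroup_imp_group)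
  \<comment> \<open>Commutators within \<open>H\<close> are among those of \<open>G\<close>, and
    subgroups generated inside \<open>H\<close> are the same in \<open>H\<close> and in
    \<open>G\<close>.\<close>
  have sub: "lower_central (G\<lparr>carrier := H\<rparr>) n \<subseteq> lower_central G n" for n
  proof (induction n)
    case 0
    then show ?case using subgroup.subset[OF H] by simp
  next
    case (Suc n)
    let ?comm = "\<lambda>A. \<Union>x\<in>A n. \<Union>y\<in>H. {x \<otimes> y \<otimes> inv x \<otimes> inv y}"
    let ?L = "lower_central (G\<lparr>carrier := H\<rparr>)"
    have L: "?L n \<subseteq> H" using H.lower_central_subset[of n] by simp
    have eq: "(\<Union>x\<in>?L n. \<Union>y\<in>H. {x \<otimes> y \<otimes> inv\<^bsub>G\<lparr>carrier := H\<rparr>\<^esub> x \<otimes> inv\<^bsub>G\<lparr>carrier := H\<rparr>\<^esub> y}) =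
      (\<Union>x\<in>?L n. \<Union>y\<in>H. {x \<otimes> y \<otimes> inv x \<otimes> inv y})"
      using m_inv_consistent[OF H] L by (intro SUP_cong refl) auto
    have "(\<Union>x\<in>?L n. \<Union>y\<in>H. {x \<otimes> y \<otimes> inv x \<otimes> inv y}) \<subseteq> H"
      by (intro UN_least) (use L subgroup.m_closed[OF H] subgroup.m_inv_closed[OF H] in \<open>simp add: subset_iff\<close>)
    then have "?L (Suc n) = generate G (\<Union>x\<in>?L n. \<Union>y\<in>H. {x \<otimes> y \<otimes> inv x \<otimes> inv y})"
      using generate_consistent[OF _ H] eq by simp
    also have "\<dots> \<subseteq> generate G (\<Union>x\<in>lower_central G n. \<Union>y\<in>carrier G. {x \<otimes> y \<otimes> inv x \<otimes> inv y})"
      using Suc subgroup.subset[OF H] by (intro mono_generate) blast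
    finally show ?case by simp
  qed
  obtain n where "lower_central G n = {\<one>}" using assms(1) by (auto simp: nilpotent_group_def)
  then have "lower_central (G\<lparr>carrier := H\<rparr>) n \<subseteq> {\<one>}" using sub by blast
  moreover have "\<one> \<in> lower_central (G\<lparr>carrier := H\<rparr>) n"
    by (cases n) (use subgroup.one_closed[OF H] generate.one[of "G\<lparr>carrier := H\<rparr>"] in auto)
  ultimately have "lower_central (G\<lparr>carrier := H\<rparr>) n = {\<one>\<^bsub>G\<lparr>carrier := H\<rparr>\<^esub>}" by auto
  then show ?thesis using H.is_group unfolding nilpotent_group_def by blast
qed

text \<open>The second component of an element with square one is trivial by odd order, so such
  elements correspond to those of \<open>A\<close>.\<close>

lemma DirProd_unique_involution:
  assumes "group G" "group A" "group B" and iso: "G \<cong> A \<times>\<times> B" and odd: "odd (order B)"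
    and involution: "\<exists>a\<in>carrier A. a \<noteq> \<one>\<^bsub>A\<^esub> \<and> a \<otimes>\<^bsub>A\<^esub> a = \<one>\<^bsub>A\<^esub> \<and>
      (\<forall>b\<in>carrier A. b \<otimes>\<^bsub>A\<^esub> b = \<one>\<^bsub>A\<^esub> \<longrightarrow> b = \<one>\<^bsub>A\<^esub> \<or> b = a)"
  shows "\<exists>z\<in>carrier G. z \<noteq> \<one>\<^bsub>G\<^esub> \<and> z \<otimes>\<^bsub>G\<^esub> z = \<one>\<^bsub>G\<^esub> \<and>
    (\<forall>y\<in>carrier G. y \<otimes>\<^bsub>G\<^esub> y = \<one>\<^bsub>G\<^esub> \<longrightarrow> y = \<one>\<^bsub>G\<^esub> \<or> y = z)"
proof -
  obtain a where a: "a \<in> carrier A" "a \<noteq> \<one>\<^bsub>A\<^esub>" "a \<otimes>\<^bsub>A\<^esub> a = \<one>\<^bsub>A\<^esub>"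
    and uniq: "\<And>b. b \<in> carrier A \<Longrightarrow> b \<otimes>\<^bsub>A\<^esub> b = \<one>\<^bsub>A\<^esub> \<Longrightarrow> b = \<one>\<^bsub>A\<^esub> \<or> b = a"
    using involution by blast
  interpret A: group A by fact
  interpret B: group B by fact
  interpret G: group G by fact
  obtain f where f: "f \<in> iso G (A \<times>\<times> B)" using iso by (auto simp: is_iso_def)
  interpret f: group_hom G "A \<times>\<times> B" f
    using f DirProd_group[OF A.is_group B.is_group] G.is_group
    by (simp add: group_hom_def group_hom_axioms_def iso_def)
  have bij: "bij_betw f (carrier G) (carrier A \<times> carrier B)" using f by (simp add: iso_def)
  have inj: "x = y" if "x \<in> carrier G" "y \<in> carrier G" "f x = f y" for x y
    using that inj_onD[OF bij_betw_imp_inj_on[OF bij]] by blast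
  have "(a, \<one>\<^bsub>B\<^esub>) \<in> f ` carrier G" using bij a(1) by (simp add: bij_betw_def)
  then obtain z where z: "z \<in> carrier G" "f z = (a, \<one>\<^bsub>B\<^esub>)" by (elim imageE) simp
  have "z \<noteq> \<one>\<^bsub>G\<^esub>"
  proof
    assume "z = \<one>\<^bsub>G\<^esub>"
    then show False using f.hom_one z(2) a(2) by simp
  qed
  moreover have "z \<otimes>\<^bsub>G\<^esub> z = \<one>\<^bsub>G\<^esub>"
    by (rule inj) (use z a(3) f.hom_mult[OF z(1,1)] f.hom_one in simp_all)
  moreover have "y = \<one>\<^bsub>G\<^esub> \<or> y = z" if y: "y \<in> carrier G" "y \<otimes>\<^bsub>G\<^esub> y = \<one>\<^bsub>G\<^esub>" for y
  proof -
    obtain b h where bh: "f y = (b, h)" by fastforce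
    then have mem: "b \<in> carrier A" "h \<in> carrier B" using f.hom_closed[OF y(1)] by simp_all
    have "(b \<otimes>\<^bsub>A\<^esub> b, h \<otimes>\<^bsub>B\<^esub> h) = (\<one>\<^bsub>A\<^esub>, \<one>\<^bsub>B\<^esub>)"
      using f.hom_mult[OF y(1,1)] f.hom_one y(2) bh by simp
    then have sq: "b \<otimes>\<^bsub>A\<^esub> b = \<one>\<^bsub>A\<^esub>" "h \<otimes>\<^bsub>B\<^esub> h = \<one>\<^bsub>B\<^esub>" by simp_all
    have "h = \<one>\<^bsub>B\<^esub>" by (rule B.square_one_odd_order[OF odd mem(2) sq(2)])
    moreover have "b = \<one>\<^bsub>A\<^esub> \<or> b = a" using uniq[OF mem(1) sq(1)] .
    ultimately have "f y = f \<one>\<^bsub>G\<^esub> \<or> f y = f z" using bh z(2) f.hom_one by auto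
    then show ?thesis using inj y(1) z(1) G.one_closed by blast
  qed
  ultimately show ?thesis using z(1) by blast
qed

lemma double_mod_eq_0:
  fixes b N :: int
  assumes "0 \<le> b" "b < 2 * N" "(b + b) mod (2 * N) = 0"
  shows "b = 0 \<or> b = N"
proof -
  have N: "N > 0" using assms(1,2) by linarith
  have "2 * N dvd b + b" using assms(3) by (rule mod_0_imp_dvd)
  then have "2 * N dvd 2 * b" by simp
  then obtain c where c: "b = N * c" by auto
  have "0 \<le> c" using assms(1) N c by (simp add: zero_le_mult_iff)
  moreover have "N * c < N * 2" using assms(2) c by (simp add: mult.commute)
  then have "c < 2" using N by simp
  ultimately have "c = 0 \<or> c = 1" by linarith
  then show ?thesis using c by auto
qed

lemma integer_mod_group_unique_involution:
  assumes "n > 0"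
  defines "Z \<equiv> integer_mod_group (2 ^ n)"
  shows "\<exists>a\<in>carrier Z. a \<noteq> \<one>\<^bsub>Z\<^esub> \<and> a \<otimes>\<^bsub>Z\<^esub> a = \<one>\<^bsub>Z\<^esub> \<and>
    (\<forall>b\<in>carrier Z. b \<otimes>\<^bsub>Z\<^esub> b = \<one>\<^bsub>Z\<^esub> \<longrightarrow> b = \<one>\<^bsub>Z\<^esub> \<or> b = a)"
proof -
  obtain k where n: "n = Suc k" using assms(1) not0_implies_Suc by blast
  define N :: int where "N = 2 ^ k"
  have N: "N > 0" "int (2 ^ n) = 2 * N" by (simp_all add: N_def n)
  have Z: "carrier Z = {0..<2 * N}" "\<one>\<^bsub>Z\<^esub> = 0" "a \<otimes>\<^bsub>Z\<^esub> b = (a + b) mod (2 * N)" for a b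
    using N(2) by (simp_all add: Z_def carrier_integer_mod_group)
  show ?thesis
    unfolding Z
  proof (intro bexI[of _ N] conjI ballI impI)
    fix b assume "b \<in> {0..<2 * N}" "(b + b) mod (2 * N) = 0"
    then show "b = 0 \<or> b = N" using double_mod_eq_0 by simp
  qed (use N(1) in auto)
qed

text \<open>Every element outside the cyclic half squares to \<open>(int m, False)\<close>, which is
  not the identity; so an involution lies in the cyclic half, where \<open>(int m, False)\<close> is
  the only one.\<close>

lemma generalized_quaternion_unique_involution:
  assumes "m > 0"
  defines "Q \<equiv> generalized_quaternion m"
  shows "\<exists>a\<in>carrier Q. a \<noteq> \<one>\<^bsub>Q\<^esub> \<and> a \<otimes>\<^bsub>Q\<^esub> a = \<one>\<^bsub>Q\<^esub> \<and>
    (\<forall>b\<in>carrier Q. b \<otimes>\<^bsub>Q\<^esub> b = \<one>\<^bsub>Q\<^esub> \<longrightarrow> b = \<one>\<^bsub>Q\<^esub> \<or> b = a)"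
proof -
  have Q: "carrier Q = {0..<2 * int m} \<times> UNIV" "\<one>\<^bsub>Q\<^esub> = (0, False)"
    by (simp_all add: Q_def generalized_quaternion_def)
  have sq_False: "(i, False) \<otimes>\<^bsub>Q\<^esub> (i, False) = ((i + i) mod (2 * int m), False)"
    and sq_True: "(i, True) \<otimes>\<^bsub>Q\<^esub> (i, True) = (int m, False)" for i
    using assms(1) by (simp_all add: Q_def generalized_quaternion_def)
  show ?thesis
    unfolding Q
  proof (intro bexI[of _ "(int m, False)"] conjI ballI impI)
    show "(int m, False) \<otimes>\<^bsub>Q\<^esub> (int m, False) = (0, False)" unfolding sq_False by simp
    fix b :: "int \<times> bool" assume b: "b \<in> {0..<2 * int m} \<times> UNIV" "b \<otimes>\<^bsub>Q\<^esub> b = (0, False)"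
    obtain i t where it: "b = (i, t)" by (rule prod.exhaust)
    have "\<not> t" using b(2) sq_True assms(1) unfolding it by (cases t) simp_all
    then show "b = (0, False) \<or> b = (int m, False)"
      using b double_mod_eq_0[of i "int m"] by (simp add: it sq_False)
  qed (use assms(1) in auto)
qed

lemma (in group) exceptional_group_unique_involution:
  assumes "exceptional_group G"
  obtains z where "z \<in> carrier G" "z \<noteq> \<one>" "z \<otimes> z = \<one>"
    "\<And>y. y \<in> carrier G \<Longrightarrow> y \<otimes> y = \<one> \<Longrightarrow> y = \<one> \<or> y = z"
proof -
  obtain q H where q: "prime q" "odd q" "sylow_subgroup q H G"
    and iso: "(\<exists>n>1. G \<cong> integer_mod_group (2 ^ n) \<times>\<times> G\<lparr>carrier := H\<rparr>) \<or>
      (\<exists>r\<ge>1. G \<cong> generalized_quaternion (2 ^ r) \<times>\<times> G\<lparr>carrier := H\<rparr>)"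
    using assms unfolding exceptional_group_def by blast
  have H: "subgroup H G" "odd (order (G\<lparr>carrier := H\<rparr>))"
    using q by (auto simp: sylow_subgroup_def order_def)
  have "\<exists>z\<in>carrier G. z \<noteq> \<one> \<and> z \<otimes> z = \<one> \<and> (\<forall>y\<in>carrier G. y \<otimes> y = \<one> \<longrightarrow> y = \<one> \<or> y = z)"
    using iso
  proof (elim disjE exE conjE)
    fix n :: nat assume n: "1 < n" and iso: "G \<cong> integer_mod_group (2 ^ n) \<times>\<times> G\<lparr>carrier := H\<rparr>"
    let ?Z = "integer_mod_group (2 ^ n)"
    have "\<exists>a\<in>carrier ?Z. a \<noteq> \<one>\<^bsub>?Z\<^esub> \<and> a \<otimes>\<^bsub>?Z\<^esub> a = \<one>\<^bsub>?Z\<^esub> \<and>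
        (\<forall>b\<in>carrier ?Z. b \<otimes>\<^bsub>?Z\<^esub> b = \<one>\<^bsub>?Z\<^esub> \<longrightarrow> b = \<one>\<^bsub>?Z\<^esub> \<or> b = a)"
      by (rule integer_mod_group_unique_involution) (use n in simp)
    with DirProd_unique_involution[OF is_group group_integer_mod_group subgroup_imp_group[OF H(1)] iso H(2)]
    show ?thesis by blast
  next
    fix r :: nat assume iso: "G \<cong> generalized_quaternion (2 ^ r) \<times>\<times> G\<lparr>carrier := H\<rparr>"
    let ?Q = "generalized_quaternion (2 ^ r)"
    have "\<exists>a\<in>carrier ?Q. a \<noteq> \<one>\<^bsub>?Q\<^esub> \<and> a \<otimes>\<^bsub>?Q\<^esub> a = \<one>\<^bsub>?Q\<^esub> \<and>
        (\<forall>b\<in>carrier ?Q. b \<otimes>\<^bsub>?Q\<^esub> b = \<one>\<^bsub>?Q\<^esub> \<longrightarrow> b = \<one>\<^bsub>?Q\<^esub> \<or> b = a)"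
      by (rule generalized_quaternion_unique_involution) simp
    with DirProd_unique_involution[OF is_group _ subgroup_imp_group[OF H(1)] iso H(2)]
    show ?thesis using generalized_quaternion_group[of "2 ^ r"] by simp
  qed
  then show ?thesis using that by blast
qed

lemma product_group_pair_iso:
  assumes "i \<noteq> j"
  shows "product_group {i, j} K \<cong> K i \<times>\<times> K j"
proof -
  let ?f = "\<lambda>f. (f i, f j)"
  have "?f \<in> hom (product_group {i, j} K) (K i \<times>\<times> K j)"
    by (auto simp: hom_def)
  moreover have "bij_betw ?f (carrier (product_group {i, j} K)) (carrier (K i \<times>\<times> K j))"
  proof (rule bij_betw_byWitness[where f' = "\<lambda>(a, b). \<lambda>l\<in>{i, j}. if l = i then a else b"])
    show "\<forall>f\<in>carrier (product_group {i, j} K).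
      (case (f i, f j) of (a, b) \<Rightarrow> \<lambda>l\<in>{i, j}. if l = i then a else b) = f"
      by (auto simp: PiE_iff extensional_def fun_eq_iff)
  qed (use assms in \<open>auto simp: PiE_iff extensional_def split: if_splits\<close>)
  ultimately have "?f \<in> iso (product_group {i, j} K) (K i \<times>\<times> K j)" by (simp add: iso_def)
  then show ?thesis by (rule is_isoI)
qed

theorem theorem2p7:
  fixes G :: "('a, 'b) monoid_scheme"
    and k :: nat and p :: "nat \<Rightarrow> nat" and P :: "nat \<Rightarrow> 'a set" and T :: "'a set"
  assumes "group G" and "finite (carrier G)" and "nilpotent_group G"
    and "k \<ge> 2"
    and "bij_betw p {1..k} {q. prime q \<and> q dvd order G}"
    and "\<And>i. i \<in> {1..k} \<Longrightarrow> sylow_subgroup (p i) (P i) G"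
    and "G \<cong> product_group {1..k} (\<lambda>i. G\<lparr>carrier := P i\<rparr>)"
    and "system_of_representatives T (twin_classes (difference_graph G))"
  shows "(exceptional_group G \<longrightarrow>
            (\<exists>!z. z \<in> T \<and> group.ord G z = 2) \<and>
            resolving_set (difference_graph G)
              ((pverts (difference_graph G) - T) \<union> {THE z. z \<in> T \<and> group.ord G z = 2}))
       \<and> (\<not> exceptional_group G \<longrightarrow>
            resolving_set (difference_graph G) (pverts (difference_graph G) - T))
       \<and> (let \<alpha> = int (order G)
                  - (int (\<Prod>i = 1..k. card (maximal_cyclic_generators (G\<lparr>carrier := P i\<rparr>)))
                     + int (card (twin_classes (difference_graph G))))
          in int (metric_dimension (difference_graph G)) \<in> {\<alpha>, \<alpha> - 1})"
proof -
  let ?K = "\<lambda>i. G\<lparr>carrier := P i\<rparr>"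
  interpret group G by fact
  have sylow: "prime (p i)" "subgroup (P i) G" "card (P i) = p i ^ multiplicity (p i) (order G)"
    if "i \<in> {1..k}" for i
    using assms(6)[OF that] by (auto simp: sylow_subgroup_def)
  \<comment> \<open>The exponent is positive because \<open>p\<close> takes its values among the
    prime divisors of the order; in particular every factor is nontrivial.\<close>
  have order_K: "\<exists>e>0. order (?K i) = p i ^ e" if i: "i \<in> {1..k}" for i
  proof -
    have "p i dvd order G" using bij_betwE[OF assms(5)] i by blast
    moreover have "order G \<noteq> 0" using assms(2) order_gt_0_iff_finite by simp
    ultimately have "multiplicity (p i) (order G) > 0"
      using sylow(1)[OF i] by (simp add: prime_multiplicity_gt_zero_iff)
    then show ?thesis using sylow(3)[OF i] by (auto simp: order_def)
  qed
  have two: "\<exists>j\<in>{1..k}. j \<noteq> i" for i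
    using assms(4) by (intro bexI[of _ "if i = 1 then 2 else 1"]) auto
  obtain \<phi> where \<phi>: "\<phi> \<in> iso G (product_group {1..k} ?K)" using assms(7) by (auto simp: is_iso_def)
  interpret N: nilpotent_product G "{1..k}" ?K p \<phi>
  proof unfold_locales
    show "finite (carrier G)" "finite {1..k}" "{1..k} \<noteq> {}" using assms(2,4) by auto
    show "inj_on p {1..k}" using assms(5) by (rule bij_betw_imp_inj_on)
    show "\<phi> \<in> iso G (product_group {1..k} ?K)" by (rule \<phi>)
    show "\<exists>j\<in>{1..k}. j \<noteq> i" for i by (rule two)
    fix i assume i: "i \<in> {1..k}"
    show "nilpotent_group (?K i)" by (rule subgroup_nilpotent[OF assms(3) sylow(2)[OF i]])
    show "prime (p i)" by (rule sylow(1)[OF i])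
    show "\<exists>e>0. order (?K i) = p i ^ e" by (rule order_K[OF i])
  qed
  let ?D = "difference_graph G"
  interpret D: pair_graph ?D by (rule N.D_pair_graph)
  note T = assms(8)
  have TV: "T \<subseteq> pverts ?D" by (rule D.representatives_subset[OF T])
  have ord2: "ord z = 2 \<longleftrightarrow> z \<noteq> \<one>\<^bsub>G\<^esub> \<and> z \<otimes>\<^bsub>G\<^esub> z = \<one>\<^bsub>G\<^esub>" if z: "z \<in> carrier G" for z
  proof -
    have "z \<otimes>\<^bsub>G\<^esub> z = \<one>\<^bsub>G\<^esub> \<longleftrightarrow> ord z dvd 2" using pow_eq_id[OF z, of 2] z by (simp add: numeral_2_eq_2)
    also have "\<dots> \<longleftrightarrow> ord z = 1 \<or> ord z = 2" using two_is_prime_nat prime_nat_iff by auto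
    finally show ?thesis using ord_eq_1[OF z] by auto
  qed
  have exc: "(\<exists>!z. z \<in> T \<and> ord z = 2) \<and>
      resolving_set ?D ((pverts ?D - T) \<union> {THE z. z \<in> T \<and> ord z = 2})"
    if exceptional: "exceptional_group G"
  proof -
    obtain z where z: "z \<in> carrier G" "z \<noteq> \<one>\<^bsub>G\<^esub>" "z \<otimes>\<^bsub>G\<^esub> z = \<one>\<^bsub>G\<^esub>"
      "\<And>y. y \<in> carrier G \<Longrightarrow> y \<otimes>\<^bsub>G\<^esub> y = \<one>\<^bsub>G\<^esub> \<Longrightarrow> y = \<one>\<^bsub>G\<^esub> \<or> y = z"
      using exceptional_group_unique_involution[OF exceptional] by blast
    have zT: "z \<in> T" by (rule N.one_involution_representative[OF T z])
    have uniq: "y = z" if "y \<in> T \<and> ord y = 2" for y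
    proof -
      have y: "y \<in> carrier G" using that TV N.pverts_eq by blast
      then have "y \<noteq> \<one>\<^bsub>G\<^esub>" "y \<otimes>\<^bsub>G\<^esub> y = \<one>\<^bsub>G\<^esub>" using ord2[OF y] that by blast+
      then show ?thesis using z(4)[OF y] by blast
    qed
    have zz: "z \<in> T \<and> ord z = 2" using zT ord2[OF z(1)] z(2,3) by blast
    then have the: "(THE z. z \<in> T \<and> ord z = 2) = z" using uniq by (rule the_equality)
    have "\<exists>!z. z \<in> T \<and> ord z = 2" using zz uniq by (rule ex1I)
    then show ?thesis
      unfolding the using N.resolving_with_involution[OF T z(1-3) zT] by (intro conjI)
  qed
  \<comment> \<open>By contraposition: an unresolved pair shows that there are just two factors, and
    replacing the 2-factor by its isomorphic standard form in the given decomposition makes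
    \<open>G\<close> exceptional.\<close>
  have non_exc: "resolving_set ?D (pverts ?D - T)" if not_exceptional: "\<not> exceptional_group G"
    unfolding resolving_set_def
  proof (intro conjI ballI impI)
    fix x y assume xy: "x \<in> pverts ?D" "y \<in> pverts ?D" "x \<noteq> y"
    show "\<exists>z\<in>pverts ?D - T. resolves ?D z x y"
    proof (rule ccontr)
      assume "\<not> ?thesis"
      then have unres: "\<And>z. z \<in> pverts ?D - T \<Longrightarrow> \<not> resolves ?D z x y" by blast
      obtain i0 j g e z where I: "{1..k} = {i0, j}" "i0 \<noteq> j" "p i0 = 2"
        and K_i0: "two_group_one_involution (?K i0) e z" "order (?K i0) > 2"
        and g: "g \<in> maximal_cyclic_generators (?K j)" "prime (card (generate (?K j) {g}))"
        by (rule N.unresolved_structure[OF T xy unres])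
      have cases: "(\<exists>n>1. ?K i0 \<cong> integer_mod_group (2 ^ n)) \<or> (\<exists>r\<ge>1. ?K i0 \<cong> generalized_quaternion (2 ^ r))"
        by (rule two_group_one_involution.cyclic_or_generalized_quaternion[OF K_i0])
      have ij: "i0 \<in> {1..k}" "j \<in> {1..k}" using I(1) by blast+
      have "p j \<noteq> 2" 
      proof
        assume "p j = 2"
        then have "p i0 = p j" using I(3) by (rule trans[OF _ sym, rotated])
        then show False using inj_onD[OF N.p_inj _ ij] I(2) by blast
      qed
      then have odd: "odd (p j)" using primes_dvd_imp_eq[OF two_is_prime_nat sylow(1)[OF ij(2)]] by auto
      interpret K0: group "?K i0" by (rule N.K_group[OF ij(1)])
      have "G \<cong> product_group {i0, j} ?K" using assms(7) unfolding I(1) .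
      also have "product_group {i0, j} ?K \<cong> ?K i0 \<times>\<times> ?K j" by (rule product_group_pair_iso[OF I(2)])
      finally have iso: "G \<cong> ?K i0 \<times>\<times> ?K j" .
      have "(\<exists>n>1. G \<cong> integer_mod_group (2 ^ n) \<times>\<times> ?K j) \<or>
          (\<exists>r\<ge>1. G \<cong> generalized_quaternion (2 ^ r) \<times>\<times> ?K j)"
        using cases
      proof (elim disjE exE conjE)
        fix n :: nat assume n: "1 < n" "?K i0 \<cong> integer_mod_group (2 ^ n)"
        have "G \<cong> integer_mod_group (2 ^ n) \<times>\<times> ?K j"
          by (rule iso_trans[OF iso K0.DirProd_iso_trans[OF n(2) iso_refl]])
        with n(1) show ?thesis by blast
      next
        fix r :: nat assume r: "1 \<le> r" "?K i0 \<cong> generalized_quaternion (2 ^ r)"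
        have "G \<cong> generalized_quaternion (2 ^ r) \<times>\<times> ?K j"
          by (rule iso_trans[OF iso K0.DirProd_iso_trans[OF r(2) iso_refl]])
        with r(1) show ?thesis by blast
      qed
      moreover have "maximal_cyclic_subgroup (generate (?K j) {g}) (?K j)"
        using g(1) by (simp add: maximal_cyclic_generators_def)
      ultimately have "exceptional_group G"
        unfolding exceptional_group_def using sylow(1)[OF ij(2)] odd assms(6)[OF ij(2)] g(2) by blast
      then show False using not_exceptional by blast
    qed
  qed blast
  have fin: "finite (pverts ?D)" by (rule D.pair_finite_verts)
  have cardT: "card (pverts ?D - T) + card (twin_classes ?D) = card (pverts ?D)"
    using card_Diff_subset[OF finite_subset[OF TV fin] TV] card_mono[OF fin TV]
      D.card_representatives[OF T] by linarith
  have "\<exists>S. resolving_set ?D S \<and> card S \<le> card (pverts ?D - T) + 1"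
  proof (cases "exceptional_group G")
    case True
    have "card ((pverts ?D - T) \<union> {THE z. z \<in> T \<and> ord z = 2}) \<le> card (pverts ?D - T) + 1"
      using card_Un_le[of "pverts ?D - T" "{THE z. z \<in> T \<and> ord z = 2}"] by simp
    with exc[OF True] show ?thesis by blast
  next
    case False
    then show ?thesis using non_exc by auto
  qed
  then obtain S where S: "resolving_set ?D S" "card S \<le> card (pverts ?D - T) + 1" by blast
  have "metric_dimension ?D \<le> card (pverts ?D - T) + 1" "card (pverts ?D - T) \<le> metric_dimension ?D"
    using D.metric_dimension_bounds[OF S(1)] S(2) cardT by linarith+
  then have "metric_dimension ?D = card (pverts ?D - T) + 1 \<or> metric_dimension ?D = card (pverts ?D - T)"
    by linarith
  \<comment> \<open>The identity is neither a vertex nor counted by the product, which is why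
    \<alpha> exceeds the number of nonrepresentatives by one.\<close>
  moreover have "int (card (pverts ?D - T)) + 1 = int (order G) -
      (int (\<Prod>i = 1..k. card (maximal_cyclic_generators (?K i))) + int (card (twin_classes ?D)))"
    using N.card_pverts cardT by linarith
  ultimately have "let \<alpha> = int (order G)
                  - (int (\<Prod>i = 1..k. card (maximal_cyclic_generators (?K i)))
                     + int (card (twin_classes ?D)))
          in int (metric_dimension ?D) \<in> {\<alpha>, \<alpha> - 1}"
    unfolding Let_def by auto
  then show ?thesis using exc non_exc by blast
qed

end
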